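(* Let $s\in\overline{\mathbf R_\flat}$ be such that $s<\frac12$, $W=\mathbf C^d\times\mathbf C^d$, and let $T_\#^{\mathrm{aw}}$ be the map from $\widehat{\mathcal A}_0(W)\times\widehat{\mathcal A}_0(W)$ to $\widehat A(W)$ given by $T_\#^{\mathrm{aw}}(a_1,a_2)=a_1\#_{\mathfrak V}^{\mathrm{aw}}a_2$, where $\#_{\mathfrak V}^{\mathrm{aw}}$ is the twisted anti-Wick product. Then $T_\#^{\mathrm{aw}}$ is uniquely extendable to continuous mappings $$\widehat{\mathcal A}_s(W)\times\widehat{\mathcal A}_s(W)\to\widehat{\mathcal A}_s(W),$$ $$\widehat{\mathcal C}_s(W)\times\widehat{\mathcal C}_s(W)\to\widehat{\mathcal C}_s(W),\qquad \widehat{\mathcal C}_s^\star(W)\times\widehat{\mathcal C}_s^\star(W)\to\widehat{\mathcal C}_s^\star(W).$$ If instead $0<s\le\frac12$, then the same holds true with $\widehat{\mathcal A}_{0,s}$ and $\widehat{\mathcal C}_{0,s}$ in place of $\widehat{\mathcal A}_s$ and $\widehat{\mathcal C}_s$, respectively, at each occurrence (and likewise for the $\star$-version).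
   Context: **Indices and weights.** $\mathbf N=\{0,1,2,\dots\}$. $\overline{\mathbf R_\flat}=[0,\infty)\cup\{\flat_\sigma:\sigma>0\}$, where the $\flat_\sigma$ are formal symbols, ordered so that $x_1<\flat_{\sigma_1}<\flat_{\sigma_2}<x_2$ whenever $x_1<\frac12\le x_2$ and $\sigma_1<\sigma_2$. For $r>0$ and $\alpha\in\mathbf N^d$: $\vartheta_{r,s}(\alpha)=e^{r|\alpha|^{1/(2s)}}$ if $s\in(0,\infty)$; $\vartheta_{r,s}(\alpha)=r^{|\alpha|}(\alpha!)^{1/(2\sigma)}$ if $s=\flat_\sigma$; $\vartheta_{r,0}(\alpha)=1$ if $|\alpha|\le r$ and $=\infty$ if $|\alpha|>r$. Conventions: $a/\infty=0$ for all $a\in(0,\infty]$, $\infty\cdot0=0$. For $\omega:\mathbf N^{2d}\to[0,\infty]$, $\ell_{[\omega]}$ is the set of $c:\mathbf N^{2d}\to\mathbf C$ with $\|c\,\omega\|_{\ell^p}<\infty$, with this (quasi-/semi-)norm, $p\in(0,\infty]$ fixed (the limit spaces below do not depend on $p$). **Spaces.** On $\mathbf N^{2d}=\mathbf N^d\times\mathbf N^d\ni(\alpha,\beta)$ put $\vartheta_r(\alpha,\beta)=\vartheta_{r,s}(\alpha)\vartheta_{r,s}(\beta)$, $\omega_{r_2,r_1}(\alpha,\beta)=\vartheta_{r_2,s}(\alpha)/\vartheta_{r_1,s}(\beta)$, $\omega^\star_{r_2,r_1}(\alpha,\beta)=\vartheta_{r_1,s}(\beta)/\vartheta_{r_2,s}(\alpha)$.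 With limits over positive parameters: $\ell_{\mathcal A,s}=\operatorname{ind\,lim}_r\ell_{[\vartheta_r]}$, $\ell_{\mathcal A,0,s}=\operatorname{proj\,lim}_r\ell_{[\vartheta_r]}$; $\ell_{\mathcal C,s}=\operatorname{ind\,lim}_{r_2}\operatorname{proj\,lim}_{r_1}\ell_{[\omega_{r_2,r_1}]}$, $\ell_{\mathcal C,0,s}=\operatorname{ind\,lim}_{r_1}\operatorname{proj\,lim}_{r_2}\ell_{[\omega_{r_2,r_1}]}$, $\ell_{\mathcal C,s}^\star=\operatorname{ind\,lim}_{r_1}\operatorname{proj\,lim}_{r_2}\ell_{[\omega^\star_{r_2,r_1}]}$, $\ell_{\mathcal C,0,s}^\star=\operatorname{ind\,lim}_{r_2}\operatorname{proj\,lim}_{r_1}\ell_{[\omega^\star_{r_2,r_1}]}$. As sets, projective/inductive limits are intersections/unions. With $e_\alpha(z)=z^\alpha/\sqrt{\alpha!}$, the spaces $\widehat{\mathcal A}_s(W),\widehat{\mathcal A}_{0,s}(W),\widehat{\mathcal C}_s(W),\widehat{\mathcal C}_{0,s}(W),\widehat{\mathcal C}_s^\star(W),\widehat{\mathcal C}_{0,s}^\star(W)$ consist of the formal series $a(z,w)=\sum c(a;\alpha,\beta)e_\alpha(z)e_\beta(\overline w)$ with coefficients in the sequence space with the same decorations, with transported topology. $\widehat{\mathcal A}_0(W)$ is the space of such series with finitely many non-zero coefficients; $\widehat A(W)$ is the set of functions $a(z,w)$ such that $(z,w)\mapsto a(z,\overline w)$ is entire. **Twisted anti-Wick product.** For $a\in\widehat{\mathcal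 A}_0(W)$ and a polynomial $F$ on $\mathbf C^d$, the anti-Wick operator is $\operatorname{Op}_{\mathfrak V}^{\mathrm{aw}}(a)F(z)=\pi^{-d}\int_{\mathbf C^d}a(w,w)F(w)e^{(z-w,w)}\,d\lambda(w)$, where $(z,w)=\sum_jz_j\overline{w_j}$ and $d\lambda$ is Lebesgue measure. For $a_1,a_2\in\widehat{\mathcal A}_0(W)$, $a_1\#_{\mathfrak V}^{\mathrm{aw}}a_2\in\widehat{\mathcal A}_0(W)$ is the unique symbol with $\operatorname{Op}_{\mathfrak V}^{\mathrm{aw}}(a_1)\circ\operatorname{Op}_{\mathfrak V}^{\mathrm{aw}}(a_2)=\operatorname{Op}_{\mathfrak V}^{\mathrm{aw}}(a_1\#_{\mathfrak V}^{\mathrm{aw}}a_2)$.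
   Formalization: For the C-spaces (all variants), continuity is on C×C with the inductive limit topology of the products of the steps, not the product topology: joint continuity fails there, as the (0,0) coefficient of a product is a pairing of a sequence space with its dual, not jointly continuous. *)

theory Defs
  imports "HOL-Analysis.Analysis"
begin

section \<open>The extended index set\<close>

text \<open>\<open>Num x\<close> is the number \<open>x\<close> and \<open>Flat \<sigma>\<close> is the formal symbol \<open>\<flat>\<^sub>\<sigma>\<close>; the admissible indices
  (\<open>x \<ge> 0\<close> and \<open>\<sigma> > 0\<close>) are singled out by \<open>R_flat\<close>. All flat symbols lie between the numbers
  below \<open>1/2\<close> and the numbers from \<open>1/2\<close> on.\<close>

datatype flat_index = Num real | Flat real

definition R_flat :: "flat_index set" where
  "R_flat = Num ` {0..} \<union> Flat ` {0<..}"

instantiation flat_index :: linorder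
begin

fun less_flat_index :: "flat_index \<Rightarrow> flat_index \<Rightarrow> bool" where
  "less_flat_index (Num x) (Num y) \<longleftrightarrow> x < y"
| "less_flat_index (Num x) (Flat \<sigma>) \<longleftrightarrow> x < 1/2"
| "less_flat_index (Flat \<sigma>) (Num y) \<longleftrightarrow> 1/2 \<le> y"
| "less_flat_index (Flat \<sigma>) (Flat \<tau>) \<longleftrightarrow> \<sigma> < \<tau>"

definition less_eq_flat_index :: "flat_index \<Rightarrow> flat_index \<Rightarrow> bool" where
  "less_eq_flat_index s t \<longleftrightarrow> s < t \<or> s = t"

instance
proof
  fix x y z :: flat_index
  show "(x < y) = (x \<le> y \<and> \<not> y \<le> x)"
    by (cases x; cases y) (auto simp: less_eq_flat_index_def)
  show "x \<le> x"
    by (simp add: less_eq_flat_index_def)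
  show "x \<le> y \<Longrightarrow> y \<le> z \<Longrightarrow> x \<le> z"
    by (cases x; cases y; cases z) (auto simp: less_eq_flat_index_def)
  show "x \<le> y \<Longrightarrow> y \<le> x \<Longrightarrow> x = y"
    by (cases x; cases y) (auto simp: less_eq_flat_index_def)
  show "x \<le> y \<or> y \<le> x"
    by (cases x; cases y) (auto simp: less_eq_flat_index_def)
qed

end


section \<open>Multi-indices and weights\<close>

type_synonym 'd mindex = "nat ^ 'd"

definition mi_abs :: "('d::finite) mindex \<Rightarrow> nat" where
  "mi_abs \<alpha> = (\<Sum>i\<in>UNIV. \<alpha> $ i)"

definition mi_fact :: "('d::finite) mindex \<Rightarrow> real" where
  "mi_fact \<alpha> = (\<Prod>i\<in>UNIV. fact (\<alpha> $ i))"

definition mi_power :: "complex ^ 'd \<Rightarrow> ('d::finite) mindex \<Rightarrow> complex" where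
  "mi_power z \<alpha> = (\<Prod>i\<in>UNIV. (z $ i) ^ (\<alpha> $ i))"

fun theta :: "real \<Rightarrow> flat_index \<Rightarrow> ('d::finite) mindex \<Rightarrow> ennreal" where
  "theta r (Num s) \<alpha> =
     (if s = 0 then (if real (mi_abs \<alpha>) \<le> r then 1 else \<infinity>)
      else ennreal (exp (r * real (mi_abs \<alpha>) powr (1 / (2 * s)))))"
| "theta r (Flat \<sigma>) \<alpha> = ennreal (r ^ mi_abs \<alpha> * mi_fact \<alpha> powr (1 / (2 * \<sigma>)))"

text \<open>A formal series \<open>\<Sum> c(\<alpha>,\<beta>) e\<^sub>\<alpha>(z) e\<^sub>\<beta>(w-bar)\<close> is identified with its coefficient family \<open>c\<close>, so
  that the series spaces with the transported topology are the sequence spaces themselves.\<close>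

type_synonym 'd fseries = "'d mindex \<times> 'd mindex \<Rightarrow> complex"

text \<open>In \<^typ>\<open>ennreal\<close> one has \<open>a / \<infinity> = 0\<close> for every \<open>a\<close> (also \<open>\<infinity> / \<infinity> = 0\<close>) and \<open>\<infinity> * 0 = 0\<close>, as
  needed for the quotient weights at \<open>s = 0\<close>.\<close>

definition weight_A :: "flat_index \<Rightarrow> real \<Rightarrow> ('d::finite) mindex \<times> 'd mindex \<Rightarrow> ennreal" where
  "weight_A s r = (\<lambda>(\<alpha>, \<beta>). theta r s \<alpha> * theta r s \<beta>)"

definition weight_C :: "flat_index \<Rightarrow> real \<Rightarrow> real \<Rightarrow> ('d::finite) mindex \<times> 'd mindex \<Rightarrow> ennreal" where
  "weight_C s r2 r1 = (\<lambda>(\<alpha>, \<beta>). theta r2 s \<alpha> / theta r1 s \<beta>)"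

definition weight_C_star :: "flat_index \<Rightarrow> real \<Rightarrow> real \<Rightarrow> ('d::finite) mindex \<times> 'd mindex \<Rightarrow> ennreal" where
  "weight_C_star s r2 r1 = (\<lambda>(\<alpha>, \<beta>). theta r1 s \<beta> / theta r2 s \<alpha>)"


section \<open>Weighted sequence spaces\<close>

definition ennreal_powr :: "ennreal \<Rightarrow> real \<Rightarrow> ennreal" where
  "ennreal_powr x q = (if x = \<infinity> then \<infinity> else ennreal (enn2real x powr q))"

definition lp_norm :: "ennreal \<Rightarrow> ('k \<Rightarrow> ennreal) \<Rightarrow> ennreal" where
  "lp_norm p f =
     (if p = \<infinity> then (SUP k. f k)
      else ennreal_powr (\<Sum>\<^sub>\<infinity>k. ennreal_powr (f k) (enn2real p)) (1 / enn2real p))"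

definition weighted_norm :: "ennreal \<Rightarrow> ('k \<Rightarrow> ennreal) \<Rightarrow> ('k \<Rightarrow> complex) \<Rightarrow> ennreal" where
  "weighted_norm p \<omega> c = lp_norm p (\<lambda>k. ennreal (cmod (c k)) * \<omega> k)"

definition ell :: "ennreal \<Rightarrow> ('k \<Rightarrow> ennreal) \<Rightarrow> ('k \<Rightarrow> complex) set" where
  "ell p \<omega> = {c. weighted_norm p \<omega> c < \<infinity>}"

definition ell_top :: "ennreal \<Rightarrow> ('k \<Rightarrow> ennreal) \<Rightarrow> ('k \<Rightarrow> complex) topology" where
  "ell_top p \<omega> = topology (\<lambda>U. U \<subseteq> ell p \<omega> \<and>
     (\<forall>x\<in>U. \<exists>e>0. \<forall>y\<in>ell p \<omega>. weighted_norm p \<omega> (\<lambda>k. y k - x k) < e \<longrightarrow> y \<in> U))"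

lemma openin_ell_top:
  "openin (ell_top p \<omega>) U \<longleftrightarrow> U \<subseteq> ell p \<omega> \<and>
     (\<forall>x\<in>U. \<exists>e>0. \<forall>y\<in>ell p \<omega>. weighted_norm p \<omega> (\<lambda>k. y k - x k) < e \<longrightarrow> y \<in> U)"
proof -
  have "istopology (\<lambda>U. U \<subseteq> ell p \<omega> \<and>
     (\<forall>x\<in>U. \<exists>e>0. \<forall>y\<in>ell p \<omega>. weighted_norm p \<omega> (\<lambda>k. y k - x k) < e \<longrightarrow> y \<in> U))"
    (is "istopology ?P")
    unfolding istopology_def
  proof (intro conjI allI impI)
    fix S T assume S: "?P S" and T: "?P T"
    show "S \<inter> T \<subseteq> ell p \<omega>" using S by blast
    show "\<forall>x\<in>S \<inter> T. \<exists>e>0. \<forall>y\<in>ell p \<omega>. weighted_norm p \<omega> (\<lambda>k. y k - x k) < e \<longrightarrow> y \<in> S \<inter> T"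
    proof
      fix x assume x: "x \<in> S \<inter> T"
      obtain d where d: "d > 0" "\<forall>y\<in>ell p \<omega>. weighted_norm p \<omega> (\<lambda>k. y k - x k) < d \<longrightarrow> y \<in> S"
        using S x by blast
      obtain e where e: "e > 0" "\<forall>y\<in>ell p \<omega>. weighted_norm p \<omega> (\<lambda>k. y k - x k) < e \<longrightarrow> y \<in> T"
        using T x by blast
      show "\<exists>e>0. \<forall>y\<in>ell p \<omega>. weighted_norm p \<omega> (\<lambda>k. y k - x k) < e \<longrightarrow> y \<in> S \<inter> T"
        using d e by (intro exI[of _ "min d e"]) auto
    qed
  next
    fix \<K> assume K: "\<forall>K\<in>\<K>. ?P K"
    show "\<Union>\<K> \<subseteq> ell p \<omega>" using K by blast
    show "\<forall>x\<in>\<Union>\<K>. \<exists>e>0. \<forall>y\<in>ell p \<omega>. weighted_norm p \<omega> (\<lambda>k. y k - x k) < e \<longrightarrow> y \<in> \<Union>\<K>"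
    proof
      fix x assume "x \<in> \<Union>\<K>"
      then obtain K where "K \<in> \<K>" "x \<in> K" by blast
      then obtain e where "e > 0" "\<forall>y\<in>ell p \<omega>. weighted_norm p \<omega> (\<lambda>k. y k - x k) < e \<longrightarrow> y \<in> K"
        using K by blast
      then show "\<exists>e>0. \<forall>y\<in>ell p \<omega>. weighted_norm p \<omega> (\<lambda>k. y k - x k) < e \<longrightarrow> y \<in> \<Union>\<K>"
        using \<open>K \<in> \<K>\<close> by blast
    qed
  qed
  then show ?thesis
    by (simp add: ell_top_def topology_inverse')
qed

lemma topspace_ell_top [simp]: "topspace (ell_top p \<omega>) = ell p \<omega>"
proof
  show "topspace (ell_top p \<omega>) \<subseteq> ell p \<omega>"
    using openin_ell_top openin_topspace by blast
  have "openin (ell_top p \<omega>) (ell p \<omega>)"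
    unfolding openin_ell_top using zero_less_one by blast
  then show "ell p \<omega> \<subseteq> topspace (ell_top p \<omega>)"
    by (rule openin_subset)
qed


section \<open>Projective and inductive limits\<close>

definition proj_lim :: "'i set \<Rightarrow> ('i \<Rightarrow> 'a topology) \<Rightarrow> 'a topology" where
  "proj_lim I X = topology_generated_by
     {U \<inter> (\<Inter>j\<in>I. topspace (X j)) | U i. i \<in> I \<and> openin (X i) U}"

lemma topspace_proj_lim:
  assumes "I \<noteq> {}"
  shows "topspace (proj_lim I X) = (\<Inter>i\<in>I. topspace (X i))"
  unfolding proj_lim_def topology_generated_by_topspace using assms by blast

definition abs_convex :: "('k \<Rightarrow> complex) set \<Rightarrow> bool" where
  "abs_convex V \<longleftrightarrow>
     (\<forall>x\<in>V. \<forall>y\<in>V. \<forall>a b. cmod a + cmod b \<le> 1 \<longrightarrow> (\<lambda>k. a * x k + b * y k) \<in> V)"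

text \<open>A neighbourhood base at \<open>0\<close> of the locally convex inductive limit, i.e. of the finest locally
  convex topology on the union for which every inclusion is continuous, is given by the absolutely
  convex sets that meet every step in a neighbourhood of \<open>0\<close>.\<close>

definition lc_zero_nbhd :: "'i set \<Rightarrow> ('i \<Rightarrow> ('k \<Rightarrow> complex) topology) \<Rightarrow> ('k \<Rightarrow> complex) set \<Rightarrow> bool" where
  "lc_zero_nbhd I X V \<longleftrightarrow>
     abs_convex V \<and> (\<forall>i\<in>I. \<exists>O'. openin (X i) O' \<and> (\<lambda>_. 0) \<in> O' \<and> O' \<subseteq> V)"

definition ind_lim :: "'i set \<Rightarrow> ('i \<Rightarrow> ('k \<Rightarrow> complex) topology) \<Rightarrow> ('k \<Rightarrow> complex) topology" where
  "ind_lim I X = topology (\<lambda>U. U \<subseteq> (\<Union>i\<in>I. topspace (X i)) \<and>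
     (\<forall>x\<in>U. \<exists>V. lc_zero_nbhd I X V \<and>
        (\<forall>y\<in>(\<Union>i\<in>I. topspace (X i)). (\<lambda>k. y k - x k) \<in> V \<longrightarrow> y \<in> U)))"

lemma lc_zero_nbhd_Int:
  assumes "lc_zero_nbhd I X V" "lc_zero_nbhd I X W"
  shows "lc_zero_nbhd I X (V \<inter> W)"
  unfolding lc_zero_nbhd_def
proof (intro conjI ballI)
  show "abs_convex (V \<inter> W)"
    using assms by (auto simp: lc_zero_nbhd_def abs_convex_def)
  fix i assume "i \<in> I"
  then obtain A B where "openin (X i) A" "(\<lambda>_. 0) \<in> A" "A \<subseteq> V"
    and "openin (X i) B" "(\<lambda>_. 0) \<in> B" "B \<subseteq> W"
    using assms by (fastforce simp: lc_zero_nbhd_def)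
  then show "\<exists>O'. openin (X i) O' \<and> (\<lambda>_. 0) \<in> O' \<and> O' \<subseteq> V \<inter> W"
    by (intro exI[of _ "A \<inter> B"]) auto
qed

lemma openin_ind_lim:
  "openin (ind_lim I X) U \<longleftrightarrow> U \<subseteq> (\<Union>i\<in>I. topspace (X i)) \<and>
     (\<forall>x\<in>U. \<exists>V. lc_zero_nbhd I X V \<and>
        (\<forall>y\<in>(\<Union>i\<in>I. topspace (X i)). (\<lambda>k. y k - x k) \<in> V \<longrightarrow> y \<in> U))"
proof -
  let ?E = "\<Union>i\<in>I. topspace (X i)"
  have "istopology (\<lambda>U. U \<subseteq> ?E \<and>
     (\<forall>x\<in>U. \<exists>V. lc_zero_nbhd I X V \<and> (\<forall>y\<in>?E. (\<lambda>k. y k - x k) \<in> V \<longrightarrow> y \<in> U)))"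
    (is "istopology ?P")
    unfolding istopology_def
  proof (intro conjI allI impI)
    fix S T assume S: "?P S" and T: "?P T"
    show "S \<inter> T \<subseteq> ?E" using S by blast
    show "\<forall>x\<in>S \<inter> T. \<exists>V. lc_zero_nbhd I X V \<and> (\<forall>y\<in>?E. (\<lambda>k. y k - x k) \<in> V \<longrightarrow> y \<in> S \<inter> T)"
    proof
      fix x assume x: "x \<in> S \<inter> T"
      obtain V where V: "lc_zero_nbhd I X V" "\<forall>y\<in>?E. (\<lambda>k. y k - x k) \<in> V \<longrightarrow> y \<in> S"
        using S x by blast
      obtain W where W: "lc_zero_nbhd I X W" "\<forall>y\<in>?E. (\<lambda>k. y k - x k) \<in> W \<longrightarrow> y \<in> T"
        using T x by blast
      show "\<exists>V. lc_zero_nbhd I X V \<and> (\<forall>y\<in>?E. (\<lambda>k. y k - x k) \<in> V \<longrightarrow> y \<in> S \<inter> T)"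
        using V W lc_zero_nbhd_Int by (intro exI[of _ "V \<inter> W"]) blast
    qed
  next
    fix \<K> assume K: "\<forall>K\<in>\<K>. ?P K"
    show "\<Union>\<K> \<subseteq> ?E" using K by blast
    show "\<forall>x\<in>\<Union>\<K>. \<exists>V. lc_zero_nbhd I X V \<and> (\<forall>y\<in>?E. (\<lambda>k. y k - x k) \<in> V \<longrightarrow> y \<in> \<Union>\<K>)"
    proof
      fix x assume "x \<in> \<Union>\<K>"
      then obtain K where "K \<in> \<K>" "x \<in> K" by blast
      then obtain V where "lc_zero_nbhd I X V" "\<forall>y\<in>?E. (\<lambda>k. y k - x k) \<in> V \<longrightarrow> y \<in> K"
        using K by blast
      then show "\<exists>V. lc_zero_nbhd I X V \<and> (\<forall>y\<in>?E. (\<lambda>k. y k - x k) \<in> V \<longrightarrow> y \<in> \<Union>\<K>)"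
        using \<open>K \<in> \<K>\<close> by blast
    qed
  qed
  then show ?thesis
    by (simp add: ind_lim_def topology_inverse')
qed

lemma topspace_ind_lim:
  assumes "\<And>i. i \<in> I \<Longrightarrow> (\<lambda>_. 0) \<in> topspace (X i)"
  shows "topspace (ind_lim I X) = (\<Union>i\<in>I. topspace (X i))"
proof
  show "topspace (ind_lim I X) \<subseteq> (\<Union>i\<in>I. topspace (X i))"
    using openin_ind_lim openin_topspace by blast
  have "lc_zero_nbhd I X UNIV"
    unfolding lc_zero_nbhd_def abs_convex_def using assms openin_topspace by blast
  then have "openin (ind_lim I X) (\<Union>i\<in>I. topspace (X i))"
    unfolding openin_ind_lim by blast
  then show "(\<Union>i\<in>I. topspace (X i)) \<subseteq> topspace (ind_lim I X)"
    by (rule openin_subset)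
qed

definition final_top :: "'i set \<Rightarrow> ('i \<Rightarrow> 'a topology) \<Rightarrow> 'a topology" where
  "final_top I X = topology (\<lambda>U. U \<subseteq> (\<Union>i\<in>I. topspace (X i)) \<and>
     (\<forall>i\<in>I. openin (X i) (U \<inter> topspace (X i))))"

lemma openin_final_top:
  "openin (final_top I X) U \<longleftrightarrow> U \<subseteq> (\<Union>i\<in>I. topspace (X i)) \<and>
     (\<forall>i\<in>I. openin (X i) (U \<inter> topspace (X i)))"
proof -
  have "istopology (\<lambda>U. U \<subseteq> (\<Union>i\<in>I. topspace (X i)) \<and>
     (\<forall>i\<in>I. openin (X i) (U \<inter> topspace (X i))))" (is "istopology ?P")
    unfolding istopology_def
  proof (intro conjI allI impI ballI)
    fix S T assume S: "?P S" and T: "?P T"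
    show "S \<inter> T \<subseteq> (\<Union>i\<in>I. topspace (X i))" using S by blast
    fix i assume i: "i \<in> I"
    have "openin (X i) (S \<inter> topspace (X i))" "openin (X i) (T \<inter> topspace (X i))"
      using S T i by blast+
    then have "openin (X i) ((S \<inter> topspace (X i)) \<inter> (T \<inter> topspace (X i)))"
      by (rule openin_Int)
    moreover have "(S \<inter> topspace (X i)) \<inter> (T \<inter> topspace (X i)) = S \<inter> T \<inter> topspace (X i)" by blast
    ultimately show "openin (X i) (S \<inter> T \<inter> topspace (X i))" by simp
  next
    fix \<K> assume K: "\<forall>K\<in>\<K>. ?P K"
    show "\<Union>\<K> \<subseteq> (\<Union>i\<in>I. topspace (X i))" using K by blast
    fix i assume "i \<in> I"
    then have "\<And>U. U \<in> (\<lambda>K. K \<inter> topspace (X i)) ` \<K> \<Longrightarrow> openin (X i) U"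
      using K by blast
    then have "openin (X i) (\<Union>K\<in>\<K>. K \<inter> topspace (X i))"
      by (intro openin_Union) blast
    moreover have "(\<Union>K\<in>\<K>. K \<inter> topspace (X i)) = \<Union>\<K> \<inter> topspace (X i)" by blast
    ultimately show "openin (X i) (\<Union>\<K> \<inter> topspace (X i))" by simp
  qed
  then show ?thesis
    by (simp add: final_top_def topology_inverse')
qed

lemma topspace_final_top: "topspace (final_top I X) = (\<Union>i\<in>I. topspace (X i))"
  (is "_ = ?E")
proof
  show "topspace (final_top I X) \<subseteq> ?E"
    using openin_topspace[of "final_top I X"] unfolding openin_final_top by (rule conjunct1)
  have "openin (X j) (?E \<inter> topspace (X j))" if "j \<in> I" for j
  proof -
    have "?E \<inter> topspace (X j) = topspace (X j)"
      using that by blast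
    then show ?thesis
      by (simp only: openin_topspace)
  qed
  then have "openin (final_top I X) ?E"
    unfolding openin_final_top by blast
  then show "?E \<subseteq> topspace (final_top I X)"
    by (rule openin_subset)
qed


section \<open>The symbol spaces\<close>

text \<open>All parameters range over the positive reals. The exponent \<open>p\<close> is kept as an argument.\<close>

definition A_hat :: "ennreal \<Rightarrow> flat_index \<Rightarrow> ('d::finite) fseries topology" where
  "A_hat p s = ind_lim {0<..} (\<lambda>r. ell_top p (weight_A s r))"

definition A0_hat :: "ennreal \<Rightarrow> flat_index \<Rightarrow> ('d::finite) fseries topology" where
  "A0_hat p s = proj_lim {0<..} (\<lambda>r. ell_top p (weight_A s r))"

definition C_step :: "ennreal \<Rightarrow> flat_index \<Rightarrow> real \<Rightarrow> ('d::finite) fseries topology" where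
  "C_step p s r2 = proj_lim {0<..} (\<lambda>r1. ell_top p (weight_C s r2 r1))"

definition C_hat :: "ennreal \<Rightarrow> flat_index \<Rightarrow> ('d::finite) fseries topology" where
  "C_hat p s = ind_lim {0<..} (C_step p s)"

definition C0_step :: "ennreal \<Rightarrow> flat_index \<Rightarrow> real \<Rightarrow> ('d::finite) fseries topology" where
  "C0_step p s r1 = proj_lim {0<..} (\<lambda>r2. ell_top p (weight_C s r2 r1))"

definition C0_hat :: "ennreal \<Rightarrow> flat_index \<Rightarrow> ('d::finite) fseries topology" where
  "C0_hat p s = ind_lim {0<..} (C0_step p s)"

definition C_star_step :: "ennreal \<Rightarrow> flat_index \<Rightarrow> real \<Rightarrow> ('d::finite) fseries topology" where
  "C_star_step p s r1 = proj_lim {0<..} (\<lambda>r2. ell_top p (weight_C_star s r2 r1))"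

definition C_star_hat :: "ennreal \<Rightarrow> flat_index \<Rightarrow> ('d::finite) fseries topology" where
  "C_star_hat p s = ind_lim {0<..} (C_star_step p s)"

definition C0_star_step :: "ennreal \<Rightarrow> flat_index \<Rightarrow> real \<Rightarrow> ('d::finite) fseries topology" where
  "C0_star_step p s r2 = proj_lim {0<..} (\<lambda>r1. ell_top p (weight_C_star s r2 r1))"

definition C0_star_hat :: "ennreal \<Rightarrow> flat_index \<Rightarrow> ('d::finite) fseries topology" where
  "C0_star_hat p s = ind_lim {0<..} (C0_star_step p s)"

definition A_fin :: "('d::finite) fseries set" where
  "A_fin = {a. finite {k. a k \<noteq> 0}}"


section \<open>Anti-Wick operators and the twisted anti-Wick product\<close>

definition e_basis :: "('d::finite) mindex \<Rightarrow> complex ^ 'd \<Rightarrow> complex" where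
  "e_basis \<alpha> z = mi_power z \<alpha> / of_real (sqrt (mi_fact \<alpha>))"

definition cnj_vec :: "complex ^ 'd \<Rightarrow> complex ^ ('d::finite)" where
  "cnj_vec w = (\<chi> i. cnj (w $ i))"

text \<open>The function \<open>a(z,w)\<close> given by a symbol with finitely many non-zero coefficients.\<close>

definition symbol :: "('d::finite) fseries \<Rightarrow> complex ^ 'd \<Rightarrow> complex ^ 'd \<Rightarrow> complex" where
  "symbol a z w =
     (\<Sum>(\<alpha>, \<beta>) \<in> {k. a k \<noteq> 0}. a (\<alpha>, \<beta>) * e_basis \<alpha> z * e_basis \<beta> (cnj_vec w))"

definition polynomials :: "(complex ^ 'd \<Rightarrow> complex) set" where
  "polynomials = {F. \<exists>S c. finite (S :: ('d::finite) mindex set) \<and>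
     F = (\<lambda>z. \<Sum>\<alpha>\<in>S. c \<alpha> * mi_power z \<alpha>)}"

definition cform :: "complex ^ 'd \<Rightarrow> complex ^ 'd \<Rightarrow> complex" where
  "cform z w = (\<Sum>j\<in>UNIV. z $ j * cnj (w $ (j::'d::finite)))"

definition Op_aw :: "('d::finite) fseries \<Rightarrow> (complex ^ 'd \<Rightarrow> complex) \<Rightarrow> complex ^ 'd \<Rightarrow> complex" where
  "Op_aw a F z =
     of_real (1 / pi ^ CARD('d)) * (LINT w|lborel. symbol a w w * F w * exp (cform (z - w) w))"

definition twisted_aw :: "('d::finite) fseries \<Rightarrow> 'd fseries \<Rightarrow> 'd fseries" where
  "twisted_aw a1 a2 =
     (THE b. b \<in> A_fin \<and> (\<forall>F\<in>polynomials. Op_aw a1 (Op_aw a2 F) = Op_aw b F))"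


section \<open>Unique continuous extension\<close>

definition uniquely_extends :: "'a topology \<Rightarrow> 'b topology \<Rightarrow> 'a set \<Rightarrow> ('a \<Rightarrow> 'b) \<Rightarrow> bool" where
  "uniquely_extends P Y D f \<longleftrightarrow> D \<subseteq> topspace P \<and>
     (\<exists>!T. T \<in> extensional (topspace P) \<and> continuous_map P Y T \<and> (\<forall>x\<in>D. T x = f x))"

text \<open>The product of an inductive limit with itself, formed as the inductive limit of the products
  of the steps: it carries the finest topology for which the inclusions of these products are
  continuous. As the steps are nested, its underlying set is the full product of the union with
  itself.

  For \<open>C_hat\<close> and its variants this topology, and not the coarser product topology, is the one in
  which the twisted anti-Wick product is continuous. Indeed, let \<open>u = \<Sum> c\<^sub>\<gamma> e\<^sub>\<gamma>(z)\<close> and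
  \<open>v = \<Sum> d\<^sub>\<gamma> e\<^sub>\<gamma>(w-bar)\<close>. The coefficient of the product of \<open>u\<close> and \<open>v\<close> at \<open>(0,0)\<close> is, up to
  signs, the pairing \<open>\<Sum> c\<^sub>\<gamma> d\<^sub>\<gamma>\<close>, where \<open>c\<close> runs through an inductive limit of weighted spaces and
  \<open>d\<close> through the projective limit with the reciprocal weights (or vice versa). Such a pairing is
  not jointly continuous for the product topology: bounding it on a product of two neighbourhoods of
  \<open>0\<close> would force the inductive limit to be one of its steps.\<close>

definition ind_square :: "(real \<Rightarrow> 'a topology) \<Rightarrow> ('a \<times> 'a) topology" where
  "ind_square X = final_top {0<..} (\<lambda>r. prod_topology (X r) (X r))"

end

theory Submission
  imports Defs "HOL-Probability.Characteristic_Functions"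
begin

text \<open>
  By the reproducing property of the Gaussian measure, \<open>Op_aw\<close> turns \<open>z\<^sup>\<alpha> w-bar\<^sup>\<beta>\<close> into the operator
  \<open>F \<mapsto> \<partial>\<^sup>\<beta> (z\<^sup>\<alpha> F)\<close>. Commuting multiplications and derivatives gives
  \<open>a # b = \<Sum>\<^sub>\<gamma> (-1)\<^bsup>|\<gamma>|\<^esup> / \<gamma>! (\<partial>\<^sub>z\<^sup>\<gamma> a) (\<partial>\<^sub>w\<^sup>\<gamma> b)\<close>, where \<open>\<partial>\<^sub>w\<close> differentiates in the conjugate of \<open>w\<close>.
  In the normalised basis its coefficients grow at most exponentially in the order of the indices, so
  the product is continuous between two weighted spaces as soon as the passage from one weight to the
  other absorbs an exponential factor; for \<open>s < 1/2\<close> every parameter can be weakened to one for which it does, and for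
  \<open>0 < s \<le> 1/2\<close> every parameter can be strengthened to one. For the inductive limit \<open>A_hat\<close>, a bilinear map continuous on all
  pairs of steps is jointly continuous because there are countably many normed steps. Truncations
  converge in every space, which gives uniqueness.
\<close>

section \<open>Gaussian integrals and anti-Wick operators on polynomials\<close>

text \<open>Below \<open>1/2\<close> the logarithm of the weight grows faster than linearly in the
  order of \<alpha> (as a power with exponent \<open>1 / (2 * s) > 1\<close>, or as the logarithm of
  a factorial for the flat symbols), so a factor \<open>8 ^ mi_abs \<alpha>\<close> is absorbed
  however small the parameter is; at \<open>s = 0\<close> only finitely many indices have finite
  weight. At \<open>1/2\<close> the growth is linear and the parameter itself must be large, which
  is possible only where the dominating parameter is chosen after the dominated one. The number 8 is
  \<open>2 * 4\<close>: 2 bounds the coefficients, and 4 leaves one factor \<open>1/2\<close> for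
  the sum over the ways of forming an index and one for the norm of the result. Hence supremum
  bounds on the factors control the product for every \<open>p\<close>, even for
  \<open>p < 1\<close>, where the triangle inequality fails. In quotient weights the contracted
  index \<gamma> enters a numerator and a denominator; what the numerator gains must pay for the
  denominator, and this dictates the order in which the parameters are chosen.\<close>

lemma measurable_vec_PiM [measurable]:
  "(\<lambda>f. \<chi> i. f i) \<in> measurable (Pi\<^sub>M (UNIV :: 'n::finite set) (\<lambda>_. lborel :: 'a::euclidean_space measure)) borel"
proof (subst borel_measurable_euclidean_space, intro ballI)
  fix b :: "'a ^ 'n"
  assume "b \<in> Basis"
  then obtain i u where b: "b = axis i u" "u \<in> Basis"
    by (auto simp: Basis_vec_def)
  have "(\<lambda>f. (\<chi> i. f i) \<bullet> b) = (\<lambda>f. f i \<bullet> u)"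
    by (simp add: b inner_axis)
  then show "(\<lambda>f. (\<chi> i. f i) \<bullet> b) \<in> borel_measurable (Pi\<^sub>M UNIV (\<lambda>_. lborel :: 'a measure))"
    by simp
qed

text \<open>A measure that gives every box its volume is Lebesgue measure, and a box of vectors is
  the product of the boxes of its components. This turns Gaussian integrals over
  \<open>complex ^ 'd\<close> into products of integrals over the complex plane.\<close>

lemma lborel_vec:
  "lborel = distr (Pi\<^sub>M (UNIV :: 'n::finite set) (\<lambda>_. lborel :: 'a::euclidean_space measure)) borel (\<lambda>f. \<chi> i. f i)"
    (is "_ = ?M")
proof (rule lborel_eqI)
  interpret product_sigma_finite "\<lambda>_ :: 'n. lborel :: 'a measure"
    by standard
  fix l u :: "'a ^ 'n"
  assume le: "\<And>b. b \<in> Basis \<Longrightarrow> l \<bullet> b \<le> u \<bullet> b"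
  have le': "l $ i \<bullet> v \<le> u $ i \<bullet> v" if "v \<in> Basis" for i v
    using le[of "axis i v"] that by (simp add: inner_axis axis_in_Basis_iff)
  have "(\<lambda>f. \<chi> i. f i) -` box l u \<inter> space (Pi\<^sub>M UNIV (\<lambda>_. lborel)) = (\<Pi>\<^sub>E i\<in>UNIV. box (l $ i) (u $ i))"
    by (auto simp: mem_box Basis_vec_def inner_axis space_PiM PiE_iff)
  then have "emeasure ?M (box l u) = emeasure (Pi\<^sub>M UNIV (\<lambda>_. lborel)) (\<Pi>\<^sub>E i\<in>UNIV. box (l $ i) (u $ i))"
    by (simp add: emeasure_distr)
  also have "\<dots> = (\<Prod>i\<in>UNIV. emeasure lborel (box (l $ i) (u $ i)))"
    by (intro emeasure_PiM) auto
  also have "\<dots> = ennreal (\<Prod>i\<in>UNIV. \<Prod>v\<in>Basis. (u $ i - l $ i) \<bullet> v)"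
    using le' by (simp add: emeasure_lborel_box prod_ennreal[symmetric] prod_nonneg inner_diff_left)
  also have "(\<Prod>i\<in>UNIV. \<Prod>v\<in>Basis. (u $ i - l $ i) \<bullet> v) = (\<Prod>b\<in>Basis. (u - l) \<bullet> b)"
  proof -
    have eq: "(Basis :: ('a^'n) set) = (\<lambda>(i, v). axis i v) ` (UNIV \<times> Basis)"
      by (auto simp: Basis_vec_def)
    have "inj_on (\<lambda>(i, v). axis i v) ((UNIV :: 'n set) \<times> (Basis :: 'a set))"
      by (auto simp: inj_on_def axis_eq_axis)
    then have "(\<Prod>b\<in>Basis. (u - l) \<bullet> b) = (\<Prod>(i, v)\<in>UNIV \<times> Basis. (u - l) \<bullet> axis i v)"
      unfolding eq by (subst prod.reindex) (simp_all add: case_prod_unfold)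
    then show ?thesis
      by (simp add: prod.cartesian_product inner_axis case_prod_unfold)
  qed
  finally show "emeasure ?M (box l u) = (\<Prod>b\<in>Basis. (u - l) \<bullet> b)" .
qed simp

lemma vec_product_integral:
  fixes f :: "'n::finite \<Rightarrow> 'a::euclidean_space \<Rightarrow> complex"
  assumes "\<And>i. integrable lborel (f i)"
  shows "integrable lborel (\<lambda>w::'a^'n. \<Prod>i\<in>UNIV. f i (w $ i))"
    and "(LINT w|lborel. (\<Prod>i\<in>UNIV. f i (w $ i))) = (\<Prod>i\<in>UNIV. (LINT w|lborel. f i w))"
proof -
  interpret product_sigma_finite "\<lambda>_ :: 'n. lborel :: 'a measure"
    by standard
  have [measurable]: "f i \<in> borel_measurable borel" for i
    using borel_measurable_integrable[OF assms[of i]] by simp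
  have [measurable]: "(\<lambda>w::'a^'n. w $ i) \<in> borel_measurable borel" for i
    by (intro borel_measurable_continuous_onI continuous_intros)
  have *: "integrable (Pi\<^sub>M UNIV (\<lambda>_. lborel)) (\<lambda>x. \<Prod>i\<in>UNIV. f i (x i))"
    using assms by (intro product_integrable_prod) auto
  show "integrable lborel (\<lambda>w::'a^'n. \<Prod>i\<in>UNIV. f i (w $ i))"
    unfolding lborel_vec
    by (subst integrable_distr_eq) (use * in auto)
  show "(LINT w|lborel. (\<Prod>i\<in>UNIV. f i (w $ i))) = (\<Prod>i\<in>UNIV. (LINT w|lborel. f i w))"
    unfolding lborel_vec[where 'n='n and 'a='a]
    by (subst integral_distr) (use assms in \<open>auto intro!: product_integral_prod\<close>)
qed

lemma complex_product_integral:
  fixes f g :: "real \<Rightarrow> complex"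
  assumes "integrable lborel f" "integrable lborel g"
  shows "integrable lborel (\<lambda>w::complex. f (Re w) * g (Im w))"
    and "(LINT w|lborel. f (Re w) * g (Im w)) = (LINT x|lborel. f x) * (LINT x|lborel. g x)"
proof -
  interpret product_sigma_finite "\<lambda>_ :: complex. lborel :: real measure"
    by standard
  have [measurable]: "f \<in> borel_measurable borel" "g \<in> borel_measurable borel"
    using assms borel_measurable_integrable by fastforce+
  \<comment> \<open>The basis of the complex numbers is \<open>{1, \<i>}\<close>, so
    \<open>f\<close> is attached to the real axis and \<open>g\<close> to the imaginary one.\<close>
  define h where "h b = (if b = 1 then f else g)" for b :: complex
  have h: "integrable lborel (h b)" for b
    using assms by (simp add: h_def)
  have eq: "(\<Prod>b\<in>Basis. h b (x b)) = f (Re (\<Sum>b\<in>Basis. x b *\<^sub>R b)) * g (Im (\<Sum>b\<in>Basis. x b *\<^sub>R b))" for x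
    by (simp add: Basis_complex_def h_def)
  have *: "integrable (Pi\<^sub>M Basis (\<lambda>_. lborel)) (\<lambda>x. \<Prod>i\<in>Basis. h i (x i))"
    using h by (intro product_integrable_prod) auto
  show "integrable lborel (\<lambda>w::complex. f (Re w) * g (Im w))"
    unfolding lborel_eq[where 'a=complex]
    by (subst integrable_distr_eq) (use * in \<open>simp_all add: eq\<close>)
  have "(LINT w|lborel. f (Re w) * g (Im w)) = (\<integral>x. (\<Prod>b\<in>Basis. h b (x b)) \<partial>Pi\<^sub>M Basis (\<lambda>_. lborel))"
    unfolding lborel_eq[where 'a=complex] by (subst integral_distr) (simp_all add: eq)
  also have "\<dots> = (\<Prod>b\<in>Basis. integral\<^sup>L lborel (h b))"
    using h by (intro product_integral_prod) auto
  finally show "(LINT w|lborel. f (Re w) * g (Im w)) = (LINT x|lborel. f x) * (LINT x|lborel. g x)"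
    by (simp add: Basis_complex_def h_def)
qed

text \<open>Completing the square in \<open>Re c\<close> turns the modulus into a standard normal
  density at \<open>sqrt 2 * x - Re c / sqrt 2\<close>. What remains is the oscillation coming from
  \<open>Im c\<close>, so the integral is the characteristic function of the normal distribution at
  \<open>Im c / sqrt 2\<close>.\<close>

lemma gaussian_exp_integral:
  fixes c :: complex
  shows "integrable lborel (\<lambda>x. exp (c * of_real x - of_real (x\<^sup>2)))" (is ?A)
    and "(LINT x|lborel. exp (c * of_real x - of_real (x\<^sup>2))) = of_real (sqrt pi) * exp (c\<^sup>2 / 4)" (is ?B)
proof -
  define t where "t = Im c / sqrt 2"
  let ?g = "\<lambda>x. complex_of_real (std_normal_density x) * iexp (t * x)"
  have int: "integrable lborel ?g"
    by (rule Bochner_Integration.integrable_bound[where f = std_normal_density]) (auto simp: norm_mult)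
  have val: "(LINT x|lborel. ?g x) = exp (- (t\<^sup>2) / 2)"
  proof -
    have "char std_normal_distribution t = (LINT x|lborel. std_normal_density x *\<^sub>R iexp (t * x))"
      unfolding char_def by (subst integral_density) auto
    then show ?thesis
      by (simp add: char_std_normal_distribution scaleR_conv_of_real)
  qed
  have eq: "exp (c * of_real x - of_real (x\<^sup>2)) =
     of_real (sqrt (2 * pi)) * exp ((of_real (Re c))\<^sup>2 / 4 + \<i> * of_real (Re c * Im c) / 2) * ?g (- (Re c) / sqrt 2 + sqrt 2 * x)" for x
  proof -
    have "?g y = exp (of_real (- (y\<^sup>2) / 2) + \<i> * of_real (t * y)) / of_real (sqrt (2 * pi))" for y
      unfolding std_normal_density_def exp_add exp_of_real by simp
    then have "?g (- (Re c) / sqrt 2 + sqrt 2 * x) = exp (of_real (- ((- (Re c) / sqrt 2 + sqrt 2 * x)\<^sup>2) / 2) + \<i> * of_real (t * (- (Re c) / sqrt 2 + sqrt 2 * x))) / of_real (sqrt (2 * pi))" .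
    also have "complex_of_real (- ((- (Re c) / sqrt 2 + sqrt 2 * x)\<^sup>2) / 2) + \<i> * of_real (t * (- (Re c) / sqrt 2 + sqrt 2 * x))
      = (c * of_real x - of_real (x\<^sup>2)) - ((of_real (Re c))\<^sup>2 / 4 + \<i> * of_real (Re c * Im c) / 2)"
      by (rule complex_eqI) (simp_all add: t_def field_simps power2_eq_square)
    finally show ?thesis
      by (simp add: exp_diff)
  qed
  show ?A
    unfolding eq
    by (intro integrable_mult_right lborel_integrable_real_affine) (use int in auto)
  have "(LINT x|lborel. exp (c * of_real x - of_real (x\<^sup>2))) =
     of_real (sqrt (2 * pi)) * exp ((of_real (Re c))\<^sup>2 / 4 + \<i> * of_real (Re c * Im c) / 2) *
       (LINT x|lborel. ?g (- (Re c) / sqrt 2 + sqrt 2 * x))"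
    unfolding eq by simp
  \<comment> \<open>The divisor \<open>sqrt 2\<close> is the Jacobian of the affine
    substitution.\<close>
  also have "(LINT x|lborel. ?g (- (Re c) / sqrt 2 + sqrt 2 * x)) = exp (- (t\<^sup>2) / 2) / sqrt 2"
    using lborel_integral_real_affine[of "sqrt 2" ?g "- (Re c) / sqrt 2"] val
    by (simp add: scaleR_conv_of_real field_simps)
  also have "of_real (sqrt (2 * pi)) * exp ((of_real (Re c))\<^sup>2 / 4 + \<i> * of_real (Re c * Im c) / 2) * (exp (- (t\<^sup>2) / 2) / sqrt 2)
     = of_real (sqrt pi) * exp ((of_real (Re c))\<^sup>2 / 4 + \<i> * of_real (Re c * Im c) / 2 + of_real (- (t\<^sup>2) / 2))"
    unfolding exp_add exp_of_real by (simp add: real_sqrt_mult)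
  also have "(of_real (Re c))\<^sup>2 / 4 + \<i> * of_real (Re c * Im c) / 2 + of_real (- (t\<^sup>2) / 2) = c\<^sup>2 / 4"
    by (rule complex_eqI) (simp_all add: t_def field_simps power2_eq_square)
  finally show ?B .
qed

text \<open>In real coordinates \<open>a * w + b * cnj w\<close> has the coefficients
  \<open>a + b\<close> and \<open>\<i> * (a - b)\<close>, so two real Gaussian integrals multiply
  and their exponents add up to \<open>a * b\<close>. As a function of \<open>a\<close> and
  \<open>b\<close> this generates all moments of \<open>w\<close> and \<open>cnj w\<close>.\<close>

lemma gaussian_complex_generating:
  fixes a b :: complex
  shows "integrable lborel (\<lambda>w. exp (a * w + b * cnj w - of_real ((cmod w)\<^sup>2)))"
    and "(LINT w|lborel. exp (a * w + b * cnj w - of_real ((cmod w)\<^sup>2))) = of_real pi * exp (a * b)"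
proof -
  have eq: "exp (a * w + b * cnj w - of_real ((cmod w)\<^sup>2)) =
     exp ((a + b) * of_real (Re w) - of_real ((Re w)\<^sup>2)) * exp (\<i> * (a - b) * of_real (Im w) - of_real ((Im w)\<^sup>2))" for w
    unfolding exp_add[symmetric]
    by (rule arg_cong[where f=exp], rule complex_eqI) (simp_all add: cmod_power2 field_simps)
  note G = complex_product_integral[OF gaussian_exp_integral(1)[of "a + b"] gaussian_exp_integral(1)[of "\<i> * (a - b)"]]
  show "integrable lborel (\<lambda>w. exp (a * w + b * cnj w - of_real ((cmod w)\<^sup>2)))"
    unfolding eq by (rule G(1))
  have "(a + b)\<^sup>2 / 4 + (\<i> * (a - b))\<^sup>2 / 4 = a * b"
    by (simp add: power2_eq_square field_simps)
  then have "exp ((a + b)\<^sup>2 / 4) * exp ((\<i> * (a - b))\<^sup>2 / 4) = exp (a * b)"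
    by (metis exp_add)
  moreover have "of_real (sqrt pi) * of_real (sqrt pi) = complex_of_real pi"
    by (simp flip: of_real_mult)
  ultimately show "(LINT w|lborel. exp (a * w + b * cnj w - of_real ((cmod w)\<^sup>2))) = of_real pi * exp (a * b)"
    unfolding eq G(2) gaussian_exp_integral(2) by (simp add: algebra_simps)
qed

text \<open>The modulus is at most the sum of the moduli of real and imaginary part, which splits
  the integrand into one-dimensional factors. It is the source of the majorants for all later
  Gaussian integrals.\<close>

lemma gaussian_exp_norm_integrable:
  fixes R :: real
  shows "integrable lborel (\<lambda>w::complex. exp (R * cmod w - (cmod w)\<^sup>2))"
proof -
  have 1: "integrable lborel (\<lambda>x::real. exp (\<bar>R\<bar> * \<bar>x\<bar> - x\<^sup>2))"
  proof (rule Bochner_Integration.integrable_bound)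
    have "norm (exp (of_real a * complex_of_real x - of_real (x\<^sup>2))) = exp (a * x - x\<^sup>2)" for a x :: real
      by (simp only: flip: of_real_mult of_real_diff) (simp add: exp_of_real)
    then have "integrable lborel (\<lambda>x. exp (a * x - x\<^sup>2))" for a :: real
      using integrable_norm[OF gaussian_exp_integral(1)[of "of_real a"]] by simp
    then show "integrable lborel (\<lambda>x. exp (\<bar>R\<bar> * x - x\<^sup>2) + exp (- \<bar>R\<bar> * x - x\<^sup>2))"
      by (intro Bochner_Integration.integrable_add)
    show "AE x in lborel. norm (exp (\<bar>R\<bar> * \<bar>x\<bar> - x\<^sup>2)) \<le> norm (exp (\<bar>R\<bar> * x - x\<^sup>2) + exp (- \<bar>R\<bar> * x - x\<^sup>2))"
    proof (intro AE_I2)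
      fix x :: real
      have "exp (\<bar>R\<bar> * \<bar>x\<bar> - x\<^sup>2) \<le> exp (\<bar>R\<bar> * x - x\<^sup>2) + exp (- \<bar>R\<bar> * x - x\<^sup>2)"
        by (cases "x \<ge> 0") simp_all
      then show "norm (exp (\<bar>R\<bar> * \<bar>x\<bar> - x\<^sup>2)) \<le> norm (exp (\<bar>R\<bar> * x - x\<^sup>2) + exp (- \<bar>R\<bar> * x - x\<^sup>2))"
        by (metis abs_ge_self exp_ge_zero norm_of_real abs_of_nonneg order_trans real_norm_def)
    qed
  qed simp
  then have "integrable lborel (\<lambda>x. complex_of_real (exp (\<bar>R\<bar> * \<bar>x\<bar> - x\<^sup>2)))"
    by simp
  from complex_product_integral(1)[OF this this]
  have "integrable lborel (\<lambda>w. exp (\<bar>R\<bar> * \<bar>Re w\<bar> - (Re w)\<^sup>2) * exp (\<bar>R\<bar> * \<bar>Im w\<bar> - (Im w)\<^sup>2))"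
    unfolding of_real_mult[symmetric] by (simp only: complex_of_real_integrable_eq)
  then show ?thesis
  proof (rule Bochner_Integration.integrable_bound)
    have "R * cmod w \<le> \<bar>R\<bar> * \<bar>Re w\<bar> + \<bar>R\<bar> * \<bar>Im w\<bar>" for w
      using mult_mono[OF abs_ge_self[of R] cmod_le[of w]] by (simp add: distrib_left)
    then show "AE w in lborel. norm (exp (R * cmod w - (cmod w)\<^sup>2))
        \<le> norm (exp (\<bar>R\<bar> * \<bar>Re w\<bar> - (Re w)\<^sup>2) * exp (\<bar>R\<bar> * \<bar>Im w\<bar> - (Im w)\<^sup>2))"
      by (simp add: exp_add[symmetric] cmod_power2 algebra_simps)
  qed simp
qed

text \<open>The partial sums of the norms stay below the integrable majorant, so the exponential
  series may be integrated term by term. The moments of \<phi> thus become the coefficients of a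
  power series in \<open>t\<close>.\<close>

lemma integral_exp_power_series:
  fixes f \<phi> :: "complex \<Rightarrow> complex"
  assumes [measurable]: "f \<in> borel_measurable borel" "\<phi> \<in> borel_measurable borel"
    and int: "integrable lborel (\<lambda>w. exp (cmod t * cmod (\<phi> w)) * cmod (f w))"
  shows "(\<lambda>n. (LINT w|lborel. \<phi> w ^ n * f w) / fact n * t ^ n) sums (LINT w|lborel. exp (t * \<phi> w) * f w)"
proof -
  let ?F = "\<lambda>n w. (t * \<phi> w) ^ n /\<^sub>R fact n * f w"
  have norm: "norm (?F n w) = (cmod t * cmod (\<phi> w)) ^ n /\<^sub>R fact n * cmod (f w)" for n w
    by (simp add: norm_mult norm_power power_mult_distrib divide_simps)
  have sn: "(\<lambda>n. norm (?F n w)) sums (exp (cmod t * cmod (\<phi> w)) * cmod (f w))" for w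
    unfolding norm by (intro sums_mult2 exp_converges)
  have le: "(\<Sum>k\<in>K. norm (?F k w)) \<le> exp (cmod t * cmod (\<phi> w)) * cmod (f w)" if "finite K" for K w
    using sum_le_suminf[OF sums_summable[OF sn[of w]] that] sums_unique[OF sn[of w]] by simp
  have intF: "integrable lborel (?F n)" for n
  proof (rule Bochner_Integration.integrable_bound[OF int])
    show "AE w in lborel. norm (?F n w) \<le> norm (exp (cmod t * cmod (\<phi> w)) * cmod (f w))"
      using le[of "{n}"] by simp
  qed simp
  have "(\<lambda>n. integral\<^sup>L lborel (?F n)) sums (LINT w|lborel. (\<Sum>n. ?F n w))"
  proof (rule sums_integral[OF intF])
    show "AE w in lborel. summable (\<lambda>i. norm (?F i w))"
      using sn sums_summable by blast
    show "summable (\<lambda>n. LINT w|lborel. norm (?F n w))"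
    proof (rule summableI_nonneg_bounded)
      fix N
      have "(\<Sum>n<N. (LINT w|lborel. norm (?F n w))) = (LINT w|lborel. (\<Sum>n<N. norm (?F n w)))"
        by (intro Bochner_Integration.integral_sum[symmetric] integrable_norm intF)
      also have "\<dots> \<le> (LINT w|lborel. exp (cmod t * cmod (\<phi> w)) * cmod (f w))"
      proof (rule integral_mono)
        show "integrable lborel (\<lambda>w. \<Sum>n<N. norm (?F n w))"
          using intF by (intro Bochner_Integration.integrable_sum integrable_norm) auto
        show "(\<Sum>n<N. norm (?F n w)) \<le> exp (cmod t * cmod (\<phi> w)) * cmod (f w)" for w
          by (intro le) simp
      qed (rule int)
      finally show "(\<Sum>n<N. (LINT w|lborel. norm (?F n w))) \<le> (LINT w|lborel. exp (cmod t * cmod (\<phi> w)) * cmod (f w))" .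
    qed simp
  qed
  moreover have "(\<Sum>n. ?F n w) = exp (t * \<phi> w) * f w" for w
    by (rule sums_unique[symmetric], intro sums_mult2 exp_converges)
  moreover have "integral\<^sup>L lborel (?F n) = (LINT w|lborel. \<phi> w ^ n * f w) / fact n * t ^ n" for n
  proof -
    have "?F n = (\<lambda>w. (t ^ n / fact n) * (\<phi> w ^ n * f w))"
      by (simp add: power_mult_distrib scaleR_conv_of_real field_simps)
    then show ?thesis
      by simp
  qed
  ultimately show ?thesis
    by simp
qed

text \<open>Everywhere convergent series have positive radius, so equal sums near 0 force equality
  as formal power series.\<close>

lemma power_series_coeff_unique:
  fixes a b :: "nat \<Rightarrow> complex"
  assumes "\<And>t. (\<lambda>n. a n * t ^ n) sums g t" "\<And>t. (\<lambda>n. b n * t ^ n) sums g t"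
  shows "a n = b n"
proof -
  have r: "fps_conv_radius (Abs_fps c) > 0" if "\<And>t. (\<lambda>n. c n * t ^ n) sums g t" for c
    unfolding fps_conv_radius_def
    using conv_radius_geI[of c 1] sums_summable[OF that[of 1]]
      less_le_trans[of 0 "ereal 1" "conv_radius c"]
    by (simp add: zero_ereal_def)
  have "Abs_fps a = Abs_fps b"
  proof (rule eval_fps_eqD)
    show "eventually (\<lambda>z. eval_fps (Abs_fps a) z = eval_fps (Abs_fps b) z) (nhds 0)"
      using assms by (simp add: eval_fps_def sums_iff)
  qed (use r assms in auto)
  then show ?thesis
    by (metis fps_nth_Abs_fps)
qed


section \<open>Moments of the complex Gaussian measure\<close>

lemma gaussian_poly_integrable:
  "integrable lborel (\<lambda>w::complex. cmod w ^ m * exp (R * cmod w - (cmod w)\<^sup>2))"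
proof (rule Bochner_Integration.integrable_bound)
  show "integrable lborel (\<lambda>w::complex. fact m * exp ((R + 1) * cmod w - (cmod w)\<^sup>2))"
    by (intro integrable_mult_right gaussian_exp_norm_integrable)
  \<comment> \<open>One term of the exponential series is below its sum; this trades the power of
    \<open>cmod w\<close> for an increase of \<open>R\<close> by 1.\<close>
  have "x ^ m \<le> fact m * exp x" if "x \<ge> 0" for x :: real
    using sum_le_suminf[OF summable_exp_generic[of x], of "{m}"] that
    by (simp add: exp_def field_simps)
  then have "cmod w ^ m * exp (R * cmod w - (cmod w)\<^sup>2) \<le> fact m * exp (cmod w) * exp (R * cmod w - (cmod w)\<^sup>2)" for w
    by (intro mult_right_mono) auto
  also have "fact m * exp (cmod w) * exp (R * cmod w - (cmod w)\<^sup>2) = fact m * exp ((R + 1) * cmod w - (cmod w)\<^sup>2)" for w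
    by (simp add: exp_add[symmetric] algebra_simps)
  finally show "AE w in lborel. norm (cmod w ^ m * exp (R * cmod w - (cmod w)\<^sup>2))
      \<le> norm (fact m * exp ((R + 1) * cmod w - (cmod w)\<^sup>2))"
    by simp
qed simp

lemma gaussian_term_norm_le:
  "exp (cmod t * cmod w) * cmod (w ^ m * exp (z * cnj w - of_real ((cmod w)\<^sup>2)))
     \<le> cmod w ^ m * exp ((cmod t + cmod z) * cmod w - (cmod w)\<^sup>2)"
proof -
  have "Re (z * cnj w) \<le> cmod z * cmod w"
    using complex_Re_le_cmod[of "z * cnj w"] by (simp add: norm_mult)
  then have "exp (cmod t * cmod w) * exp (Re (z * cnj w) - (cmod w)\<^sup>2) \<le> exp ((cmod t + cmod z) * cmod w - (cmod w)\<^sup>2)"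
    by (simp add: exp_add[symmetric] algebra_simps)
  then have "cmod w ^ m * (exp (cmod t * cmod w) * exp (Re (z * cnj w) - (cmod w)\<^sup>2)) \<le> cmod w ^ m * exp ((cmod t + cmod z) * cmod w - (cmod w)\<^sup>2)"
    by (intro mult_left_mono) auto
  then show ?thesis
    by (simp add: norm_mult norm_power norm_exp_eq_Re mult_ac)
qed

lemma gaussian_moment_integrable:
  "integrable lborel (\<lambda>w. w ^ m * cnj w ^ k * exp (z * cnj w - of_real ((cmod w)\<^sup>2)))"
proof (rule Bochner_Integration.integrable_bound)
  show "integrable lborel (\<lambda>w. cmod w ^ (m + k) * exp (cmod z * cmod w - (cmod w)\<^sup>2))"
    by (rule gaussian_poly_integrable)
  show "AE w in lborel. norm (w ^ m * cnj w ^ k * exp (z * cnj w - of_real ((cmod w)\<^sup>2)))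
      \<le> norm (cmod w ^ (m + k) * exp (cmod z * cmod w - (cmod w)\<^sup>2))"
    using gaussian_term_norm_le[of 0 _ "m + k" z] by (simp add: norm_mult norm_power power_add)
qed (auto intro!: borel_measurable_continuous_onI continuous_intros)

text \<open>Integration against \<open>exp (z * cnj w)\<close> reproduces holomorphic functions at
  \<open>z\<close>, and each further \<open>cnj w\<close> is a derivative of this kernel in
  \<open>z\<close>. The right side is therefore the \<open>k\<close>-th derivative of
  \<open>z ^ m\<close>; its coefficient vanishes for \<open>k > m\<close>, where the exponent is
  truncated.\<close>

lemma gaussian_moment:
  "(LINT w|lborel. w ^ m * cnj w ^ k * exp (z * cnj w - of_real ((cmod w)\<^sup>2)))
     = of_real pi * of_nat (fact k * (m choose k)) * z ^ (m - k)"
proof -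
  have int: "integrable lborel (\<lambda>w. exp (cmod t * cmod w) * cmod (w ^ m * exp (z * cnj w - of_real ((cmod w)\<^sup>2))))" for t z m
    by (rule Bochner_Integration.integrable_bound[OF gaussian_poly_integrable[of m "cmod t + cmod z"]])
       (use gaussian_term_norm_le in \<open>auto intro!: borel_measurable_continuous_onI continuous_intros\<close>)
  \<comment> \<open>The reproducing property for monomials, read off from the generating function as
    the coefficient of \<open>t ^ m\<close>.\<close>
  have 1: "(LINT w|lborel. w ^ m * exp (z * cnj w - of_real ((cmod w)\<^sup>2))) = of_real pi * z ^ m" for m z
  proof -
    let ?f = "\<lambda>w. exp (z * cnj w - of_real ((cmod w)\<^sup>2))"
    have "(LINT w|lborel. w ^ m * ?f w) / fact m = of_real pi * z ^ m / fact m"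
    proof (rule power_series_coeff_unique)
      fix t
      have "(\<lambda>n. (LINT w|lborel. w ^ n * ?f w) / fact n * t ^ n) sums (LINT w|lborel. exp (t * w) * ?f w)"
        using int[of t 0 z] 
        by (intro integral_exp_power_series) (auto intro!: borel_measurable_continuous_onI continuous_intros)
      also have "(LINT w|lborel. exp (t * w) * ?f w) = of_real pi * exp (t * z)"
        using gaussian_complex_generating(2)[of t z] by (simp add: exp_add[symmetric] algebra_simps)
      finally show "(\<lambda>n. (LINT w|lborel. w ^ n * ?f w) / fact n * t ^ n) sums (of_real pi * exp (t * z))" .
      show "(\<lambda>n. of_real pi * z ^ n / fact n * t ^ n) sums (of_real pi * exp (t * z))"
        using sums_mult[OF exp_converges[of "t * z"], of "of_real pi"]
        by (simp add: power_mult_distrib scaleR_conv_of_real field_simps)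
    qed
    then show ?thesis
      by simp
  qed
  let ?f = "\<lambda>w. w ^ m * exp (z * cnj w - of_real ((cmod w)\<^sup>2))"
  have "(LINT w|lborel. cnj w ^ k * ?f w) / fact k = of_real pi * of_nat (m choose k) * z ^ (m - k)"
  proof (rule power_series_coeff_unique[where n = k and a = "\<lambda>n. (LINT w|lborel. cnj w ^ n * ?f w) / fact n"
        and b = "\<lambda>n. of_real pi * of_nat (m choose n) * z ^ (m - n)"])
    fix t
    have "(\<lambda>n. (LINT w|lborel. cnj w ^ n * ?f w) / fact n * t ^ n) sums (LINT w|lborel. exp (t * cnj w) * ?f w)"
      using int[of t m z] 
        by (intro integral_exp_power_series) (auto intro!: borel_measurable_continuous_onI continuous_intros)
    \<comment> \<open>The extra exponential only moves the point \<open>z\<close> to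
      \<open>t + z\<close>, so the coefficients sought are those of the binomial expansion.\<close>
    also have "(LINT w|lborel. exp (t * cnj w) * ?f w) = of_real pi * (t + z) ^ m"
      using 1[of m "t + z"] by (simp add: exp_add[symmetric] algebra_simps)
    finally show "(\<lambda>n. (LINT w|lborel. cnj w ^ n * ?f w) / fact n * t ^ n) sums (of_real pi * (t + z) ^ m)" .
    have "(\<lambda>n. of_real pi * of_nat (m choose n) * z ^ (m - n) * t ^ n) sums
        (\<Sum>n\<le>m. of_real pi * of_nat (m choose n) * z ^ (m - n) * t ^ n)"
      by (intro sums_finite) (auto simp: binomial_eq_0)
    also have "(\<Sum>n\<le>m. of_real pi * of_nat (m choose n) * z ^ (m - n) * t ^ n) = of_real pi * (t + z) ^ m"
      by (simp add: binomial_ring sum_distrib_left mult_ac)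
    finally show "(\<lambda>n. of_real pi * of_nat (m choose n) * z ^ (m - n) * t ^ n) sums (of_real pi * (t + z) ^ m)" .
  qed
  then show ?thesis
    by (simp add: field_simps)
qed

text \<open>The falling factorial, that is, the factor which the derivative of order \<beta>
  produces from the monomial with exponent \<nu>. It is 0 unless \<beta> is below \<nu>, which makes
  truncated exponents \<open>\<nu> - \<beta>\<close> harmless.\<close>

definition mi_ffact :: "('d::finite) mindex \<Rightarrow> 'd mindex \<Rightarrow> nat" where
  "mi_ffact \<nu> \<beta> = (\<Prod>i\<in>UNIV. fact (\<beta> $ i) * (\<nu> $ i choose \<beta> $ i))"

lemma gaussian_moment_vec:
  fixes z :: "complex ^ ('d::finite)" and \<alpha> \<beta> \<mu> :: "'d mindex"
  defines "f \<equiv> \<lambda>w. mi_power w \<alpha> * mi_power (cnj_vec w) \<beta> * mi_power w \<mu> * exp (cform (z - w) w)"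
  shows "integrable lborel f"
    and "(LINT w|lborel. f w) = of_real (pi ^ CARD('d)) * of_nat (mi_ffact (\<alpha> + \<mu>) \<beta>) * mi_power z (\<alpha> + \<mu> - \<beta>)"
proof -
  let ?h = "\<lambda>i w. w ^ (\<alpha> $ i + \<mu> $ i) * cnj w ^ (\<beta> $ i) * exp (z $ i * cnj w - of_real ((cmod w)\<^sup>2))"
  have "exp (cform (z - w) w) = (\<Prod>i\<in>UNIV. exp (z $ i * cnj (w $ i) - of_real ((cmod (w $ i))\<^sup>2)))" for w
    by (simp add: cform_def exp_sum left_diff_distrib flip: complex_norm_square)
  then have f: "f = (\<lambda>w. \<Prod>i\<in>UNIV. ?h i (w $ i))"
    by (simp add: f_def fun_eq_iff mi_power_def cnj_vec_def prod.distrib[symmetric] power_add mult_ac)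
  show "integrable lborel f"
    unfolding f by (intro vec_product_integral gaussian_moment_integrable)
  have "(LINT w|lborel. f w) = (\<Prod>i\<in>UNIV. (LINT w|lborel. ?h i w))"
    unfolding f by (intro vec_product_integral gaussian_moment_integrable)
  also have "\<dots> = of_real (pi ^ CARD('d)) * of_nat (mi_ffact (\<alpha> + \<mu>) \<beta>) * mi_power z (\<alpha> + \<mu> - \<beta>)"
    unfolding gaussian_moment by (simp add: prod.distrib mi_ffact_def mi_power_def)
  finally show "(LINT w|lborel. f w) = of_real (pi ^ CARD('d)) * of_nat (mi_ffact (\<alpha> + \<mu>) \<beta>) * mi_power z (\<alpha> + \<mu> - \<beta>)" .
qed

text \<open>For \<open>k = (\<alpha>, \<beta>)\<close> this is the \<beta>-derivative of
  \<open>mi_power z (\<alpha> + \<mu>)\<close> with the normalisation of the basis: the image of the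
  monomial with exponent \<mu> under the operator of a single basis symbol.\<close>

definition aw_monom :: "('d::finite) mindex \<times> 'd mindex \<Rightarrow> 'd mindex \<Rightarrow> complex ^ 'd \<Rightarrow> complex" where
  "aw_monom k \<mu> z = of_nat (mi_ffact (fst k + \<mu>) (snd k)) / of_real (sqrt (mi_fact (fst k) * mi_fact (snd k)))
     * mi_power z (fst k + \<mu> - snd k)"

text \<open>The exponents form an arbitrary finite family, repetitions included. The image of a
  polynomial arises in exactly this form, so the formula can be applied a second time to a
  composition.\<close>

lemma Op_aw_poly:
  fixes z :: "complex ^ ('d::finite)"
  shows "Op_aw a (\<lambda>z. \<Sum>j\<in>J. c j * mi_power z (\<nu> j)) z = (\<Sum>k | a k \<noteq> 0. a k * (\<Sum>j\<in>J. c j * aw_monom k (\<nu> j) z))"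
proof -
  let ?g = "\<lambda>\<alpha> \<beta> \<mu> w. mi_power w \<alpha> * mi_power (cnj_vec w) \<beta> * mi_power w \<mu> * exp (cform (z - w) w)"
  have "symbol a w w * (\<Sum>j\<in>J. c j * mi_power w (\<nu> j)) * exp (cform (z - w) w) =
      (\<Sum>k | a k \<noteq> 0. \<Sum>j\<in>J. (a k * c j / of_real (sqrt (mi_fact (fst k) * mi_fact (snd k)))) * ?g (fst k) (snd k) (\<nu> j) w)" for w
    by (simp add: symbol_def e_basis_def sum_distrib_left sum_distrib_right case_prod_unfold mult_ac real_sqrt_mult)
       (intro sum.cong refl, simp add: sum_divide_distrib mult_ac)
  then have "(LINT w|lborel. symbol a w w * (\<Sum>j\<in>J. c j * mi_power w (\<nu> j)) * exp (cform (z - w) w)) =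
      (\<Sum>k | a k \<noteq> 0. \<Sum>j\<in>J. (a k * c j / of_real (sqrt (mi_fact (fst k) * mi_fact (snd k)))) * (LINT w|lborel. ?g (fst k) (snd k) (\<nu> j) w))"
    by (simp add: Bochner_Integration.integral_sum Bochner_Integration.integrable_sum integrable_mult_right gaussian_moment_vec(1) integral_mult_right)
  then show ?thesis
    unfolding Op_aw_def gaussian_moment_vec(2) aw_monom_def
    by (simp add: sum_distrib_left field_simps)
qed

section \<open>Composition of anti-Wick operators\<close>

text \<open>Both sides are the coefficient of \<open>x ^ b\<close> in
  \<open>(1 + x) ^ n * ((1 + x) - x) ^ a\<close>, expanded on the left by the binomial theorem in
  \<open>g\<close>.\<close>

lemma alternating_vandermonde:
  "(\<Sum>g\<le>b. (-1) ^ g * int ((a choose g) * ((n + a - g) choose (b - g)))) = int (n choose b)"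
proof (induction a arbitrary: n b)
  case 0
  have "(\<Sum>g\<le>b. (-1) ^ g * int ((0 choose g) * ((n + 0 - g) choose (b - g)))) = (\<Sum>g\<in>{0::nat}. int (n choose b))"
    by (intro sum.mono_neutral_cong_right) auto
  then show ?case by simp
next
  case (Suc a)
  show ?case
  proof (cases b)
    case 0
    then show ?thesis by simp
  next
    case (Suc b')
    let ?t = "\<lambda>n b g. (-1) ^ g * int ((a choose g) * ((n + a - g) choose (b - g)))"
    \<comment> \<open>Pascal's rule on \<open>Suc a choose g\<close>: the part with
      \<open>g - 1\<close> is shifted by one, which flips its sign and lowers
      \<open>b\<close>.\<close>
    have "(\<Sum>g\<le>b. (-1) ^ g * int ((Suc a choose g) * ((n + Suc a - g) choose (b - g))))
        = (\<Sum>g\<le>b. ?t (Suc n) b g) - (\<Sum>g\<le>b'. ?t n b' g)"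
      unfolding Suc sum.atMost_Suc_shift
      by (simp add: algebra_simps sum.distrib sum_negf sum_subtractf)
    then show ?thesis
      unfolding Suc.IH by (simp add: Suc)
  qed
qed

text \<open>Differentiating \<open>j + c\<close> times is differentiating \<open>j\<close> times and
  then \<open>c\<close> times. Multiplication by the remaining factorial reduces this to identities
  between factorials.\<close>

lemma ffact_add:
  "fact (j + c) * (m choose (j + c)) = (fact j * (m choose j)) * (fact c * ((m - j) choose c))"
proof (cases "j + c \<le> m")
  case True
  then have "fact (m - (j + c)) * (fact (j + c) * (m choose (j + c))) = fact m"
    using binomial_fact_lemma[of "j + c" m] by (simp add: mult_ac)
  moreover have "fact (m - (j + c)) * (fact c * ((m - j) choose c)) = fact (m - j)"
    using binomial_fact_lemma[of c "m - j"] True by (simp add: mult_ac)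
  moreover have "fact (m - j) * (fact j * (m choose j)) = fact m"
    using binomial_fact_lemma[of j m] True by (simp add: mult_ac)
  ultimately have "fact (m - (j + c)) * (fact (j + c) * (m choose (j + c))) =
      fact (m - (j + c)) * ((fact j * (m choose j)) * (fact c * ((m - j) choose c)))"
    by (metis mult.assoc mult.commute)
  then show ?thesis
    by (metis fact_nonzero mult_left_cancel)
next
  case False
  then show ?thesis
    by (cases "j \<le> m") (auto simp: binomial_eq_0)
qed

text \<open>The normal ordering identity \<open>z\<^sup>a \<partial>\<^sup>b = \<Sum>\<^sub>g (-1)\<^sup>g g! (a choose g) (b choose g) \<partial>\<^bsup>b-g\<^esup> z\<^bsup>a-g\<^esup>\<close>,
  applied to \<open>z\<^sup>n\<close> and followed by \<open>\<partial>\<^sup>c\<close>.\<close>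

lemma reordering_identity:
  "(\<Sum>g\<le>min a b. (-1) ^ g * int (fact g * (a choose g) * (b choose g) * (fact (c + (b - g)) * ((n + a - g) choose (c + (b - g))))))
     = int ((fact b * (n choose b)) * (fact c * ((n + a - b) choose c)))"
proof -
  have "(\<Sum>g\<le>min a b. (-1) ^ g * int (fact g * (a choose g) * (b choose g) * (fact (c + (b - g)) * ((n + a - g) choose (c + (b - g))))))
     = (\<Sum>g\<le>min a b. int (fact b * (fact c * ((n + a - b) choose c))) * ((-1) ^ g * int ((a choose g) * ((n + a - g) choose (b - g)))))"
  proof (rule sum.cong)
    fix g assume "g \<in> {..min a b}"
    then have g: "g \<le> a" "g \<le> b" by auto
    have 1: "fact (c + (b - g)) * ((n + a - g) choose (c + (b - g))) =
        (fact (b - g) * ((n + a - g) choose (b - g))) * (fact c * ((n + a - b) choose c))"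
      using ffact_add[of "b - g" c "n + a - g"] g by (simp add: add.commute)
    have 2: "fact g * (b choose g) * fact (b - g) = fact b"
      using binomial_fact_lemma[OF g(2)] by (simp add: mult_ac)
    have 3: "fact g * (a choose g) * (b choose g) * (fact (c + (b - g)) * ((n + a - g) choose (c + (b - g))))
        = (fact g * (b choose g) * fact (b - g)) * (fact c * ((n + a - b) choose c)) * ((a choose g) * ((n + a - g) choose (b - g)))"
      unfolding 1 by (simp only: mult_ac)
    then show "(-1) ^ g * int (fact g * (a choose g) * (b choose g) * (fact (c + (b - g)) * ((n + a - g) choose (c + (b - g)))))
        = int (fact b * (fact c * ((n + a - b) choose c))) * ((-1) ^ g * int ((a choose g) * ((n + a - g) choose (b - g))))"
      unfolding 3 2 by (simp only: of_nat_mult mult_ac)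
  qed simp
  also have "\<dots> = int (fact b * (fact c * ((n + a - b) choose c))) *
      (\<Sum>g\<le>min a b. (-1) ^ g * int ((a choose g) * ((n + a - g) choose (b - g))))"
    by (simp only: sum_distrib_left)
  also have "(\<Sum>g\<le>min a b. (-1) ^ g * int ((a choose g) * ((n + a - g) choose (b - g))))
      = (\<Sum>g\<le>b. (-1) ^ g * int ((a choose g) * ((n + a - g) choose (b - g))))"
    by (intro sum.mono_neutral_left) (auto simp: binomial_eq_0)
  finally show ?thesis
    unfolding alternating_vandermonde by simp
qed

section \<open>Sums over boxes of multi-indices\<close>

lemma vec_box_eq: "{\<gamma> :: nat ^ 'd::finite. \<forall>i. \<gamma> $ i \<le> N i} = vec_lambda ` (\<Pi>\<^sub>E i\<in>UNIV. {..N i})"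
proof -
  have "\<gamma> \<in> vec_lambda ` (\<Pi>\<^sub>E i\<in>UNIV. {..N i})" if "\<forall>i. \<gamma> $ i \<le> N i" for \<gamma>
    using that by (intro image_eqI[of _ _ "\<lambda>i. \<gamma> $ i"]) auto
  then show ?thesis by (auto simp: PiE_iff)
qed

lemma finite_vec_box: "finite {\<gamma> :: nat ^ 'd::finite. \<forall>i. \<gamma> $ i \<le> N i}"
  unfolding vec_box_eq by (intro finite_imageI finite_PiE) auto

lemma sum_vec_box_prod:
  fixes f :: "'d::finite \<Rightarrow> nat \<Rightarrow> 'b::comm_semiring_1"
  shows "(\<Sum>\<gamma> | \<forall>i. \<gamma> $ i \<le> N i. \<Prod>i\<in>UNIV. f i (\<gamma> $ i)) = (\<Prod>i\<in>UNIV. \<Sum>g\<le>N i. f i g)"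
proof -
  have "(\<Sum>\<gamma> | \<forall>i. \<gamma> $ i \<le> N i. \<Prod>i\<in>UNIV. f i (\<gamma> $ i)) = (\<Sum>g\<in>(\<Pi>\<^sub>E i\<in>UNIV. {..N i}). \<Prod>i\<in>UNIV. f i (g i))"
    unfolding vec_box_eq by (subst sum.reindex) (auto simp: inj_on_def vec_lambda_inject)
  then show ?thesis by (simp add: prod_sum_PiE)
qed

section \<open>The product formula in the normalised basis\<close>

lemma mi_fact_pos [simp]: "mi_fact \<alpha> > 0"
  by (simp add: mi_fact_def prod_pos)

lemma mi_fact_nonzero [simp]: "mi_fact \<alpha> \<noteq> 0"
  by (metis mi_fact_pos less_irrefl)

text \<open>The product over the components of the binomials
  \<open>\<alpha> $ i + \<beta> $ i choose \<beta> $ i\<close>; written through factorials it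
  combines directly with the normalising square roots.\<close>

definition mi_binom :: "('d::finite) mindex \<Rightarrow> 'd mindex \<Rightarrow> real" where
  "mi_binom \<alpha> \<beta> = mi_fact (\<alpha> + \<beta>) / (mi_fact \<alpha> * mi_fact \<beta>)"

text \<open>One contribution to the product: the factors are taken at
  \<open>(\<alpha>1 + \<gamma>, \<beta>1)\<close> and
  \<open>(\<alpha>2, \<beta>2 + \<gamma>)\<close>, and \<gamma> is contracted. Recording what is
  left after the contraction avoids truncated subtraction.\<close>

type_synonym 'd quintuple = "'d mindex \<times> 'd mindex \<times> 'd mindex \<times> 'd mindex \<times> 'd mindex"

text \<open>Multiplying the basis elements of indices \<alpha>1 and \<alpha>2 produces the square
  root of \<open>mi_binom \<alpha>1 \<alpha>2\<close>, and likewise for \<beta>. The two derivatives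
  of order \<gamma> together with the division by the factorial of \<gamma> produce the square roots
  of the other two binomials.\<close>

definition aw_coeff :: "('d::finite) quintuple \<Rightarrow> real" where
  "aw_coeff = (\<lambda>(\<alpha>1, \<alpha>2, \<beta>1, \<beta>2, \<gamma>).
     (-1) ^ mi_abs \<gamma> * sqrt (mi_binom \<alpha>1 \<alpha>2 * mi_binom \<beta>1 \<beta>2 * mi_binom \<alpha>1 \<gamma> * mi_binom \<beta>2 \<gamma>))"

definition aw_term :: "('d::finite) fseries \<Rightarrow> 'd fseries \<Rightarrow> 'd quintuple \<Rightarrow> complex" where
  "aw_term c d = (\<lambda>(\<alpha>1, \<alpha>2, \<beta>1, \<beta>2, \<gamma>).
     of_real (aw_coeff (\<alpha>1, \<alpha>2, \<beta>1, \<beta>2, \<gamma>)) * c (\<alpha>1 + \<gamma>, \<beta>1) * d (\<alpha>2, \<beta>2 + \<gamma>))"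

definition aw_fibre :: "('d::finite) mindex \<times> 'd mindex \<Rightarrow> 'd quintuple set" where
  "aw_fibre k = {(\<alpha>1, \<alpha>2, \<beta>1, \<beta>2, \<gamma>). (\<alpha>1 + \<alpha>2, \<beta>1 + \<beta>2) = k}"

text \<open>The coefficients, in the normalised basis, of \<open>\<Sum>\<^sub>\<gamma> (-1)\<^bsup>|\<gamma>|\<^esup> / \<gamma>! (\<partial>\<^sub>z\<^sup>\<gamma> c) (\<partial>\<^sub>w\<^sup>\<gamma> d)\<close>, where \<open>\<partial>\<^sub>w\<close> differentiates
  in the conjugate of \<open>w\<close>.\<close>

definition aw_prod :: "('d::finite) fseries \<Rightarrow> 'd fseries \<Rightarrow> 'd fseries" where
  "aw_prod c d k = infsum (aw_term c d) (aw_fibre k)"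

text \<open>Passing back from the normalised basis to monomials leaves, apart from the
  normalisations of the two factors, the integer coefficient of normal ordering.\<close>

lemma aw_coeff_normalised:
  "aw_coeff (\<alpha>1, \<alpha>2, \<beta>1, \<beta>2, \<gamma>) / sqrt (mi_fact (\<alpha>1 + \<alpha>2) * mi_fact (\<beta>1 + \<beta>2)) =
     (-1) ^ mi_abs \<gamma> * (mi_fact \<gamma> * mi_binom \<alpha>1 \<gamma> * mi_binom \<beta>2 \<gamma>)
       / sqrt (mi_fact (\<alpha>1 + \<gamma>) * mi_fact (\<beta>2 + \<gamma>) * mi_fact \<alpha>2 * mi_fact \<beta>1)"
proof -
  have "sqrt (mi_binom \<alpha>1 \<alpha>2 * mi_binom \<beta>1 \<beta>2 * mi_binom \<alpha>1 \<gamma> * mi_binom \<beta>2 \<gamma>) =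
      sqrt (mi_fact (\<alpha>1 + \<alpha>2) * mi_fact (\<beta>1 + \<beta>2)) * (mi_fact \<gamma> * mi_binom \<alpha>1 \<gamma> * mi_binom \<beta>2 \<gamma>)
       / sqrt (mi_fact (\<alpha>1 + \<gamma>) * mi_fact (\<beta>2 + \<gamma>) * mi_fact \<alpha>2 * mi_fact \<beta>1)" (is "_ = ?R")
  proof (rule real_sqrt_unique)
    show "?R\<^sup>2 = mi_binom \<alpha>1 \<alpha>2 * mi_binom \<beta>1 \<beta>2 * mi_binom \<alpha>1 \<gamma> * mi_binom \<beta>2 \<gamma>"
      by (simp add: power_mult_distrib power_divide less_imp_le mi_binom_def field_simps power2_eq_square)
  qed (simp add: mi_binom_def less_imp_le)
  then show ?thesis
    by (simp add: aw_coeff_def field_simps)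
qed

lemma mi_binom_eq:
  assumes "\<forall>i. \<gamma> $ i \<le> A $ i"
  shows "mi_binom (A - \<gamma>) \<gamma> = of_nat (\<Prod>i\<in>UNIV. A $ i choose \<gamma> $ i)"
  using assms by (simp add: mi_binom_def mi_fact_def prod_dividef[symmetric] prod.distrib[symmetric] binomial_fact mult.commute)

text \<open>The left side applies to a monomial: multiply by exponent \<open>a2\<close>,
  differentiate by \<open>B2\<close>, multiply by \<open>A1\<close>, differentiate by
  \<open>b1\<close>. Interchanging the two middle operations by the one-variable identity in every
  coordinate yields the sum over \<gamma>.\<close>

lemma aw_monom_reorder:
  fixes A1 b1 a2 B2 \<mu> :: "('d::finite) mindex"
  shows "of_nat (mi_ffact (a2 + \<mu>) B2) / of_real (sqrt (mi_fact a2 * mi_fact B2)) * aw_monom (A1, b1) (a2 + \<mu> - B2) z =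
     (\<Sum>\<gamma> | \<forall>i. \<gamma> $ i \<le> min (A1 $ i) (B2 $ i).
        of_real (aw_coeff (A1 - \<gamma>, a2, b1, B2 - \<gamma>, \<gamma>)) * aw_monom ((A1 - \<gamma>) + a2, b1 + (B2 - \<gamma>)) \<mu> z)"
    (is "?L = (\<Sum>\<gamma> | ?P \<gamma>. ?R \<gamma>)")
proof -
  \<comment> \<open>All terms share the exponent \<open>e\<close> and the normalisation
    \<open>r\<close>; only the integer \<open>t i g\<close>, one factor per coordinate, depends on
    \<gamma>.\<close>
  define e where "e = A1 + a2 + \<mu> - B2 - b1"
  define r where "r = sqrt (mi_fact A1 * mi_fact B2 * mi_fact a2 * mi_fact b1)"
  define t where "t = (\<lambda>i g. (-1) ^ g * int (fact g * (A1 $ i choose g) * (B2 $ i choose g) *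
        (fact (b1 $ i + (B2 $ i - g)) * ((a2 $ i + \<mu> $ i + A1 $ i - g) choose (b1 $ i + (B2 $ i - g))))))"
  have R: "?R \<gamma> = of_int (\<Prod>i\<in>UNIV. t i (\<gamma> $ i)) / of_real r * mi_power z e" if P: "?P \<gamma>" for \<gamma>
  proof -
    have le: "\<forall>i. \<gamma> $ i \<le> A1 $ i" "\<forall>i. \<gamma> $ i \<le> B2 $ i"
      using P by auto
    have sub: "A1 - \<gamma> + \<gamma> = A1" "B2 - \<gamma> + \<gamma> = B2"
      using le by (simp_all add: vec_eq_iff)
    have exp: "A1 - \<gamma> + a2 + \<mu> - (b1 + (B2 - \<gamma>)) = e"
      unfolding e_def vec_eq_iff
    proof
      fix i
      show "(A1 - \<gamma> + a2 + \<mu> - (b1 + (B2 - \<gamma>))) $ i = (A1 + a2 + \<mu> - B2 - b1) $ i"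
        using le(1)[rule_format, of i] le(2)[rule_format, of i] by simp
    qed
    have "of_int (\<Prod>i\<in>UNIV. t i (\<gamma> $ i)) = (-1) ^ mi_abs \<gamma> * (mi_fact \<gamma> * mi_binom (A1 - \<gamma>) \<gamma> * mi_binom (B2 - \<gamma>) \<gamma>)
        * of_nat (mi_ffact (A1 - \<gamma> + a2 + \<mu>) (b1 + (B2 - \<gamma>)))"
    proof -
      have "A1 $ i - \<gamma> $ i + a2 $ i + \<mu> $ i = a2 $ i + \<mu> $ i + A1 $ i - \<gamma> $ i" for i
        using le(1)[rule_format, of i] by simp
      then show ?thesis
        unfolding mi_binom_eq[OF le(1)] mi_binom_eq[OF le(2)]
        by (simp add: t_def mi_abs_def mi_fact_def mi_ffact_def prod.distrib power_sum)
    qed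
    then have "of_int (\<Prod>i\<in>UNIV. t i (\<gamma> $ i)) / r = aw_coeff (A1 - \<gamma>, a2, b1, B2 - \<gamma>, \<gamma>)
        / sqrt (mi_fact (A1 - \<gamma> + a2) * mi_fact (b1 + (B2 - \<gamma>))) * of_nat (mi_ffact (A1 - \<gamma> + a2 + \<mu>) (b1 + (B2 - \<gamma>)))"
      unfolding aw_coeff_normalised sub r_def by simp
    then have "complex_of_real (of_int (\<Prod>i\<in>UNIV. t i (\<gamma> $ i)) / r) = complex_of_real (aw_coeff (A1 - \<gamma>, a2, b1, B2 - \<gamma>, \<gamma>)
        / sqrt (mi_fact (A1 - \<gamma> + a2) * mi_fact (b1 + (B2 - \<gamma>))) * of_nat (mi_ffact (A1 - \<gamma> + a2 + \<mu>) (b1 + (B2 - \<gamma>))))"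
      by (simp only:)
    then show ?thesis
      by (simp add: aw_monom_def exp)
  qed
  have "(\<Sum>\<gamma> | ?P \<gamma>. ?R \<gamma>) = (\<Sum>\<gamma> | ?P \<gamma>. of_int (\<Prod>i\<in>UNIV. t i (\<gamma> $ i)) / of_real r * mi_power z e)"
    using R by (intro sum.cong) auto
  also have "\<dots> = of_int (\<Sum>\<gamma> | ?P \<gamma>. \<Prod>i\<in>UNIV. t i (\<gamma> $ i)) / of_real r * mi_power z e"
    by (simp add: sum_distrib_right sum_divide_distrib)
  also have "(\<Sum>\<gamma> | ?P \<gamma>. \<Prod>i\<in>UNIV. t i (\<gamma> $ i)) = (\<Prod>i\<in>UNIV. \<Sum>g\<le>min (A1 $ i) (B2 $ i). t i g)"
    by (rule sum_vec_box_prod)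
  also have "\<dots> = int (mi_ffact (a2 + \<mu>) B2 * (\<Prod>i\<in>UNIV. fact (b1 $ i) * ((a2 $ i + \<mu> $ i + A1 $ i - B2 $ i) choose b1 $ i)))"
    unfolding t_def reordering_identity by (simp add: mi_ffact_def prod.distrib)
  finally have sum: "(\<Sum>\<gamma> | ?P \<gamma>. ?R \<gamma>) = of_nat (mi_ffact (a2 + \<mu>) B2 * (\<Prod>i\<in>UNIV. fact (b1 $ i) * ((a2 $ i + \<mu> $ i + A1 $ i - B2 $ i) choose b1 $ i)))
      / of_real r * mi_power z e"
    by simp
  \<comment> \<open>If \<open>B2\<close> is not below \<open>a2 + \<mu>\<close>, the truncated
    exponents differ, but then the falling factorial makes both sides 0.\<close>
  show ?thesis
  proof (cases "\<forall>i. B2 $ i \<le> a2 $ i + \<mu> $ i")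
    case True
    then have "mi_ffact (A1 + (a2 + \<mu> - B2)) b1 = (\<Prod>i\<in>UNIV. fact (b1 $ i) * ((a2 $ i + \<mu> $ i + A1 $ i - B2 $ i) choose b1 $ i))"
      by (simp add: mi_ffact_def add.commute add.left_commute)
    moreover have "A1 + (a2 + \<mu> - B2) - b1 = e"
      using True by (simp add: e_def vec_eq_iff add.assoc)
    ultimately show ?thesis
      unfolding sum by (simp add: aw_monom_def r_def real_sqrt_mult mult_ac)
  next
    case False
    then have "mi_ffact (a2 + \<mu>) B2 = 0"
      by (auto simp: mi_ffact_def not_le binomial_eq_0)
    then show ?thesis
      unfolding sum by simp
  qed
qed


section \<open>Finitely supported symbols: the product formula represents composition\<close>

definition aw_support :: "('d::finite) fseries \<Rightarrow> 'd fseries \<Rightarrow> 'd quintuple set" where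
  "aw_support c d = {(\<alpha>1, \<alpha>2, \<beta>1, \<beta>2, \<gamma>). c (\<alpha>1 + \<gamma>, \<beta>1) \<noteq> 0 \<and> d (\<alpha>2, \<beta>2 + \<gamma>) \<noteq> 0}"

lemma aw_term_eq_0: "q \<notin> aw_support c d \<Longrightarrow> aw_term c d q = 0"
  by (auto simp: aw_support_def aw_term_def split: prod.splits)

text \<open>Quintuples in the support correspond bijectively to two indices of the factors together
  with a \<gamma> below \<open>fst k1\<close> and \<open>snd k2\<close>, which is the shape in which
  the reordering of operators delivers its terms.\<close>

lemma sum_aw_support:
  fixes f :: "('d::finite) quintuple \<Rightarrow> complex"
  assumes "c \<in> A_fin" "d \<in> A_fin"
  shows "finite (aw_support c d)"
    and "(\<Sum>q\<in>aw_support c d. f q) = (\<Sum>k1 | c k1 \<noteq> 0. \<Sum>k2 | d k2 \<noteq> 0.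
      \<Sum>\<gamma> | \<forall>i. \<gamma> $ i \<le> min (fst k1 $ i) (snd k2 $ i). f (fst k1 - \<gamma>, fst k2, snd k1, snd k2 - \<gamma>, \<gamma>))"
proof -
  let ?G = "\<lambda>k1 k2. {\<gamma>. \<forall>i. \<gamma> $ i \<le> min (fst k1 $ i) (snd k2 $ i)} :: 'd mindex set"
  let ?I = "Sigma {k. c k \<noteq> 0} (\<lambda>k1. Sigma {k. d k \<noteq> 0} (\<lambda>k2. ?G k1 k2))"
  let ?j = "\<lambda>(k1, k2, \<gamma>). (fst k1 - \<gamma>, fst k2, snd k1, snd k2 - \<gamma>, \<gamma>)"
  have fin: "finite {k. c k \<noteq> 0}" "finite {k. d k \<noteq> 0}" "finite (?G k1 k2)" for k1 k2
    using assms finite_vec_box[where 'd='d and N="\<lambda>i. min (fst k1 $ i) (snd k2 $ i)"] by (auto simp: A_fin_def)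
  have sub: "A - \<gamma> + \<gamma> = A" if "\<forall>i. \<gamma> $ i \<le> A $ i" for A \<gamma> :: "'d mindex"
    using that by (simp add: vec_eq_iff)
  have bij: "bij_betw ?j ?I (aw_support c d)"
    by (rule bij_betw_byWitness[where f' = "\<lambda>(\<alpha>1, \<alpha>2, \<beta>1, \<beta>2, \<gamma>). ((\<alpha>1 + \<gamma>, \<beta>1), (\<alpha>2, \<beta>2 + \<gamma>), \<gamma>)"])
       (auto simp: aw_support_def sub)
  have "finite ?I"
    by (intro finite_SigmaI fin)
  then show "finite (aw_support c d)"
    using bij_betw_finite[OF bij] by blast
  have "(\<Sum>q\<in>aw_support c d. f q) = (\<Sum>x\<in>?I. f (?j x))"
    by (rule sum.reindex_bij_betw[OF bij, symmetric])
  also have "\<dots> = (\<Sum>k1 | c k1 \<noteq> 0. \<Sum>x\<in>Sigma {k. d k \<noteq> 0} (?G k1). f (?j (k1, x)))"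
    by (subst sum.Sigma) (use fin in \<open>auto intro!: finite_SigmaI simp: case_prod_unfold\<close>)
  also have "\<dots> = (\<Sum>k1 | c k1 \<noteq> 0. \<Sum>k2 | d k2 \<noteq> 0. \<Sum>\<gamma>\<in>?G k1 k2. f (?j (k1, k2, \<gamma>)))"
    by (intro sum.cong refl, subst sum.Sigma) (use fin in \<open>auto simp: case_prod_unfold\<close>)
  finally show "(\<Sum>q\<in>aw_support c d. f q) = (\<Sum>k1 | c k1 \<noteq> 0. \<Sum>k2 | d k2 \<noteq> 0.
      \<Sum>\<gamma> | \<forall>i. \<gamma> $ i \<le> min (fst k1 $ i) (snd k2 $ i). f (fst k1 - \<gamma>, fst k2, snd k1, snd k2 - \<gamma>, \<gamma>))"
    by simp
qed

definition aw_key :: "('d::finite) quintuple \<Rightarrow> 'd mindex \<times> 'd mindex" where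
  "aw_key = (\<lambda>(\<alpha>1, \<alpha>2, \<beta>1, \<beta>2, \<gamma>). (\<alpha>1 + \<alpha>2, \<beta>1 + \<beta>2))"

lemma aw_prod_finite:
  assumes "c \<in> A_fin" "d \<in> A_fin"
  shows "aw_prod c d k = (\<Sum>q | q \<in> aw_support c d \<and> aw_key q = k. aw_term c d q)"
proof -
  have "aw_prod c d k = infsum (aw_term c d) {q \<in> aw_support c d. aw_key q = k}"
    unfolding aw_prod_def
    by (rule infsum_cong_neutral) (auto simp: aw_fibre_def aw_key_def aw_term_eq_0)
  then show ?thesis
    using sum_aw_support(1)[OF assms] by simp
qed

lemma aw_prod_support:
  assumes "c \<in> A_fin" "d \<in> A_fin"
  shows "{k. aw_prod c d k \<noteq> 0} \<subseteq> aw_key ` aw_support c d"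
proof
  fix k assume "k \<in> {k. aw_prod c d k \<noteq> 0}"
  then have "(\<Sum>q | q \<in> aw_support c d \<and> aw_key q = k. aw_term c d q) \<noteq> 0"
    by (simp add: aw_prod_finite[OF assms])
  then have "{q. q \<in> aw_support c d \<and> aw_key q = k} \<noteq> {}"
    by (metis sum.empty)
  then show "k \<in> aw_key ` aw_support c d"
    by blast
qed

lemma aw_prod_A_fin:
  assumes "c \<in> A_fin" "d \<in> A_fin"
  shows "aw_prod c d \<in> A_fin"
  unfolding A_fin_def mem_Collect_eq
  by (intro finite_subset[OF aw_prod_support] finite_imageI sum_aw_support(1) assms)

lemma aw_prod_sum:
  assumes "c \<in> A_fin" "d \<in> A_fin"
  shows "(\<Sum>k | aw_prod c d k \<noteq> 0. aw_prod c d k * f k) = (\<Sum>q\<in>aw_support c d. aw_term c d q * f (aw_key q))"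
proof -
  have fin: "finite (aw_support c d)"
    by (rule sum_aw_support(1)[OF assms])
  have "(\<Sum>k | aw_prod c d k \<noteq> 0. aw_prod c d k * f k) = (\<Sum>k\<in>aw_key ` aw_support c d. aw_prod c d k * f k)"
    using fin aw_prod_support[OF assms] by (intro sum.mono_neutral_left) auto
  also have "\<dots> = (\<Sum>k\<in>aw_key ` aw_support c d. \<Sum>q | q \<in> aw_support c d \<and> aw_key q = k. aw_term c d q * f (aw_key q))"
    by (simp add: aw_prod_finite[OF assms] sum_distrib_right)
  also have "\<dots> = (\<Sum>q\<in>aw_support c d. aw_term c d q * f (aw_key q))"
    by (rule sum.image_gen[OF fin, symmetric])
  finally show ?thesis .
qed

text \<open>By linearity it suffices to reorder the operators for each pair of basis symbols and
  each monomial; the resulting terms are then regrouped by their output index.\<close>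

lemma Op_aw_prod:
  fixes c d :: "('d::finite) fseries"
  assumes "c \<in> A_fin" "d \<in> A_fin" "F \<in> polynomials"
  shows "Op_aw c (Op_aw d F) = Op_aw (aw_prod c d) F"
proof
  fix z :: "complex ^ 'd"
  obtain S f where S: "finite S" and F: "F = (\<lambda>z. \<Sum>\<mu>\<in>S. f \<mu> * mi_power z \<mu>)"
    using assms(3) by (auto simp: polynomials_def)
  have fin: "finite {k. d k \<noteq> 0}"
    using assms by (simp add: A_fin_def)
  define w where "w k \<mu> = complex_of_nat (mi_ffact (fst k + \<mu>) (snd k)) / of_real (sqrt (mi_fact (fst k) * mi_fact (snd k)))" for k and \<mu> :: "'d mindex"
  \<comment> \<open>The image is indexed by pairs of a symbol index and a monomial; different pairs
    may give the same exponent.\<close>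
  have "Op_aw d F = (\<lambda>z. \<Sum>j\<in>{k. d k \<noteq> 0} \<times> S. (d (fst j) * f (snd j) * w (fst j) (snd j)) * mi_power z (fst (fst j) + snd j - snd (fst j)))"
    unfolding F Op_aw_poly aw_monom_def w_def[symmetric]
    by (simp add: sum_distrib_left sum.cartesian_product case_prod_unfold mult_ac)
  then have "Op_aw c (Op_aw d F) z = (\<Sum>k | c k \<noteq> 0. c k * (\<Sum>j\<in>{k. d k \<noteq> 0} \<times> S. (d (fst j) * f (snd j) * w (fst j) (snd j)) *
      aw_monom k (fst (fst j) + snd j - snd (fst j)) z))"
    by (simp only: Op_aw_poly)
  also have "\<dots> = (\<Sum>k1 | c k1 \<noteq> 0. \<Sum>k2 | d k2 \<noteq> 0. \<Sum>\<mu>\<in>S. c k1 * d k2 * f \<mu> *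
      (w k2 \<mu> * aw_monom k1 (fst k2 + \<mu> - snd k2) z))"
    by (simp add: sum_distrib_left sum.cartesian_product case_prod_unfold mult_ac)
  also have "\<dots> = (\<Sum>k1 | c k1 \<noteq> 0. \<Sum>k2 | d k2 \<noteq> 0. \<Sum>\<mu>\<in>S. c k1 * d k2 * f \<mu> *
      (\<Sum>\<gamma> | \<forall>i. \<gamma> $ i \<le> min (fst k1 $ i) (snd k2 $ i).
        of_real (aw_coeff (fst k1 - \<gamma>, fst k2, snd k1, snd k2 - \<gamma>, \<gamma>)) * aw_monom ((fst k1 - \<gamma>) + fst k2, snd k1 + (snd k2 - \<gamma>)) \<mu> z))"
    unfolding w_def
    by (subst aw_monom_reorder[where ?A1.0 = "fst k1" and ?b1.0 = "snd k1" for k1, unfolded prod.collapse]) (rule refl)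
  also have "\<dots> = (\<Sum>k1 | c k1 \<noteq> 0. \<Sum>k2 | d k2 \<noteq> 0. \<Sum>\<gamma> | \<forall>i. \<gamma> $ i \<le> min (fst k1 $ i) (snd k2 $ i).
      aw_term c d (fst k1 - \<gamma>, fst k2, snd k1, snd k2 - \<gamma>, \<gamma>) *
        (\<Sum>\<mu>\<in>S. f \<mu> * aw_monom (aw_key (fst k1 - \<gamma>, fst k2, snd k1, snd k2 - \<gamma>, \<gamma>)) \<mu> z))"
  proof (rule sum.cong[OF refl], rule sum.cong[OF refl])
    fix k1 k2 :: "'d mindex \<times> 'd mindex"
    have sub: "A - \<gamma> + \<gamma> = A" if "\<forall>i. \<gamma> $ i \<le> A $ i" for A \<gamma> :: "'d mindex"
      using that by (simp add: vec_eq_iff)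
    let ?G = "{\<gamma>. \<forall>i. \<gamma> $ i \<le> min (fst k1 $ i) (snd k2 $ i)}"
    let ?h = "\<lambda>\<gamma> \<mu>. of_real (aw_coeff (fst k1 - \<gamma>, fst k2, snd k1, snd k2 - \<gamma>, \<gamma>)) * aw_monom ((fst k1 - \<gamma>) + fst k2, snd k1 + (snd k2 - \<gamma>)) \<mu> z"
    have "(\<Sum>\<mu>\<in>S. c k1 * d k2 * f \<mu> * (\<Sum>\<gamma>\<in>?G. ?h \<gamma> \<mu>)) = (\<Sum>\<gamma>\<in>?G. \<Sum>\<mu>\<in>S. c k1 * d k2 * f \<mu> * ?h \<gamma> \<mu>)"
      by (simp only: sum_distrib_left) (rule sum.swap)
    also have "\<dots> = (\<Sum>\<gamma>\<in>?G. aw_term c d (fst k1 - \<gamma>, fst k2, snd k1, snd k2 - \<gamma>, \<gamma>) *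
        (\<Sum>\<mu>\<in>S. f \<mu> * aw_monom (aw_key (fst k1 - \<gamma>, fst k2, snd k1, snd k2 - \<gamma>, \<gamma>)) \<mu> z))"
      by (intro sum.cong refl) (auto simp: aw_term_def aw_key_def sub sum_distrib_left mult_ac)
    finally show "(\<Sum>\<mu>\<in>S. c k1 * d k2 * f \<mu> * (\<Sum>\<gamma>\<in>?G. ?h \<gamma> \<mu>)) = (\<Sum>\<gamma>\<in>?G. aw_term c d (fst k1 - \<gamma>, fst k2, snd k1, snd k2 - \<gamma>, \<gamma>) *
        (\<Sum>\<mu>\<in>S. f \<mu> * aw_monom (aw_key (fst k1 - \<gamma>, fst k2, snd k1, snd k2 - \<gamma>, \<gamma>)) \<mu> z))" .
  qed
  also have "\<dots> = (\<Sum>q\<in>aw_support c d. aw_term c d q * (\<Sum>\<mu>\<in>S. f \<mu> * aw_monom (aw_key q) \<mu> z))"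
    by (rule sum_aw_support(2)[OF assms(1,2), symmetric])
  also have "\<dots> = Op_aw (aw_prod c d) F z"
    unfolding F Op_aw_poly by (rule aw_prod_sum[OF assms(1,2), symmetric])
  finally show "Op_aw c (Op_aw d F) z = Op_aw (aw_prod c d) F z" .
qed

text \<open>The symbol supported at \<open>(0, \<beta>)\<close> acts as a multiple of the
  \<beta>-derivative. Evaluated at 0 it kills every other monomial and isolates the coefficient of
  index \<beta>.\<close>

lemma mi_power_independent:
  fixes c :: "('d::finite) mindex \<Rightarrow> complex"
  assumes "finite S" and zero: "\<And>z. (\<Sum>\<alpha>\<in>S. c \<alpha> * mi_power z \<alpha>) = 0" and "\<beta> \<in> S"
  shows "c \<beta> = 0"
proof -
  define a :: "'d fseries" where "a k = (if k = (0, \<beta>) then 1 else 0)" for k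
  have off: "aw_monom (0, \<beta>) \<alpha> 0 = 0" if "\<alpha> \<noteq> \<beta>" for \<alpha>
  proof (cases "\<forall>i. \<beta> $ i \<le> \<alpha> $ i")
    case True
    then have "\<exists>i. \<alpha> $ i - \<beta> $ i > 0"
      using that by (auto simp: vec_eq_iff) (metis le_neq_implies_less)
    then show ?thesis
      by (auto simp: aw_monom_def mi_power_def zero_power)
  next
    case False
    then show ?thesis
      by (auto simp: aw_monom_def mi_ffact_def not_le binomial_eq_0)
  qed
  have "mi_ffact \<beta> \<beta> \<noteq> 0" "mi_fact \<beta> \<noteq> 0" "mi_fact (0 :: 'd mindex) \<noteq> 0"
    by (simp_all add: mi_ffact_def)
  then have on: "aw_monom (0, \<beta>) \<beta> 0 \<noteq> 0"
    by (simp add: aw_monom_def mi_power_def)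
  have "{k. a k \<noteq> 0} = {(0, \<beta>)}"
    by (auto simp: a_def)
  then have "(\<Sum>\<alpha>\<in>S. c \<alpha> * aw_monom (0, \<beta>) \<alpha> 0) = Op_aw a (\<lambda>z. \<Sum>\<alpha>\<in>S. c \<alpha> * mi_power z \<alpha>) 0"
    unfolding Op_aw_poly by (simp add: a_def)
  also have "\<dots> = 0"
    unfolding zero by (simp add: Op_aw_def)
  also have "(\<Sum>\<alpha>\<in>S. c \<alpha> * aw_monom (0, \<beta>) \<alpha> 0) = (\<Sum>\<alpha>\<in>S. if \<alpha> = \<beta> then c \<beta> * aw_monom (0, \<beta>) \<beta> 0 else 0)"
    using off by (intro sum.cong) auto
  also have "\<dots> = c \<beta> * aw_monom (0, \<beta>) \<beta> 0"
    using assms by (simp add: sum.delta)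
  finally show ?thesis
    using on by simp
qed

text \<open>The commutator of the \<open>b\<close>-th derivative with multiplication by
  \<open>z\<close> is \<open>b\<close> times the derivative of order \<open>b - 1\<close>, here
  applied to \<open>z ^ m\<close>. Cases arise because \<open>z * z ^ (m - b)\<close> has the wrong
  exponent once \<open>b > m\<close>; its coefficient is 0 there.\<close>

lemma ffact_commutator:
  fixes z :: complex
  shows "of_nat (fact b * (Suc m choose b)) * z ^ (Suc m - b) - of_nat (fact b * (m choose b)) * (z * z ^ (m - b))
     = of_nat b * (of_nat (fact (b - 1) * (m choose (b - 1))) * z ^ (m - (b - 1)))"
proof (cases b)
  case (Suc b')
  consider "b' < m" | "b' = m" | "b' > m" by linarith
  then show ?thesis
  proof cases
    case 1
    then have "z * z ^ (m - Suc b') = z ^ (m - b')"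
      by (simp add: Suc_diff_Suc flip: power_Suc)
    then show ?thesis
      unfolding Suc by (simp add: algebra_simps)
  qed (simp_all add: Suc binomial_eq_0 algebra_simps)
qed simp

text \<open>Commuting the operator of \<open>b\<close> with multiplication by \<open>z\<^sub>i\<close> lowers its order, which allows
  an induction over the order.\<close>

lemma normal_ordered_unique:
  fixes b :: "('d::finite) fseries"
  assumes "finite {k. b k \<noteq> 0}"
    and "\<And>k. b k \<noteq> 0 \<Longrightarrow> mi_abs (snd k) \<le> N"
    and "\<And>\<mu> z. (\<Sum>k | b k \<noteq> 0. b k * (of_nat (mi_ffact (fst k + \<mu>) (snd k)) * mi_power z (fst k + \<mu> - snd k))) = 0"
  shows "b k = 0"
  using assms
proof (induction N arbitrary: b k)
  case 0
  have snd0: "snd k = 0" if "b k \<noteq> 0" for k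
    using 0(2)[OF that] by (simp add: mi_abs_def vec_eq_iff)
  let ?S = "fst ` {k. b k \<noteq> 0}"
  have inj: "inj_on fst {k. b k \<noteq> 0}"
    by (intro inj_onI) (simp add: prod_eq_iff snd0)
  have "(\<Sum>\<alpha>\<in>?S. b (\<alpha>, 0) * mi_power z \<alpha>) = 0" for z
  proof -
    have "(\<Sum>\<alpha>\<in>?S. b (\<alpha>, 0) * mi_power z \<alpha>) = (\<Sum>k | b k \<noteq> 0. b (fst k, 0) * mi_power z (fst k))"
      by (subst sum.reindex[OF inj]) simp
    also have "\<dots> = (\<Sum>k | b k \<noteq> 0. b k * (of_nat (mi_ffact (fst k + 0) (snd k)) * mi_power z (fst k + 0 - snd k)))"
    proof (intro sum.cong refl)
      fix k assume "k \<in> {k. b k \<noteq> 0}"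
      then have k: "snd k = 0" "(fst k, 0) = k"
        using snd0[of k] by (auto simp: prod_eq_iff)
      show "b (fst k, 0) * mi_power z (fst k) = b k * (of_nat (mi_ffact (fst k + 0) (snd k)) * mi_power z (fst k + 0 - snd k))"
        by (simp only: k) (simp add: mi_ffact_def)
    qed
    also have "\<dots> = 0" by (rule 0(3))
    finally show ?thesis .
  qed
  from mi_power_independent[OF _ this] 0(1) have "b (\<alpha>, 0) = 0" if "\<alpha> \<in> ?S" for \<alpha>
    using that by blast
  then show ?case
    using snd0[of k] by (cases k) force
next
  case (Suc N)
  have zero: "b (\<alpha>, \<beta> + axis i 1) = 0" for \<alpha> \<beta> i
  proof -
    \<comment> \<open>The coefficients of the commutator with the \<open>i\<close>-th variable,
      placed at the index lowered by \<open>axis i 1\<close>; the numerical factor is the one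
      produced by the commutator.\<close>
    define b' :: "'d fseries" where "b' k = of_nat (snd k $ i + 1) * b (fst k, snd k + axis i 1)" for k
    let ?u = "\<lambda>k. (fst k, snd k + axis i 1) :: 'd mindex \<times> 'd mindex"
    let ?M = "\<lambda>k \<mu> z. of_nat (mi_ffact (fst k + \<mu>) (snd k)) * mi_power z (fst k + \<mu> - snd k) :: complex"
    have inj: "inj ?u"
      by (auto simp: inj_on_def prod_eq_iff)
    have supp: "b' k \<noteq> 0 \<longleftrightarrow> b (?u k) \<noteq> 0" for k
      unfolding b'_def by (metis of_nat_eq_0_iff mult_eq_0_iff add_is_0 zero_neq_one)
    have img: "?u ` {k. b' k \<noteq> 0} = {k. b k \<noteq> 0 \<and> snd k $ i \<noteq> 0}"
    proof -
      have "k \<in> ?u ` {k. b' k \<noteq> 0}" if "b k \<noteq> 0" "snd k $ i \<noteq> 0" for k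
      proof -
        have "?u (fst k, snd k - axis i 1) = k"
          using that(2) by (auto simp: prod_eq_iff vec_eq_iff axis_def)
        then show ?thesis
          using that supp[of "(fst k, snd k - axis i 1)"] by (intro image_eqI[of _ _ "(fst k, snd k - axis i 1)"]) auto
      qed
      then show ?thesis by (auto simp: supp)
    qed
    have "b' (\<alpha>, \<beta>) = 0"
    proof (rule Suc.IH)
      have "finite (?u ` {k. b' k \<noteq> 0})"
        unfolding img by (rule finite_subset[OF _ Suc.prems(1)]) auto
      then show "finite {k. b' k \<noteq> 0}"
        using finite_imageD inj inj_on_subset by blast
      show "mi_abs (snd k) \<le> N" if "b' k \<noteq> 0" for k
      proof -
        have "mi_abs (snd k + axis i 1) = mi_abs (snd k) + 1"
          by (simp add: mi_abs_def sum.distrib axis_def)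
        then show ?thesis
          using Suc.prems(2)[of "?u k"] that supp by simp
      qed
      fix \<mu> and z :: "complex ^ 'd"
      have M: "?M k (\<mu> + axis i 1) z - z $ i * ?M k \<mu> z
          = of_nat (snd k $ i) * ?M (fst k, snd k - axis i 1) \<mu> z" for k :: "'d mindex \<times> 'd mindex"
      proof -
        let ?v = "fst k + \<mu>" and ?\<beta> = "snd k"
        let ?P = "\<Prod>j\<in>UNIV - {i}. of_nat (fact (?\<beta> $ j) * (?v $ j choose ?\<beta> $ j)) * z $ j ^ (?v $ j - ?\<beta> $ j) :: complex"
        have split: "of_nat (mi_ffact v \<beta>) * mi_power z (v - \<beta>) =
            of_nat (fact (\<beta> $ i) * (v $ i choose \<beta> $ i)) * z $ i ^ (v $ i - \<beta> $ i) *
            (\<Prod>j\<in>UNIV - {i}. of_nat (fact (\<beta> $ j) * (v $ j choose \<beta> $ j)) * z $ j ^ (v $ j - \<beta> $ j))" for v \<beta>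
          unfolding mi_ffact_def mi_power_def of_nat_prod prod.distrib[symmetric]
          by (subst prod.remove[of _ i]) auto
        have 1: "?M k (\<mu> + axis i 1) z = of_nat (fact (?\<beta> $ i) * (Suc (?v $ i) choose ?\<beta> $ i)) * z $ i ^ (Suc (?v $ i) - ?\<beta> $ i) * ?P"
          unfolding split by (intro arg_cong2[where f="(*)"] prod.cong) (auto simp: axis_def)
        have 2: "?M (fst k, ?\<beta> - axis i 1) \<mu> z = of_nat (fact (?\<beta> $ i - 1) * (?v $ i choose (?\<beta> $ i - 1))) * z $ i ^ (?v $ i - (?\<beta> $ i - 1)) * ?P"
          unfolding fst_conv snd_conv split by (intro arg_cong2[where f="(*)"] prod.cong) (auto simp: axis_def)
        show ?thesis
          unfolding 1 2 unfolding split
          using arg_cong[OF ffact_commutator[of "?\<beta> $ i" "?v $ i" "z $ i"], of "\<lambda>x. x * ?P"]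
          by (simp add: algebra_simps)
      qed
      have "(\<Sum>k | b' k \<noteq> 0. b' k * ?M k \<mu> z) = (\<Sum>k | b' k \<noteq> 0. b (?u k) * (of_nat (snd (?u k) $ i) * ?M (fst (?u k), snd (?u k) - axis i 1) \<mu> z))"
        by (intro sum.cong refl) (simp add: b'_def axis_def algebra_simps)
      also have "\<dots> = (\<Sum>k\<in>?u ` {k. b' k \<noteq> 0}. b k * (of_nat (snd k $ i) * ?M (fst k, snd k - axis i 1) \<mu> z))"
        using inj by (subst sum.reindex) (auto simp: inj_on_def)
      also have "\<dots> = (\<Sum>k | b k \<noteq> 0. b k * (of_nat (snd k $ i) * ?M (fst k, snd k - axis i 1) \<mu> z))"
        unfolding img using Suc.prems(1) by (intro sum.mono_neutral_left) auto
      also have "\<dots> = (\<Sum>k | b k \<noteq> 0. b k * ?M k (\<mu> + axis i 1) z) - z $ i * (\<Sum>k | b k \<noteq> 0. b k * ?M k \<mu> z)"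
        unfolding M[symmetric] by (simp add: right_diff_distrib sum_subtractf sum_distrib_left mult_ac)
      also have "\<dots> = 0"
        unfolding Suc.prems(3) by simp
      finally show "(\<Sum>k | b' k \<noteq> 0. b' k * ?M k \<mu> z) = 0" .
    qed
    then show ?thesis
      by (simp add: b'_def del: of_nat_Suc of_nat_add)
  qed
  \<comment> \<open>By \<open>zero\<close> no coefficient of positive order survives, so the
    induction hypothesis applies to \<open>b\<close> itself.\<close>
  have supp0: "mi_abs (snd k) \<le> 0" if "b k \<noteq> 0" for k
  proof (rule ccontr)
    assume "\<not> mi_abs (snd k) \<le> 0"
    then obtain i where "snd k $ i \<noteq> 0"
      by (auto simp: mi_abs_def)
    then have "k = (fst k, snd k - axis i 1 + axis i 1)"
      by (auto simp: prod_eq_iff vec_eq_iff axis_def)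
    then show False
      using that zero by metis
  qed
  have "mi_abs (snd k) \<le> N" if "b k \<noteq> 0" for k
    using supp0[OF that] by simp
  then show ?case
    using Suc.IH[of b k] Suc.prems by blast
qed

text \<open>This makes the description in \<open>twisted_aw\<close> definite. After division by the
  normalisation the difference of the symbols is an operator in which all derivatives stand to the
  left, and testing on monomials suffices.\<close>

lemma Op_aw_inj:
  fixes b1 b2 :: "('d::finite) fseries"
  assumes "b1 \<in> A_fin" "b2 \<in> A_fin" and eq: "\<forall>F\<in>polynomials. Op_aw b1 F = Op_aw b2 F"
  shows "b1 = b2"
proof
  fix k
  define S where "S = {k. b1 k \<noteq> 0} \<union> {k. b2 k \<noteq> 0}"
  have S: "finite S"
    using assms by (auto simp: S_def A_fin_def)
  define q where "q k = complex_of_real (sqrt (mi_fact (fst k) * mi_fact (snd k)))" for k :: "'d mindex \<times> 'd mindex"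
  have q: "q k \<noteq> 0" for k
    by (simp add: q_def)
  define b where "b k = (b1 k - b2 k) / q k" for k
  have supp: "{k. b k \<noteq> 0} \<subseteq> S"
    by (auto simp: b_def S_def)
  then have fin: "finite {k. b k \<noteq> 0}"
    using S finite_subset by blast
  have "b k = 0"
  proof (rule normal_ordered_unique[where N = "Max ((\<lambda>k. mi_abs (snd k)) ` S)"])
    show "mi_abs (snd k) \<le> Max ((\<lambda>k. mi_abs (snd k)) ` S)" if "b k \<noteq> 0" for k
      using that supp S by (intro Max_ge) auto
    fix \<mu> :: "'d mindex" and z :: "complex ^ 'd"
    have "(\<lambda>z. mi_power z \<mu>) \<in> polynomials"
      unfolding polynomials_def by (intro CollectI exI[of _ "{\<mu>}"] exI[of _ "\<lambda>_. 1"]) simp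
    then have "Op_aw b1 (\<lambda>z. mi_power z \<mu>) z = Op_aw b2 (\<lambda>z. mi_power z \<mu>) z"
      using eq by metis
    moreover have "Op_aw a (\<lambda>z. mi_power z \<mu>) z = (\<Sum>k\<in>S. a k * aw_monom k \<mu> z)" if "{k. a k \<noteq> 0} \<subseteq> S" for a
    proof -
      have "Op_aw a (\<lambda>z. mi_power z \<mu>) z = (\<Sum>k | a k \<noteq> 0. a k * aw_monom k \<mu> z)"
        using Op_aw_poly[where a = a and J = "{()}" and c = "\<lambda>_. 1" and \<nu> = "\<lambda>_. \<mu>" and z = z] by simp
      also have "\<dots> = (\<Sum>k\<in>S. a k * aw_monom k \<mu> z)"
        using that S by (intro sum.mono_neutral_left) auto
      finally show ?thesis .
    qed
    ultimately have "(\<Sum>k\<in>S. b1 k * aw_monom k \<mu> z) - (\<Sum>k\<in>S. b2 k * aw_monom k \<mu> z) = 0"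
      by (simp add: S_def)
    moreover have "(\<Sum>k | b k \<noteq> 0. b k * (of_nat (mi_ffact (fst k + \<mu>) (snd k)) * mi_power z (fst k + \<mu> - snd k)))
        = (\<Sum>k\<in>S. b k * (of_nat (mi_ffact (fst k + \<mu>) (snd k)) * mi_power z (fst k + \<mu> - snd k)))"
      using supp S by (intro sum.mono_neutral_left) auto
    ultimately show "(\<Sum>k | b k \<noteq> 0. b k * (of_nat (mi_ffact (fst k + \<mu>) (snd k)) * mi_power z (fst k + \<mu> - snd k))) = 0"
      by (simp add: sum_subtractf[symmetric] b_def aw_monom_def q_def[symmetric] divide_simps q algebra_simps)
  qed (rule fin)
  then show "b1 k = b2 k"
    using q[of k] by (simp add: b_def)
qed

lemma twisted_aw_eq:
  assumes "c \<in> A_fin" "d \<in> A_fin"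
  shows "twisted_aw c d = aw_prod c d"
  unfolding twisted_aw_def
proof (rule the_equality)
  show *: "aw_prod c d \<in> A_fin \<and> (\<forall>F\<in>polynomials. Op_aw c (Op_aw d F) = Op_aw (aw_prod c d) F)"
    using aw_prod_A_fin[OF assms] Op_aw_prod[OF assms] by blast
  fix b assume b: "b \<in> A_fin \<and> (\<forall>F\<in>polynomials. Op_aw c (Op_aw d F) = Op_aw b F)"
  then have "\<forall>F\<in>polynomials. Op_aw b F = Op_aw (aw_prod c d) F"
    using * by simp
  then show "b = aw_prod c d"
    using Op_aw_inj b * by blast
qed

section \<open>Weighted sequence spaces\<close>

lemma infsum_ennreal_upper:
  fixes f :: "'k \<Rightarrow> ennreal"
  assumes "finite F" "F \<subseteq> A"
  shows "sum f F \<le> infsum f A"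
  using assms by (subst nonneg_infsum_complete) (auto intro: SUP_upper)

lemma summable_on_ennreal_any [intro, simp]: "(\<lambda>k. f k :: ennreal) summable_on A"
  by (rule nonneg_summable_on_complete) simp

lemma ennreal_powr_finite_iff: "ennreal_powr x q < \<infinity> \<longleftrightarrow> x < \<infinity>"
  by (auto simp: ennreal_powr_def less_top)

lemma ennreal_powr_mono: "x \<le> y \<Longrightarrow> q \<ge> 0 \<Longrightarrow> ennreal_powr x q \<le> ennreal_powr y q"
  by (auto simp: ennreal_powr_def top_unique enn2real_mono less_top intro!: ennreal_leI powr_mono2)

lemma ennreal_powr_cmult:
  assumes "q > 0" "a \<ge> 0"
  shows "ennreal_powr (ennreal a * x) q = ennreal (a powr q) * ennreal_powr x q"
proof (cases "a = 0")
  case False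
  then have "ennreal a \<noteq> 0" "a powr q \<noteq> 0"
    using assms by auto
  then show ?thesis
    using assms by (auto simp: ennreal_powr_def ennreal_mult_eq_top_iff ennreal_mult_top enn2real_mult powr_mult ennreal_mult)
qed (use assms in \<open>auto simp: ennreal_powr_def\<close>)

lemma ennreal_powr_powr_inverse:
  assumes "q > 0"
  shows "ennreal_powr (ennreal_powr x q) (1 / q) = x"
proof (cases x)
  case (real r)
  then show ?thesis
    using assms by (simp add: ennreal_powr_def powr_powr)
qed (simp add: ennreal_powr_def)

lemma enn2real_pos_exponent: "p > 0 \<Longrightarrow> p \<noteq> \<infinity> \<Longrightarrow> enn2real p > 0"
  by (simp add: enn2real_positive_iff less_top)

lemma lp_norm_mono:
  assumes "\<And>k. f k \<le> g k"
  shows "lp_norm p f \<le> lp_norm p g"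
  using assms by (auto simp: lp_norm_def intro!: SUP_mono' ennreal_powr_mono infsum_mono)

text \<open>A single entry is a one-element partial sum, whatever the exponent. Membership in a
  weighted space thus always provides a supremum bound.\<close>

lemma lp_norm_ge:
  assumes "p > 0"
  shows "f k \<le> lp_norm p f"
proof (cases "p = \<infinity>")
  case False
  define q where "q = enn2real p"
  have q: "q > 0"
    unfolding q_def using assms False by (rule enn2real_pos_exponent)
  have "sum (\<lambda>k. ennreal_powr (f k) q) {k} \<le> infsum (\<lambda>k. ennreal_powr (f k) q) UNIV"
    by (rule infsum_ennreal_upper) auto
  then have "ennreal_powr (ennreal_powr (f k) q) (1 / q) \<le> ennreal_powr (infsum (\<lambda>k. ennreal_powr (f k) q) UNIV) (1 / q)"
    using q by (intro ennreal_powr_mono) auto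
  then show ?thesis
    using q False by (simp add: ennreal_powr_powr_inverse lp_norm_def q_def)
qed (auto simp: lp_norm_def intro: SUP_upper)

lemma lp_norm_cmult_le:
  assumes "p > 0" "a \<ge> 0"
  shows "lp_norm p (\<lambda>k. ennreal a * f k) \<le> ennreal a * lp_norm p f"
proof (cases "p = \<infinity>")
  case True
  then show ?thesis
    by (auto simp: lp_norm_def intro!: SUP_least mult_left_mono SUP_upper)
next
  case False
  define q where "q = enn2real p"
  have q: "q > 0"
    unfolding q_def using assms(1) False by (rule enn2real_pos_exponent)
  have "infsum (\<lambda>k. ennreal_powr (ennreal a * f k) q) UNIV \<le> ennreal (a powr q) * infsum (\<lambda>k. ennreal_powr (f k) q) UNIV"
    unfolding ennreal_powr_cmult[OF q assms(2)]
  proof (rule infsum_le_finite_sums)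
    fix F :: "'a set" assume "finite F" "F \<subseteq> UNIV"
    then show "(\<Sum>k\<in>F. ennreal (a powr q) * ennreal_powr (f k) q) \<le> ennreal (a powr q) * infsum (\<lambda>k. ennreal_powr (f k) q) UNIV"
      unfolding sum_distrib_left[symmetric] by (intro mult_left_mono infsum_ennreal_upper) auto
  qed (rule summable_on_ennreal_any)
  then have "lp_norm p (\<lambda>k. ennreal a * f k) \<le> ennreal_powr (ennreal (a powr q) * infsum (\<lambda>k. ennreal_powr (f k) q) UNIV) (1 / q)"
    using q False by (simp add: lp_norm_def q_def[symmetric] ennreal_powr_mono)
  also have "\<dots> = ennreal a * lp_norm p f"
    using q False assms(2) by (simp add: ennreal_powr_cmult lp_norm_def q_def[symmetric] powr_powr)
  finally show ?thesis .
qed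

lemma lp_norm_finite_iff:
  assumes "p > 0" "p \<noteq> \<infinity>"
  shows "lp_norm p f < \<infinity> \<longleftrightarrow> infsum (\<lambda>k. ennreal_powr (f k) (enn2real p)) UNIV < \<infinity>"
  using assms(2) by (simp only: lp_norm_def if_False ennreal_powr_finite_iff)

text \<open>A sum is at most twice its larger summand, so its \<open>q\<close>-th power is at most
  the sum of the \<open>q\<close>-th powers of the doubled summands. This replaces the triangle
  inequality and holds for every positive \<open>q\<close>.\<close>

lemma lp_norm_add_finite:
  assumes p: "p > 0" and f: "lp_norm p f < \<infinity>" and g: "lp_norm p g < \<infinity>"
  shows "lp_norm p (\<lambda>k. f k + g k) < \<infinity>"
proof (cases "p = \<infinity>")
  case True
  have "f k + g k \<le> lp_norm p f + lp_norm p g" for k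
    using p by (intro add_mono lp_norm_ge)
  then have "lp_norm p (\<lambda>k. f k + g k) \<le> lp_norm p f + lp_norm p g"
    using True by (simp add: lp_norm_def SUP_least)
  also have "\<dots> < \<infinity>" using f g by simp
  finally show ?thesis .
next
  case False
  define q where "q = enn2real p"
  have q: "q > 0"
    unfolding q_def using p False by (rule enn2real_pos_exponent)
  have sp: "ennreal_powr (f k + g k) q \<le> ennreal_powr (ennreal 2 * f k) q + ennreal_powr (ennreal 2 * g k) q" for k
  proof (cases "f k \<le> g k")
    case True
    then have "f k + g k \<le> ennreal 2 * g k"
      using add_right_mono[OF True, of "g k"] by (simp add: mult_2[symmetric])
    then have "ennreal_powr (f k + g k) q \<le> ennreal_powr (ennreal 2 * g k) q"
      using q by (intro ennreal_powr_mono) auto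
    then show ?thesis
      using add_increasing[of "ennreal_powr (ennreal 2 * f k) q"] by auto
  next
    case False
    then have "f k + g k \<le> ennreal 2 * f k"
      using add_left_mono[of "g k" "f k" "f k"] by (simp add: mult_2[symmetric])
    then have "ennreal_powr (f k + g k) q \<le> ennreal_powr (ennreal 2 * f k) q"
      using q by (intro ennreal_powr_mono) auto
    then show ?thesis
      using add_increasing2[of "ennreal_powr (ennreal 2 * g k) q"] by auto
  qed
  have fin: "infsum (\<lambda>k. ennreal_powr (ennreal 2 * h k) q) UNIV < \<infinity>" if "lp_norm p h < \<infinity>" for h :: "'a \<Rightarrow> ennreal"
  proof -
    have "lp_norm p (\<lambda>k. ennreal 2 * h k) < \<infinity>"
      using lp_norm_cmult_le[OF p, of 2 h] that by (simp add: ennreal_mult_less_top le_less_trans)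
    then show ?thesis
      unfolding q_def lp_norm_finite_iff[OF p False] .
  qed
  have "infsum (\<lambda>k. ennreal_powr (f k + g k) q) UNIV \<le>
      infsum (\<lambda>k. ennreal_powr (ennreal 2 * f k) q + ennreal_powr (ennreal 2 * g k) q) UNIV"
    by (intro infsum_mono sp) auto
  also have "\<dots> = infsum (\<lambda>k. ennreal_powr (ennreal 2 * f k) q) UNIV + infsum (\<lambda>k. ennreal_powr (ennreal 2 * g k) q) UNIV"
    by (intro infsum_add) auto
  also have "\<dots> < \<infinity>"
    using fin f g by simp
  finally show ?thesis
    unfolding q_def lp_norm_finite_iff[OF p False] .
qed

lemma weighted_norm_ge:
  "p > 0 \<Longrightarrow> ennreal (cmod (c k)) * \<omega> k \<le> weighted_norm p \<omega> c"
  unfolding weighted_norm_def by (rule lp_norm_ge)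

lemma ell_cmult:
  assumes "p > 0"
  shows "weighted_norm p \<omega> (\<lambda>k. a * c k) \<le> ennreal (cmod a) * weighted_norm p \<omega> c"
  using lp_norm_cmult_le[OF assms, of "cmod a" "\<lambda>k. ennreal (cmod (c k)) * \<omega> k"]
  by (simp add: weighted_norm_def norm_mult ennreal_mult mult.assoc)

lemma ell_cmult_mem: "p > 0 \<Longrightarrow> c \<in> ell p \<omega> \<Longrightarrow> (\<lambda>k. a * c k) \<in> ell p \<omega>"
  using le_less_trans[OF ell_cmult[of p \<omega> a c]] by (simp add: ell_def ennreal_mult_less_top)

lemma ell_add_mem:
  assumes "p > 0" "c \<in> ell p \<omega>" "d \<in> ell p \<omega>"
  shows "(\<lambda>k. c k + d k) \<in> ell p \<omega>"
proof -
  have "weighted_norm p \<omega> (\<lambda>k. c k + d k) \<le> lp_norm p (\<lambda>k. ennreal (cmod (c k)) * \<omega> k + ennreal (cmod (d k)) * \<omega> k)"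
    unfolding weighted_norm_def
    by (intro lp_norm_mono) (simp add: distrib_right[symmetric] ennreal_plus[symmetric] norm_triangle_ineq mult_right_mono ennreal_leI del: ennreal_plus)
  also have "\<dots> < \<infinity>"
    using assms by (intro lp_norm_add_finite) (auto simp: ell_def weighted_norm_def)
  finally show ?thesis
    by (simp add: ell_def)
qed

lemma ell_diff_mem: "p > 0 \<Longrightarrow> c \<in> ell p \<omega> \<Longrightarrow> d \<in> ell p \<omega> \<Longrightarrow> (\<lambda>k. c k - d k) \<in> ell p \<omega>"
  using ell_add_mem[of p c \<omega> "\<lambda>k. - 1 * d k"] ell_cmult_mem[of p d \<omega> "- 1"] by simp

lemma weighted_norm_zero [simp]: "p > 0 \<Longrightarrow> weighted_norm p \<omega> (\<lambda>k. 0) = 0"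
  using ell_cmult[of p \<omega> 0 "\<lambda>k. 0"] by simp

lemma zero_in_ell [simp]: "p > 0 \<Longrightarrow> (\<lambda>k. 0) \<in> ell p \<omega>"
  by (simp add: ell_def)

lemma weighted_norm_mono:
  assumes "\<And>k. ennreal (cmod (c k)) * \<omega> k \<le> ennreal (cmod (d k)) * \<omega>' k"
  shows "weighted_norm p \<omega> c \<le> weighted_norm p \<omega>' d"
  unfolding weighted_norm_def using assms by (rule lp_norm_mono)

lemma ell_top_continuous_mapI:
  assumes "\<And>x. x \<in> ell p \<omega> \<Longrightarrow> f x \<in> ell p' \<omega>'"
    and "\<And>x e. x \<in> ell p \<omega> \<Longrightarrow> e > 0 \<Longrightarrow> \<exists>d>0. \<forall>y\<in>ell p \<omega>. weighted_norm p \<omega> (\<lambda>k. y k - x k) < d \<longrightarrow>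
        weighted_norm p' \<omega>' (\<lambda>k. f y k - f x k) < e"
  shows "continuous_map (ell_top p \<omega>) (ell_top p' \<omega>') f"
  unfolding continuous_map
proof (intro conjI allI impI)
  fix U assume U: "openin (ell_top p' \<omega>') U"
  show "openin (ell_top p \<omega>) {x \<in> topspace (ell_top p \<omega>). f x \<in> U}"
    unfolding openin_ell_top
  proof (intro conjI ballI)
    fix x assume x: "x \<in> {x \<in> topspace (ell_top p \<omega>). f x \<in> U}"
    then obtain e where e: "e > 0" "\<forall>y\<in>ell p' \<omega>'. weighted_norm p' \<omega>' (\<lambda>k. y k - f x k) < e \<longrightarrow> y \<in> U"
      using U unfolding openin_ell_top by blast
    have "x \<in> ell p \<omega>"
      using x by simp
    from assms(2)[OF this e(1)] obtain d where d: "d > 0"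
      "\<And>y. y \<in> ell p \<omega> \<Longrightarrow> weighted_norm p \<omega> (\<lambda>k. y k - x k) < d \<Longrightarrow> weighted_norm p' \<omega>' (\<lambda>k. f y k - f x k) < e"
      by blast
    then show "\<exists>d>0. \<forall>y\<in>ell p \<omega>. weighted_norm p \<omega> (\<lambda>k. y k - x k) < d \<longrightarrow> y \<in> {x \<in> topspace (ell_top p \<omega>). f x \<in> U}"
      using e(2) assms(1) by (intro exI[of _ d]) auto
  qed auto
qed (use assms(1) in auto)

lemma ell_translation_continuous:
  assumes "p > 0" "x \<in> ell p \<omega>"
  shows "continuous_map (ell_top p \<omega>) (ell_top p \<omega>) (\<lambda>y k. y k - x k)"
  using assms by (intro ell_top_continuous_mapI) (auto intro: ell_diff_mem)

lemma ell_scaling_continuous: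
  assumes "p > 0"
  shows "continuous_map (ell_top p \<omega>) (ell_top p \<omega>) (\<lambda>y k. a * y k)"
proof (intro ell_top_continuous_mapI)
  fix x :: "'a \<Rightarrow> complex" and e :: ennreal
  assume "e > 0"
  define b where "b = cmod a + 1"
  have b: "b > 0" "cmod a \<le> b"
    by (auto simp: b_def add_nonneg_pos)
  show "\<exists>d>0. \<forall>y\<in>ell p \<omega>. weighted_norm p \<omega> (\<lambda>k. y k - x k) < d \<longrightarrow>
        weighted_norm p \<omega> (\<lambda>k. a * y k - a * x k) < e"
  proof (intro exI conjI ballI impI)
    show "e / ennreal b > 0"
      using \<open>e > 0\<close> b by (simp add: ennreal_zero_less_divide)
    fix y assume "y \<in> ell p \<omega>" and y: "weighted_norm p \<omega> (\<lambda>k. y k - x k) < e / ennreal b"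
    have "weighted_norm p \<omega> (\<lambda>k. a * y k - a * x k) \<le> ennreal (cmod a) * weighted_norm p \<omega> (\<lambda>k. y k - x k)"
      using ell_cmult[OF assms, of \<omega> a "\<lambda>k. y k - x k"] by (simp add: right_diff_distrib)
    also have "\<dots> \<le> ennreal b * weighted_norm p \<omega> (\<lambda>k. y k - x k)"
      using b by (intro mult_right_mono ennreal_leI) auto
    also have "\<dots> < ennreal b * (e / ennreal b)"
      using y b by (intro ennreal_mult_strict_left_mono) auto
    also have "\<dots> \<le> e"
      using b by (simp add: ennreal_times_divide ennreal_mult_divide_eq mult.commute)
    finally show "weighted_norm p \<omega> (\<lambda>k. a * y k - a * x k) < e" .
  qed
qed (use assms in \<open>auto intro: ell_cmult_mem\<close>)

text \<open>The radius \<open>ennreal e * \<omega> k\<close> converts a bound on the norm into the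
  bound \<open>e\<close> on the coordinate. It is positive because the weight at \<open>k\<close> is
  non-zero, and the argument covers an infinite weight as well.\<close>

lemma ell_coord_continuous:
  assumes "p > 0" "\<omega> k \<noteq> 0"
  shows "continuous_map (ell_top p \<omega>) euclidean (\<lambda>y. y k)"
  unfolding continuous_map
proof (intro conjI allI impI)
  fix U :: "complex set" assume U: "openin euclidean U"
  show "openin (ell_top p \<omega>) {x \<in> topspace (ell_top p \<omega>). x k \<in> U}"
    unfolding openin_ell_top
  proof (intro conjI ballI)
    fix x assume x: "x \<in> {x \<in> topspace (ell_top p \<omega>). x k \<in> U}"
    then obtain e where e: "e > 0" "ball (x k) e \<subseteq> U"
      using U open_contains_ball[of U] by auto
    have "y k \<in> U" if "weighted_norm p \<omega> (\<lambda>k. y k - x k) < ennreal e * \<omega> k" for y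
    proof -
      have "ennreal (cmod (y k - x k)) * \<omega> k < ennreal e * \<omega> k"
        using weighted_norm_ge[OF assms(1), of "\<lambda>k. y k - x k" k \<omega>] that by (rule le_less_trans)
      then have "cmod (y k - x k) < e"
        by (meson ennreal_leI mult_right_mono not_le zero_le)
      then show ?thesis
        using e by (auto simp: dist_norm norm_minus_commute)
    qed
    moreover have "ennreal e * \<omega> k > 0"
      using e assms(2) by (simp add: zero_less_iff_neq_zero)
    ultimately show "\<exists>d>0. \<forall>y\<in>ell p \<omega>. weighted_norm p \<omega> (\<lambda>k. y k - x k) < d \<longrightarrow> y \<in> {x \<in> topspace (ell_top p \<omega>). x k \<in> U}"
      by auto
  qed auto
qed auto

text \<open>A weighted supremum bound with a real constant. Unlike the norm itself it obeys the
  triangle inequality for all \<open>p\<close>, so the data of bilinear estimates are measured by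
  it.\<close>

definition wbound :: "('k \<Rightarrow> ennreal) \<Rightarrow> ('k \<Rightarrow> complex) \<Rightarrow> real \<Rightarrow> bool" where
  "wbound \<omega> c N \<longleftrightarrow> N \<ge> 0 \<and> (\<forall>k. ennreal (cmod (c k)) * \<omega> k \<le> ennreal N)"

lemma wbound_weighted_norm:
  assumes "p > 0" "weighted_norm p \<omega> c \<le> ennreal N" "N \<ge> 0"
  shows "wbound \<omega> c N"
  unfolding wbound_def using order_trans[OF weighted_norm_ge[OF assms(1)] assms(2)] assms(3) by simp

lemma wbound_ell:
  assumes "p > 0" "c \<in> ell p \<omega>"
  obtains N where "wbound \<omega> c N"
  using assms wbound_weighted_norm[of p \<omega> c "enn2real (weighted_norm p \<omega> c)"]
  by (auto simp: ell_def less_top)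

lemma wbound_add:
  assumes "wbound \<omega> c N" "wbound \<omega> d M"
  shows "wbound \<omega> (\<lambda>k. c k + d k) (N + M)"
  unfolding wbound_def
proof (intro conjI allI)
  fix k
  have "ennreal (cmod (c k + d k)) * \<omega> k \<le> ennreal (cmod (c k)) * \<omega> k + ennreal (cmod (d k)) * \<omega> k"
    by (simp add: distrib_right[symmetric] ennreal_plus[symmetric] norm_triangle_ineq mult_right_mono ennreal_leI del: ennreal_plus)
  also have "\<dots> \<le> ennreal (N + M)"
    using assms by (auto simp: wbound_def intro: add_mono)
  finally show "ennreal (cmod (c k + d k)) * \<omega> k \<le> ennreal (N + M)" .
qed (use assms in \<open>auto simp: wbound_def\<close>)

lemma wbound_cmult:
  assumes "wbound \<omega> c N"
  shows "wbound \<omega> (\<lambda>k. a * c k) (cmod a * N)"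
  using assms by (simp add: wbound_def norm_mult ennreal_mult mult.assoc mult_left_mono)

lemma wbound_mono:
  assumes "wbound \<omega> c N" "N \<le> M"
  shows "wbound \<omega> c M"
  unfolding wbound_def
proof (intro conjI allI)
  show "ennreal (cmod (c k)) * \<omega> k \<le> ennreal M" for k
    using assms(1) ennreal_leI[OF assms(2)] unfolding wbound_def by (blast intro: order_trans)
qed (use assms in \<open>auto simp: wbound_def\<close>)

lemma wbound_weight_mono:
  assumes "wbound \<omega> c N" "\<And>k. \<omega>' k \<le> \<omega> k"
  shows "wbound \<omega>' c N"
  unfolding wbound_def
proof (intro conjI allI)
  fix k
  have "ennreal (cmod (c k)) * \<omega>' k \<le> ennreal (cmod (c k)) * \<omega> k"
    by (intro mult_left_mono assms) simp
  also have "\<dots> \<le> ennreal N"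
    using assms by (simp add: wbound_def)
  finally show "ennreal (cmod (c k)) * \<omega>' k \<le> ennreal N" .
qed (use assms in \<open>auto simp: wbound_def\<close>)

text \<open>The norm need not satisfy the triangle inequality when \<open>p < 1\<close>, so open neighbourhoods are
  taken as balls of the supremum norm, which is dominated by it.\<close>

lemma sup_ball_open:
  assumes "p > 0"
  shows "openin (ell_top p \<omega>) {y \<in> ell p \<omega>. \<exists>e'<e. wbound \<omega> (\<lambda>k. y k - x k) e'}"
  unfolding openin_ell_top
proof (intro conjI ballI)
  fix y assume "y \<in> {y \<in> ell p \<omega>. \<exists>e'<e. wbound \<omega> (\<lambda>k. y k - x k) e'}"
  then obtain e' where e': "e' < e" "wbound \<omega> (\<lambda>k. y k - x k) e'"
    by blast
  define d where "d = (e - e') / 2"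
  have d: "d > 0" "e' + d < e"
    using e' by (auto simp: d_def field_simps)
  have "wbound \<omega> (\<lambda>k. z k - x k) (e' + d)" if "weighted_norm p \<omega> (\<lambda>k. z k - y k) < ennreal d" for z
  proof -
    have "wbound \<omega> (\<lambda>k. z k - y k) d"
      using that d assms by (intro wbound_weighted_norm) auto
    from wbound_add[OF e'(2) this] show ?thesis
      by simp
  qed
  then show "\<exists>d>0. \<forall>z\<in>ell p \<omega>. weighted_norm p \<omega> (\<lambda>k. z k - y k) < d \<longrightarrow> z \<in> {y \<in> ell p \<omega>. \<exists>e'<e. wbound \<omega> (\<lambda>k. y k - x k) e'}"
    using d by (intro exI[of _ "ennreal d"]) auto
qed auto

section \<open>Summability over multi-indices\<close>

lemma summable_on_Times_nonneg:
  fixes f :: "'a \<Rightarrow> real" and g :: "'b \<Rightarrow> real"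
  assumes f: "f summable_on UNIV" "\<And>x. f x \<ge> 0" and g: "g summable_on UNIV" "\<And>y. g y \<ge> 0"
  shows "(\<lambda>(x, y). f x * g y) summable_on UNIV"
proof (rule nonneg_bdd_above_summable_on)
  show "bdd_above (sum (\<lambda>(x, y). f x * g y) ` {F. F \<subseteq> UNIV \<and> finite F})"
  proof (rule bdd_aboveI2)
    fix F :: "('a \<times> 'b) set" assume "F \<in> {F. F \<subseteq> UNIV \<and> finite F}"
    then have F: "finite F" by simp
    have "(\<Sum>(x, y)\<in>F. f x * g y) \<le> (\<Sum>(x, y)\<in>fst ` F \<times> snd ` F. f x * g y)"
      using F f g by (intro sum_mono2) (auto simp: image_iff Bex_def intro!: exI)
    also have "\<dots> = sum f (fst ` F) * sum g (snd ` F)"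
      by (simp add: sum_product sum.cartesian_product)
    also have "\<dots> \<le> infsum f UNIV * infsum g UNIV"
      using F f g by (intro mult_mono finite_sum_le_infsum infsum_nonneg sum_nonneg) auto
    finally show "(\<Sum>(x, y)\<in>F. f x * g y) \<le> infsum f UNIV * infsum g UNIV" .
  qed
qed (use f g in auto)

text \<open>Every finite set lies in a box, over which the sum factors into one geometric sum per
  coordinate.\<close>

lemma mi_abs_summable:
  fixes x :: real
  assumes "0 \<le> x" "x < 1"
  shows "(\<lambda>\<gamma>::('d::finite) mindex. x ^ mi_abs \<gamma>) summable_on UNIV"
proof (rule nonneg_bdd_above_summable_on)
  show "bdd_above (sum (\<lambda>\<gamma>::'d mindex. x ^ mi_abs \<gamma>) ` {F. F \<subseteq> UNIV \<and> finite F})"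
  proof (rule bdd_aboveI2)
    fix F :: "'d mindex set" assume "F \<in> {F. F \<subseteq> UNIV \<and> finite F}"
    then have F: "finite F" by simp
    define N where "N = (\<Sum>\<gamma>\<in>F. mi_abs \<gamma>)"
    have N: "\<gamma> $ i \<le> N" if "\<gamma> \<in> F" for \<gamma> i
    proof -
      have "\<gamma> $ i \<le> mi_abs \<gamma>"
        unfolding mi_abs_def by (intro member_le_sum) auto
      also have "\<dots> \<le> N"
        unfolding N_def using that F by (intro member_le_sum) auto
      finally show ?thesis .
    qed
    have "(\<Sum>\<gamma>\<in>F. x ^ mi_abs \<gamma>) \<le> (\<Sum>\<gamma>::'d mindex | \<forall>i. \<gamma> $ i \<le> N. x ^ mi_abs \<gamma>)"
      using N assms by (intro sum_mono2 finite_vec_box) auto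
    also have "\<dots> = (\<Prod>i\<in>(UNIV::'d set). \<Sum>g\<le>N. x ^ g)"
      unfolding mi_abs_def power_sum by (rule sum_vec_box_prod)
    also have "\<dots> \<le> (\<Prod>i\<in>(UNIV::'d set). 1 / (1 - x))"
    proof (intro prod_mono conjI)
      show "(\<Sum>g\<le>N. x ^ g) \<le> 1 / (1 - x)"
        using sum_le_suminf[of "\<lambda>n. x ^ n" "{..N}"] assms by (simp add: suminf_geometric summable_geometric)
    qed (use assms in \<open>auto intro: sum_nonneg\<close>)
    finally show "(\<Sum>\<gamma>\<in>F. x ^ mi_abs \<gamma>) \<le> (\<Prod>i\<in>(UNIV::'d set). 1 / (1 - x))" .
  qed
qed (use assms in auto)

definition pair_abs :: "('d::finite) mindex \<times> 'd mindex \<Rightarrow> nat" where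
  "pair_abs k = mi_abs (fst k) + mi_abs (snd k)"

lemma pair_abs_summable:
  fixes x :: real
  assumes "0 \<le> x" "x < 1"
  shows "(\<lambda>k::('d::finite) mindex \<times> 'd mindex. x ^ pair_abs k) summable_on UNIV"
  using summable_on_Times_nonneg[OF mi_abs_summable[OF assms] _ mi_abs_summable[OF assms]] assms
  by (simp add: pair_abs_def power_add case_prod_unfold)

definition quint_abs :: "('d::finite) quintuple \<Rightarrow> nat" where
  "quint_abs = (\<lambda>(\<alpha>1, \<alpha>2, \<beta>1, \<beta>2, \<gamma>). mi_abs \<alpha>1 + mi_abs \<alpha>2 + mi_abs \<beta>1 + mi_abs \<beta>2 + mi_abs \<gamma>)"

lemma quint_abs_summable:
  fixes x :: real
  assumes "0 \<le> x" "x < 1"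
  shows "(\<lambda>q::('d::finite) quintuple. x ^ quint_abs q) summable_on UNIV"
proof -
  note m = mi_abs_summable[OF assms, where 'd='d]
  have z: "0 \<le> x ^ n" for n using assms by simp
  note 2 = summable_on_Times_nonneg[OF m z m z]
  note 3 = summable_on_Times_nonneg[OF m z 2]
  note 4 = summable_on_Times_nonneg[OF m z 3]
  note 5 = summable_on_Times_nonneg[OF m z 4]
  show ?thesis
    using 5 assms by (simp add: quint_abs_def power_add case_prod_unfold mult.assoc)
qed

text \<open>The constant by which geometric decay in the order of the index becomes a bound on the
  norm. The type argument fixes the dimension, on which the value depends.\<close>

definition lp_geometric :: "('d::finite) itself \<Rightarrow> ennreal \<Rightarrow> ennreal" where
  "lp_geometric _ p = lp_norm p (\<lambda>k::'d mindex \<times> 'd mindex. ennreal ((1/2) ^ pair_abs k))"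

lemma lp_geometric_finite:
  assumes "p > 0"
  shows "lp_geometric TYPE('d::finite) p < \<infinity>"
proof (cases "p = \<infinity>")
  case True
  have "lp_geometric TYPE('d) p \<le> 1"
    using True by (auto simp: lp_geometric_def lp_norm_def power_le_one intro!: SUP_least)
  then show ?thesis
    by (simp add: le_less_trans)
next
  case False
  define q where "q = enn2real p"
  have q: "q > 0"
    unfolding q_def using assms False by (rule enn2real_pos_exponent)
  define x :: real where "x = (1/2) powr q"
  have x: "0 \<le> x" "x < 1"
    using q powr_less_mono2[of q "1/2" 1] by (auto simp: x_def)
  have eq: "ennreal_powr (ennreal ((1/2) ^ n)) q = ennreal (x ^ n)" for n
    by (simp add: ennreal_powr_def x_def powr_power powr_realpow[symmetric] powr_powr mult.commute)
  have "infsum (\<lambda>k::'d mindex \<times> 'd mindex. ennreal (x ^ pair_abs k)) UNIV \<le> ennreal (infsum (\<lambda>k::'d mindex \<times> 'd mindex. x ^ pair_abs k) UNIV)"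
  proof (rule infsum_le_finite_sums)
    fix F :: "('d mindex \<times> 'd mindex) set" assume "finite F"
    then show "(\<Sum>k\<in>F. ennreal (x ^ pair_abs k)) \<le> ennreal (infsum (\<lambda>k::'d mindex \<times> 'd mindex. x ^ pair_abs k) UNIV)"
      using x pair_abs_summable[OF x] by (subst sum_ennreal) (auto intro!: ennreal_leI finite_sum_le_infsum)
  qed simp
  then show ?thesis
    unfolding lp_geometric_def lp_norm_finite_iff[OF assms False] q_def[symmetric] eq
    by (simp add: le_less_trans)
qed

section \<open>Continuity of the product between weighted spaces\<close>

lemma mi_binom_le: "mi_binom \<alpha> \<beta> \<le> 2 ^ (mi_abs \<alpha> + mi_abs \<beta>)"
proof -
  have "mi_binom \<alpha> \<beta> = (\<Prod>i\<in>UNIV. real ((\<alpha> $ i + \<beta> $ i) choose \<beta> $ i))"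
    by (simp add: mi_binom_def mi_fact_def prod_dividef[symmetric] prod.distrib[symmetric] binomial_fact mult.commute)
  also have "\<dots> \<le> (\<Prod>i\<in>UNIV. 2 ^ (\<alpha> $ i + \<beta> $ i))"
  proof (intro prod_mono conjI)
    show "real ((\<alpha> $ i + \<beta> $ i) choose \<beta> $ i) \<le> 2 ^ (\<alpha> $ i + \<beta> $ i)" for i
      using of_nat_mono[OF binomial_le_pow2[of "\<alpha> $ i + \<beta> $ i" "\<beta> $ i"], where 'a=real] by simp
  qed simp
  also have "\<dots> = 2 ^ (mi_abs \<alpha> + mi_abs \<beta>)"
    by (simp add: mi_abs_def power_sum power_add prod.distrib)
  finally show ?thesis .
qed

lemma mi_binom_nonneg: "mi_binom \<alpha> \<beta> \<ge> 0"
  by (simp add: mi_binom_def less_imp_le)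

text \<open>Each component of the quintuple occurs in at most two of the four binomials, so the
  radicand is at most \<open>4 ^ quint_abs q\<close>.\<close>

lemma aw_coeff_le: "\<bar>aw_coeff q\<bar> \<le> 2 ^ quint_abs q"
proof -
  obtain \<alpha>1 \<alpha>2 \<beta>1 \<beta>2 \<gamma> where q: "q = (\<alpha>1, \<alpha>2, \<beta>1, \<beta>2, \<gamma>)"
    by (cases q) auto
  have "mi_binom \<alpha>1 \<alpha>2 * mi_binom \<beta>1 \<beta>2 * mi_binom \<alpha>1 \<gamma> * mi_binom \<beta>2 \<gamma> \<le>
      2 ^ (mi_abs \<alpha>1 + mi_abs \<alpha>2) * 2 ^ (mi_abs \<beta>1 + mi_abs \<beta>2) * 2 ^ (mi_abs \<alpha>1 + mi_abs \<gamma>) * 2 ^ (mi_abs \<beta>2 + mi_abs \<gamma>)"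
    by (intro mult_mono mi_binom_le mult_nonneg_nonneg mi_binom_nonneg) auto
  also have "\<dots> = 2 ^ (2 * mi_abs \<alpha>1 + mi_abs \<alpha>2 + mi_abs \<beta>1 + 2 * mi_abs \<beta>2 + 2 * mi_abs \<gamma>)"
    by (simp add: power_add[symmetric])
  also have "\<dots> \<le> 2 ^ (2 * quint_abs q)"
    by (intro power_increasing) (auto simp: quint_abs_def q)
  finally have "sqrt (mi_binom \<alpha>1 \<alpha>2 * mi_binom \<beta>1 \<beta>2 * mi_binom \<alpha>1 \<gamma> * mi_binom \<beta>2 \<gamma>) \<le> sqrt (2 ^ (2 * quint_abs q))"
    by (rule real_sqrt_le_mono)
  also have "\<dots> = 2 ^ quint_abs q"
    by (simp add: power_even_eq)
  finally show ?thesis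
    by (simp add: q aw_coeff_def abs_mult power_abs mi_binom_nonneg)
qed

type_synonym 'd weight = "'d mindex \<times> 'd mindex \<Rightarrow> ennreal"

text \<open>The factor \<open>8 ^ quint_abs\<close> leaves, after absorbing the coefficients of the product, a decay that
  makes every remaining sum converge. The alternatives with infinite weights are those in which the
  corresponding coefficient vanishes.\<close>

definition admissible_with :: "real \<Rightarrow> ('d::finite) weight \<Rightarrow> 'd weight \<Rightarrow> bool" where
  "admissible_with C \<omega> \<omega>' \<longleftrightarrow> C \<ge> 0 \<and> (\<forall>\<alpha>1 \<alpha>2 \<beta>1 \<beta>2 \<gamma>.
     \<omega>' (\<alpha>1 + \<alpha>2, \<beta>1 + \<beta>2) * 8 ^ quint_abs (\<alpha>1, \<alpha>2, \<beta>1, \<beta>2, \<gamma>)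
       \<le> ennreal C * (\<omega> (\<alpha>1 + \<gamma>, \<beta>1) * \<omega> (\<alpha>2, \<beta>2 + \<gamma>)) \<or>
     \<omega> (\<alpha>1 + \<gamma>, \<beta>1) = \<infinity> \<or> \<omega> (\<alpha>2, \<beta>2 + \<gamma>) = \<infinity>)"

definition admissible :: "('d::finite) weight \<Rightarrow> 'd weight \<Rightarrow> bool" where
  "admissible \<omega> \<omega>' \<longleftrightarrow> (\<exists>C. admissible_with C \<omega> \<omega>')"

lemma wbound_infinite: "wbound \<omega> c N \<Longrightarrow> \<omega> k = \<infinity> \<Longrightarrow> c k = 0"
  by (auto simp: wbound_def ennreal_mult_top top_unique dest!: spec[of _ k] split: if_splits)

lemma ennreal_mult_power_le:
  assumes "x * ennreal (4 ^ n) \<le> ennreal K" "K \<ge> 0"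
  shows "x \<le> ennreal (K * (1/4) ^ n)"
proof -
  have "x = x * ennreal (4 ^ n) * ennreal ((1/4) ^ n)"
    by (simp add: mult.assoc ennreal_mult[symmetric] power_mult_distrib[symmetric])
  also have "\<dots> \<le> ennreal K * ennreal ((1/4) ^ n)"
    using assms by (intro mult_right_mono) auto
  finally show ?thesis
    using assms by (simp add: ennreal_mult)
qed

text \<open>Of the factor \<open>8 ^ quint_abs q\<close> granted by admissibility,
  \<open>2 ^ quint_abs q\<close> pays for the coefficient and the remaining power of 4 is turned
  into decay.\<close>

lemma aw_term_bound:
  assumes C: "admissible_with C \<omega> \<omega>'"
    and c: "wbound \<omega> c N" and d: "wbound \<omega> d M" and q: "q \<in> aw_fibre k"
  shows "ennreal (cmod (aw_term c d q)) * \<omega>' k \<le> ennreal (C * N * M * (1/4) ^ quint_abs q)"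
proof -
  obtain \<alpha>1 \<alpha>2 \<beta>1 \<beta>2 \<gamma> where q': "q = (\<alpha>1, \<alpha>2, \<beta>1, \<beta>2, \<gamma>)"
    by (cases q) auto
  have k: "k = (\<alpha>1 + \<alpha>2, \<beta>1 + \<beta>2)"
    using q by (auto simp: q' aw_fibre_def)
  let ?x = "c (\<alpha>1 + \<gamma>, \<beta>1)" and ?y = "d (\<alpha>2, \<beta>2 + \<gamma>)"
  have NM: "C \<ge> 0" "N \<ge> 0" "M \<ge> 0"
    using C c d by (auto simp: wbound_def admissible_with_def)
  consider "?x = 0 \<or> ?y = 0" | "\<omega>' k * 8 ^ quint_abs q \<le> ennreal C * (\<omega> (\<alpha>1 + \<gamma>, \<beta>1) * \<omega> (\<alpha>2, \<beta>2 + \<gamma>))"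
    using C wbound_infinite[OF c] wbound_infinite[OF d] unfolding k q' admissible_with_def by blast
  then show ?thesis
  proof cases
    case 1
    then show ?thesis
      by (auto simp: q' aw_term_def)
  next
    case 2
    have "cmod (aw_term c d q) = \<bar>aw_coeff q\<bar> * (cmod ?x * cmod ?y)"
      by (simp add: q' aw_term_def norm_mult)
    also have "\<dots> \<le> 2 ^ quint_abs q * (cmod ?x * cmod ?y)"
      by (intro mult_right_mono aw_coeff_le) auto
    finally have "ennreal (cmod (aw_term c d q)) \<le> ennreal (2 ^ quint_abs q) * (ennreal (cmod ?x) * ennreal (cmod ?y))"
      by (simp add: ennreal_mult[symmetric] ennreal_leI)
    then have "ennreal (cmod (aw_term c d q)) * (\<omega>' k * ennreal (4 ^ quint_abs q)) \<le>
        ennreal (2 ^ quint_abs q) * (ennreal (cmod ?x) * ennreal (cmod ?y)) * (\<omega>' k * ennreal (4 ^ quint_abs q))"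
      by (intro mult_right_mono) auto
    also have "\<dots> = ennreal (cmod ?x) * ennreal (cmod ?y) * (\<omega>' k * (ennreal (2 ^ quint_abs q) * ennreal (4 ^ quint_abs q)))"
      by (simp only: mult_ac)
    also have "ennreal (2 ^ quint_abs q) * ennreal (4 ^ quint_abs q) = 8 ^ quint_abs q"
      by (simp add: ennreal_mult[symmetric] power_mult_distrib[symmetric] ennreal_power[symmetric])
    also have "ennreal (cmod ?x) * ennreal (cmod ?y) * (\<omega>' k * 8 ^ quint_abs q) \<le>
        ennreal (cmod ?x) * ennreal (cmod ?y) * (ennreal C * (\<omega> (\<alpha>1 + \<gamma>, \<beta>1) * \<omega> (\<alpha>2, \<beta>2 + \<gamma>)))"
      by (intro mult_left_mono 2) auto
    also have "\<dots> = ennreal C * ((ennreal (cmod ?x) * \<omega> (\<alpha>1 + \<gamma>, \<beta>1)) * (ennreal (cmod ?y) * \<omega> (\<alpha>2, \<beta>2 + \<gamma>)))"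
      by (simp only: mult_ac)
    also have "\<dots> \<le> ennreal C * (ennreal N * ennreal M)"
      using c d by (intro mult_left_mono mult_mono) (auto simp: wbound_def)
    also have "\<dots> = ennreal (C * N * M)"
      using NM by (simp add: ennreal_mult mult.assoc)
    finally have "ennreal (cmod (aw_term c d q)) * \<omega>' k * ennreal (4 ^ quint_abs q) \<le> ennreal (C * N * M)"
      by (simp only: mult.assoc)
    then show ?thesis
      using NM by (intro ennreal_mult_power_le) auto
  qed
qed

lemma pair_abs_fibre_le:
  assumes "q \<in> aw_fibre k"
  shows "pair_abs k \<le> quint_abs q"
  using assms by (auto simp: aw_fibre_def pair_abs_def quint_abs_def mi_abs_def sum.distrib)

definition quint_mass :: "('d::finite) itself \<Rightarrow> real" where
  "quint_mass _ = infsum (\<lambda>q::'d quintuple. (1/2) ^ quint_abs q) UNIV"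

lemma quint_mass_nonneg: "quint_mass TYPE('d::finite) \<ge> 0"
  unfolding quint_mass_def by (rule infsum_nonneg) simp

text \<open>One half of the decay of the terms, \<open>(1/2) ^ quint_abs q\<close>, makes the sum
  over the fibre converge uniformly in \<open>k\<close>. The other half is at most
  \<open>(1/2) ^ pair_abs k\<close> on the fibre and survives as decay of the result.\<close>

lemma aw_prod_bound:
  fixes c d :: "('d::finite) fseries"
  assumes C: "admissible_with C \<omega> \<omega>'"
    and c: "wbound \<omega> c N" and d: "wbound \<omega> d M" and k: "\<omega>' k \<noteq> 0"
  shows "aw_term c d summable_on aw_fibre k"
    and "ennreal (cmod (aw_prod c d k)) * \<omega>' k \<le> ennreal (C * N * M * quint_mass TYPE('d)) * ennreal ((1/2) ^ pair_abs k)"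
proof -
  have NM: "C \<ge> 0" "N \<ge> 0" "M \<ge> 0"
    using C c d by (auto simp: wbound_def admissible_with_def)
  note bound = aw_term_bound[OF C c d]
  \<comment> \<open>\<open>Q\<close> is \<open>C * N * M\<close> divided by the weight at
    \<open>k\<close>. For an infinite weight it is 0, since then every term of the fibre
    vanishes.\<close>
  obtain Q where Q: "Q \<ge> 0" "ennreal Q * \<omega>' k \<le> ennreal (C * N * M)"
    and Qb: "\<And>q. q \<in> aw_fibre k \<Longrightarrow> cmod (aw_term c d q) \<le> Q * (1/4) ^ quint_abs q"
  proof (cases "\<omega>' k = \<infinity>")
    case True
    have "aw_term c d q = 0" if "q \<in> aw_fibre k" for q
      using bound[OF that] True by (auto simp: ennreal_mult_top top_unique split: if_splits)
    then show ?thesis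
      using that[of 0] by simp
  next
    case False
    then obtain w where w: "\<omega>' k = ennreal w" "w > 0"
      using k by (cases "\<omega>' k") (auto simp: less_le)
    have "cmod (aw_term c d q) \<le> C * N * M / w * (1/4) ^ quint_abs q" if "q \<in> aw_fibre k" for q
    proof -
      have "cmod (aw_term c d q) * w \<le> C * N * M * (1/4) ^ quint_abs q"
        using bound[OF that] w NM by (simp add: ennreal_mult[symmetric])
      then show ?thesis
        using w by (simp add: field_simps)
    qed
    then show ?thesis
      using that[of "C * N * M / w"] w NM by (simp add: ennreal_mult[symmetric])
  qed
  let ?P = "(1/2) ^ pair_abs k :: real"
  have Qb': "cmod (aw_term c d q) \<le> Q * ?P * (1/2) ^ quint_abs q" if "q \<in> aw_fibre k" for q
  proof -
    have "(1/4) ^ quint_abs q = (1/2) ^ quint_abs q * (1/2 :: real) ^ quint_abs q"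
      by (simp add: power_mult_distrib[symmetric])
    also have "\<dots> \<le> ?P * (1/2) ^ quint_abs q"
      using pair_abs_fibre_le[OF that] by (intro mult_right_mono power_decreasing) auto
    finally have "Q * (1/4) ^ quint_abs q \<le> Q * (?P * (1/2) ^ quint_abs q)"
      using Q(1) by (rule mult_left_mono)
    then show ?thesis
      using Qb[OF that] by (simp add: mult.assoc)
  qed
  have sum: "(\<lambda>q::'d quintuple. Q * ?P * (1/2) ^ quint_abs q) summable_on UNIV"
    by (intro summable_on_cmult_right quint_abs_summable) auto
  then have sum': "(\<lambda>q::'d quintuple. Q * ?P * (1/2) ^ quint_abs q) summable_on aw_fibre k"
    by (rule summable_on_subset_banach) simp
  then have "(\<lambda>q::'d quintuple. norm (Q * ?P * (1/2) ^ quint_abs q)) summable_on aw_fibre k"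
    using Q(1) by (simp add: abs_mult)
  then have abs: "(\<lambda>q. norm (aw_term c d q)) summable_on aw_fibre k"
    by (rule Infinite_Sum.abs_summable_on_comparison_test) (use Qb' Q(1) in \<open>simp add: abs_mult\<close>)
  then show "aw_term c d summable_on aw_fibre k"
    by (rule abs_summable_summable)
  have "cmod (aw_prod c d k) \<le> infsum (\<lambda>q. cmod (aw_term c d q)) (aw_fibre k)"
    unfolding aw_prod_def by (rule norm_infsum_bound[OF abs])
  also have "\<dots> \<le> infsum (\<lambda>q::'d quintuple. Q * ?P * (1/2) ^ quint_abs q) (aw_fibre k)"
    by (intro infsum_mono abs sum' Qb')
  also have "\<dots> \<le> infsum (\<lambda>q::'d quintuple. Q * ?P * (1/2) ^ quint_abs q) UNIV"
    using Q by (intro infsum_mono2 sum sum') auto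
  also have "\<dots> = Q * (?P * quint_mass TYPE('d))"
    by (simp add: infsum_cmult_right' quint_mass_def mult.assoc)
  finally have "ennreal (cmod (aw_prod c d k)) \<le> ennreal Q * ennreal (?P * quint_mass TYPE('d))"
    using Q(1) quint_mass_nonneg[where 'd='d] by (simp add: ennreal_mult[symmetric] ennreal_leI)
  then have "ennreal (cmod (aw_prod c d k)) * \<omega>' k \<le> ennreal Q * ennreal (?P * quint_mass TYPE('d)) * \<omega>' k"
    by (rule mult_right_mono) simp
  also have "\<dots> = (ennreal Q * \<omega>' k) * ennreal (?P * quint_mass TYPE('d))"
    by (simp only: mult_ac)
  also have "\<dots> \<le> ennreal (C * N * M) * ennreal (?P * quint_mass TYPE('d))"
    by (intro mult_right_mono Q) auto
  also have "\<dots> = ennreal (C * N * M * quint_mass TYPE('d)) * ennreal ?P"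
    using NM quint_mass_nonneg[where 'd='d] by (simp add: ennreal_mult[symmetric] mult_ac)
  finally show "ennreal (cmod (aw_prod c d k)) * \<omega>' k \<le> ennreal (C * N * M * quint_mass TYPE('d)) * ennreal ?P" .
qed

lemma admissible_summable:
  assumes "admissible \<omega> \<omega>'" "wbound \<omega> c N" "wbound \<omega> d M" "\<omega>' k \<noteq> 0"
  shows "aw_term c d summable_on aw_fibre k"
  using assms aw_prod_bound(1) unfolding admissible_def by blast

lemma geometric_norm_le:
  fixes c :: "('d::finite) fseries"
  assumes "p > 0" "K \<ge> 0" "\<And>k. ennreal (cmod (c k)) * \<omega> k \<le> ennreal K * ennreal ((1/2) ^ pair_abs k)"
  shows "weighted_norm p \<omega> c \<le> ennreal (K * enn2real (lp_geometric TYPE('d) p))"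
proof -
  have "weighted_norm p \<omega> c \<le> lp_norm p (\<lambda>k::'d mindex \<times> 'd mindex. ennreal K * ennreal ((1/2) ^ pair_abs k))"
    unfolding weighted_norm_def by (intro lp_norm_mono assms)
  also have "\<dots> \<le> ennreal K * lp_geometric TYPE('d) p"
    unfolding lp_geometric_def using assms by (intro lp_norm_cmult_le) auto
  also have "\<dots> = ennreal (K * enn2real (lp_geometric TYPE('d) p))"
    using lp_geometric_finite[OF assms(1), where 'd='d] assms(2) by (simp add: ennreal_mult)
  finally show ?thesis .
qed

lemma admissible_norm_bound:
  fixes \<omega> \<omega>' :: "('d::finite) weight"
  assumes "admissible \<omega> \<omega>'" "p > 0"
  obtains K where "K \<ge> 0" "\<And>c d N M. wbound \<omega> c N \<Longrightarrow> wbound \<omega> d M \<Longrightarrow> weighted_norm p \<omega>' (aw_prod c d) \<le> ennreal (K * (N * M))"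
proof -
  obtain C where C: "admissible_with C \<omega> \<omega>'"
    using assms(1) by (auto simp: admissible_def)
  show ?thesis
  proof (rule that[of "C * quint_mass TYPE('d) * enn2real (lp_geometric TYPE('d) p)"])
    fix c d :: "'d fseries" and N M
    assume c: "wbound \<omega> c N" and d: "wbound \<omega> d M"
    have NM: "C \<ge> 0" "N \<ge> 0" "M \<ge> 0"
      using C c d by (auto simp: wbound_def admissible_with_def)
    have "ennreal (cmod (aw_prod c d k)) * \<omega>' k \<le> ennreal (C * N * M * quint_mass TYPE('d)) * ennreal ((1/2) ^ pair_abs k)" for k
      by (cases "\<omega>' k = 0") (simp, rule aw_prod_bound(2)[OF C c d])
    then have "weighted_norm p \<omega>' (aw_prod c d) \<le> ennreal (C * N * M * quint_mass TYPE('d) * enn2real (lp_geometric TYPE('d) p))"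
      using NM quint_mass_nonneg[where 'd='d] assms(2) by (intro geometric_norm_le) auto
    then show "weighted_norm p \<omega>' (aw_prod c d) \<le> ennreal (C * quint_mass TYPE('d) * enn2real (lp_geometric TYPE('d) p) * (N * M))"
      by (simp only: mult_ac)
  qed (use C quint_mass_nonneg[where 'd='d] in \<open>auto simp: admissible_with_def\<close>)
qed

lemma aw_prod_linear_left:
  assumes "aw_term c d summable_on aw_fibre k" "aw_term c' d summable_on aw_fibre k"
  shows "aw_prod (\<lambda>k. a * c k + b * c' k) d k = a * aw_prod c d k + b * aw_prod c' d k"
proof -
  have "aw_term (\<lambda>k. a * c k + b * c' k) d = (\<lambda>q. a * aw_term c d q + b * aw_term c' d q)"
    by (auto simp: fun_eq_iff aw_term_def algebra_simps)
  then show ?thesis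
    using assms by (simp add: aw_prod_def infsum_add summable_on_cmult_right infsum_cmult_right')
qed

lemma aw_prod_linear_right:
  assumes "aw_term c d summable_on aw_fibre k" "aw_term c d' summable_on aw_fibre k"
  shows "aw_prod c (\<lambda>k. a * d k + b * d' k) k = a * aw_prod c d k + b * aw_prod c d' k"
proof -
  have "aw_term c (\<lambda>k. a * d k + b * d' k) = (\<lambda>q. a * aw_term c d q + b * aw_term c d' q)"
    by (auto simp: fun_eq_iff aw_term_def algebra_simps)
  then show ?thesis
    using assms by (simp add: aw_prod_def infsum_add summable_on_cmult_right infsum_cmult_right')
qed

lemma aw_prod_increment:
  assumes "admissible_with C \<omega> \<omega>'" "wbound \<omega> x N" "wbound \<omega> y M" "wbound \<omega> x0 N0" "wbound \<omega> y0 M0" "\<omega>' k \<noteq> 0"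
  shows "aw_prod x y k - aw_prod x0 y0 k = aw_prod (\<lambda>k. x k - x0 k) y k + aw_prod x0 (\<lambda>k. y k - y0 k) k"
proof -
  note s = aw_prod_bound(1)[OF assms(1) _ _ assms(6)]
  show ?thesis
    using aw_prod_linear_left[OF s[OF assms(2,3)] s[OF assms(4,3)], of 1 "-1"]
      aw_prod_linear_right[OF s[OF assms(4,3)] s[OF assms(4,5)], of 1 "-1"]
    by simp
qed

text \<open>For \<open>p < 1\<close> the norms of the two increments cannot simply be added. Both
  are bounded coefficient by coefficient by multiples of the same geometric sequence, and the norm
  is taken only once, of the whole difference.\<close>

lemma admissible_continuous:
  fixes \<omega> \<omega>' :: "('d::finite) weight"
  assumes adm: "admissible \<omega> \<omega>'" and p: "p > 0"
  shows "continuous_map (prod_topology (ell_top p \<omega>) (ell_top p \<omega>)) (ell_top p \<omega>') (\<lambda>(x, y). aw_prod x y)"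
  unfolding continuous_map
proof (intro conjI allI impI)
  obtain K where K: "K \<ge> 0" "\<And>c d N M. wbound \<omega> c N \<Longrightarrow> wbound \<omega> d M \<Longrightarrow> weighted_norm p \<omega>' (aw_prod c d) \<le> ennreal (K * (N * M))"
    using admissible_norm_bound[OF adm p] by blast
  have mem: "aw_prod x y \<in> ell p \<omega>'" if x: "x \<in> ell p \<omega>" and y: "y \<in> ell p \<omega>" for x y
  proof -
    obtain N M where "wbound \<omega> x N" "wbound \<omega> y M"
      using wbound_ell[OF p x] wbound_ell[OF p y] by metis
    then show ?thesis
      using le_less_trans[OF K(2) ennreal_less_top] by (simp add: ell_def)
  qed
  then show "(\<lambda>(x, y). aw_prod x y) ` topspace (prod_topology (ell_top p \<omega>) (ell_top p \<omega>)) \<subseteq> topspace (ell_top p \<omega>')"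
    by auto
  fix U assume U: "openin (ell_top p \<omega>') U"
  show "openin (prod_topology (ell_top p \<omega>) (ell_top p \<omega>))
     {x \<in> topspace (prod_topology (ell_top p \<omega>) (ell_top p \<omega>)). (case x of (x, y) \<Rightarrow> aw_prod x y) \<in> U}"
    unfolding openin_prod_topology_alt
  proof (intro allI impI)
    fix x0 y0
    assume "(x0, y0) \<in> {x \<in> topspace (prod_topology (ell_top p \<omega>) (ell_top p \<omega>)). (case x of (x, y) \<Rightarrow> aw_prod x y) \<in> U}"
    then have 0: "x0 \<in> ell p \<omega>" "y0 \<in> ell p \<omega>" "aw_prod x0 y0 \<in> U"
      by auto
    obtain e where e: "e > 0" "\<And>y. y \<in> ell p \<omega>' \<Longrightarrow> weighted_norm p \<omega>' (\<lambda>k. y k - aw_prod x0 y0 k) < e \<Longrightarrow> y \<in> U"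
      using U 0(3) unfolding openin_ell_top by blast
    obtain e0 where e0: "e0 > 0" "ennreal e0 < e"
    proof (cases e)
      case (real r)
      then show ?thesis
        using that[of "r / 2"] e(1) by (simp add: ennreal_less_iff)
    qed (use that[of 1] in simp)
    obtain N M where N: "wbound \<omega> x0 N" and M: "wbound \<omega> y0 M"
      using wbound_ell[OF p 0(1)] wbound_ell[OF p 0(2)] by metis
    have NM: "N \<ge> 0" "M \<ge> 0"
      using N M by (auto simp: wbound_def)
    obtain C where C: "admissible_with C \<omega> \<omega>'"
      using adm by (auto simp: admissible_def)
    define L where "L = C * quint_mass TYPE('d) * (N + M + 1) * enn2real (lp_geometric TYPE('d) p)"
    have C0: "C \<ge> 0" using C by (simp add: admissible_with_def)
    have L: "L \<ge> 0"
      using C0 NM quint_mass_nonneg[where 'd='d] by (simp add: L_def)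
    \<comment> \<open>The cap 1 keeps the bound of \<open>y\<close> below \<open>M + 1\<close>, so
      that the estimate is linear in \<delta> with the constant \<open>L\<close>.\<close>
    define \<delta> where "\<delta> = min 1 (e0 / (L + 1))"
    have \<delta>: "\<delta> > 0" "\<delta> \<le> 1" "L * \<delta> \<le> e0"
    proof -
      show "\<delta> > 0" "\<delta> \<le> 1" using e0 L by (auto simp: \<delta>_def)
      have "L * \<delta> \<le> L * (e0 / (L + 1))"
        using L by (intro mult_left_mono) (auto simp: \<delta>_def)
      also have "\<dots> \<le> e0"
        using L e0 by (simp add: field_simps)
      finally show "L * \<delta> \<le> e0" .
    qed
    let ?B = "\<lambda>z. {y \<in> ell p \<omega>. \<exists>e'<\<delta>. wbound \<omega> (\<lambda>k. y k - z k) e'}"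
    have "aw_prod x y \<in> U" if x: "x \<in> ?B x0" and y: "y \<in> ?B y0" for x y
    proof (rule e(2))
      show "aw_prod x y \<in> ell p \<omega>'"
        using x y by (intro mem) auto
      have dx: "wbound \<omega> (\<lambda>k. x k - x0 k) \<delta>" and dy: "wbound \<omega> (\<lambda>k. y k - y0 k) \<delta>"
        using x y by (auto intro: wbound_mono)
      have wy: "wbound \<omega> y (M + \<delta>)" and wx: "wbound \<omega> x (N + \<delta>)"
        using wbound_add[OF M dy] wbound_add[OF N dx] by auto
      have "ennreal (cmod (aw_prod x y k - aw_prod x0 y0 k)) * \<omega>' k \<le>
          ennreal (C * quint_mass TYPE('d) * (N + M + 1) * \<delta>) * ennreal ((1/2) ^ pair_abs k)" for k
      proof (cases "\<omega>' k = 0")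
        case False
        have "ennreal (cmod (aw_prod x y k - aw_prod x0 y0 k)) \<le>
            ennreal (cmod (aw_prod (\<lambda>k. x k - x0 k) y k)) + ennreal (cmod (aw_prod x0 (\<lambda>k. y k - y0 k) k))"
          unfolding aw_prod_increment[OF C wx wy N M False]
          by (simp add: ennreal_plus[symmetric] norm_triangle_ineq ennreal_leI del: ennreal_plus)
        then have "ennreal (cmod (aw_prod x y k - aw_prod x0 y0 k)) * \<omega>' k \<le>
            ennreal (cmod (aw_prod (\<lambda>k. x k - x0 k) y k)) * \<omega>' k + ennreal (cmod (aw_prod x0 (\<lambda>k. y k - y0 k) k)) * \<omega>' k"
          using mult_right_mono[of "ennreal (cmod (aw_prod x y k - aw_prod x0 y0 k))" _ "\<omega>' k"]
          unfolding distrib_right[symmetric] by simp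
        also have "\<dots> \<le> ennreal (C * \<delta> * (M + \<delta>) * quint_mass TYPE('d)) * ennreal ((1/2) ^ pair_abs k)
            + ennreal (C * N * \<delta> * quint_mass TYPE('d)) * ennreal ((1/2) ^ pair_abs k)"
          by (intro add_mono aw_prod_bound(2)[OF C dx wy False] aw_prod_bound(2)[OF C N dy False])
        also have "\<dots> = ennreal (C * quint_mass TYPE('d) * \<delta> * (M + \<delta> + N)) * ennreal ((1/2) ^ pair_abs k)"
          using C0 NM \<delta> quint_mass_nonneg[where 'd='d]
          by (simp add: distrib_right[symmetric] ennreal_plus[symmetric] del: ennreal_plus) (simp add: algebra_simps)
        also have "\<dots> \<le> ennreal (C * quint_mass TYPE('d) * (N + M + 1) * \<delta>) * ennreal ((1/2) ^ pair_abs k)"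
        proof (intro mult_right_mono ennreal_leI)
          have "C * quint_mass TYPE('d) * \<delta> * (M + \<delta> + N) \<le> C * quint_mass TYPE('d) * \<delta> * (N + M + 1)"
            using C0 \<delta> quint_mass_nonneg[where 'd='d] by (intro mult_left_mono) auto
          then show "C * quint_mass TYPE('d) * \<delta> * (M + \<delta> + N) \<le> C * quint_mass TYPE('d) * (N + M + 1) * \<delta>"
            by (simp only: mult_ac)
        qed simp
        finally show ?thesis .
      qed simp
      then have "weighted_norm p \<omega>' (\<lambda>k. aw_prod x y k - aw_prod x0 y0 k) \<le> ennreal (C * quint_mass TYPE('d) * (N + M + 1) * \<delta> * enn2real (lp_geometric TYPE('d) p))"
        using C0 NM \<delta> p quint_mass_nonneg[where 'd='d] by (intro geometric_norm_le) auto
      also have "C * quint_mass TYPE('d) * (N + M + 1) * \<delta> * enn2real (lp_geometric TYPE('d) p) = L * \<delta>"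
        by (simp add: L_def mult_ac)
      also have "ennreal (L * \<delta>) \<le> ennreal e0"
        using \<delta> by (intro ennreal_leI)
      also have "\<dots> < e" by (rule e0)
      finally show "weighted_norm p \<omega>' (\<lambda>k. aw_prod x y k - aw_prod x0 y0 k) < e" .
    qed
    moreover have "z \<in> ?B z" if "z \<in> ell p \<omega>" for z
      using that \<delta> by (auto simp: wbound_def intro!: exI[of _ 0])
    ultimately show "\<exists>V W. openin (ell_top p \<omega>) V \<and> openin (ell_top p \<omega>) W \<and> x0 \<in> V \<and> y0 \<in> W \<and>
        V \<times> W \<subseteq> {x \<in> topspace (prod_topology (ell_top p \<omega>) (ell_top p \<omega>)). (case x of (x, y) \<Rightarrow> aw_prod x y) \<in> U}"
      using 0 sup_ball_open[OF p] by (intro exI[of _ "?B x0"] exI[of _ "?B y0"]) auto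
  qed
qed

section \<open>Truncation\<close>

definition truncate :: "nat \<Rightarrow> ('d::finite) fseries \<Rightarrow> 'd fseries" where
  "truncate n x = (\<lambda>k. if pair_abs k \<le> n then x k else 0)"

lemma finite_pair_abs_le: "finite {k :: ('d::finite) mindex \<times> 'd mindex. pair_abs k \<le> n}"
proof -
  let ?B = "{\<gamma> :: 'd mindex. \<forall>i. \<gamma> $ i \<le> n}"
  have "\<gamma> $ i \<le> mi_abs \<gamma>" for \<gamma> :: "'d mindex" and i
    unfolding mi_abs_def by (intro member_le_sum) auto
  then have "{k :: 'd mindex \<times> 'd mindex. pair_abs k \<le> n} \<subseteq> ?B \<times> ?B"
    unfolding pair_abs_def by (auto intro: order_trans) (metis add_leD1 add_leD2 order_trans)+
  then show ?thesis
    by (rule finite_subset) (intro finite_cartesian_product finite_vec_box)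
qed

lemma truncate_A_fin: "truncate n x \<in> A_fin"
  unfolding A_fin_def truncate_def by (rule CollectI, rule finite_subset[OF _ finite_pair_abs_le[of n]]) auto

text \<open>Convergence takes place for the weaker weight: for \<open>p = \<infinity>\<close> the
  truncations of an element need not converge in the original norm. Between admissible weights each
  coefficient gains geometric decay, so the tail beyond order \<open>n\<close> is of size
  \<open>(1/2) ^ n\<close>.\<close>

lemma truncate_limit:
  assumes adm: "admissible \<omega> \<omega>'" and one: "\<omega> 0 = 1" and p: "p > 0" and x: "x \<in> ell p \<omega>"
  shows "x \<in> ell p \<omega>'" and "limitin (ell_top p \<omega>') (\<lambda>n. truncate n x) x sequentially"
proof -
  obtain C where C: "admissible_with C \<omega> \<omega>'"
    using adm by (auto simp: admissible_def)
  then have C0: "C \<ge> 0" by (simp add: admissible_with_def)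
  obtain N where N: "wbound \<omega> x N"
    using wbound_ell[OF p x] .
  then have N0: "N \<ge> 0" by (simp add: wbound_def)
  have bound: "ennreal (cmod (x k)) * \<omega>' k \<le> ennreal (C * N * (1/4) ^ pair_abs k)" for k
  proof (cases "\<omega> k = \<infinity>")
    case True
    then show ?thesis
      using wbound_infinite[OF N] by simp
  next
    case False
    have [simp]: "mi_abs 0 = 0"
      by (simp add: mi_abs_def)
    \<comment> \<open>Admissibility at the trivial splitting, where the second factor is taken at
      index 0 with weight 1 and nothing is contracted.\<close>
    have "\<omega>' k * 8 ^ pair_abs k \<le> ennreal C * \<omega> k"
      using C[unfolded admissible_with_def, THEN conjunct2, rule_format, of "fst k" 0 "snd k" 0 0] False one
      by (simp add: quint_abs_def pair_abs_def zero_prod_def)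
    have "ennreal (cmod (x k)) * \<omega>' k * ennreal (4 ^ pair_abs k) \<le> ennreal (cmod (x k)) * \<omega>' k * ennreal (8 ^ pair_abs k)"
      by (intro mult_left_mono ennreal_leI power_mono) auto
    also have "\<dots> = ennreal (cmod (x k)) * (\<omega>' k * 8 ^ pair_abs k)"
      by (simp add: mult.assoc ennreal_power[symmetric])
    also have "\<dots> \<le> ennreal (cmod (x k)) * (ennreal C * \<omega> k)"
      by (intro mult_left_mono) (fact, simp)
    also have "\<dots> = ennreal C * (ennreal (cmod (x k)) * \<omega> k)"
      by (simp only: mult_ac)
    also have "\<dots> \<le> ennreal C * ennreal N"
      using N[unfolded wbound_def, THEN conjunct2, rule_format, of k] by (intro mult_left_mono) auto
    also have "\<dots> = ennreal (C * N)"
      using C0 N0 by (simp add: ennreal_mult)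
    finally show ?thesis
      using C0 N0 by (intro ennreal_mult_power_le) auto
  qed
  have half: "ennreal (cmod (x k)) * \<omega>' k \<le> ennreal (C * N * (1/2) ^ n) * ennreal ((1/2) ^ pair_abs k)" if "n \<le> pair_abs k" for k n
  proof -
    have "(1/4 :: real) ^ pair_abs k = (1/2) ^ pair_abs k * (1/2) ^ pair_abs k"
      by (simp add: power_mult_distrib[symmetric])
    also have "\<dots> \<le> (1/2) ^ n * (1/2) ^ pair_abs k"
      using that by (intro mult_right_mono power_decreasing) auto
    finally have "C * N * (1/4) ^ pair_abs k \<le> C * N * ((1/2) ^ n * (1/2) ^ pair_abs k)"
      using C0 N0 by (intro mult_left_mono) auto
    then show ?thesis
      using order_trans[OF bound[of k] ennreal_leI] C0 N0 by (simp add: ennreal_mult[symmetric] mult.assoc)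
  qed
  define G where "G = enn2real (lp_geometric TYPE('a) p)"
  show mem: "x \<in> ell p \<omega>'"
  proof -
    have "weighted_norm p \<omega>' x \<le> ennreal (C * N * (1/2) ^ 0 * G)"
      unfolding G_def using half[of 0] C0 N0 p by (intro geometric_norm_le) auto
    then show ?thesis
      by (simp add: ell_def le_less_trans)
  qed
  have tmem: "truncate n x \<in> ell p \<omega>'" for n
  proof -
    have "weighted_norm p \<omega>' (truncate n x) \<le> weighted_norm p \<omega>' x"
      by (intro weighted_norm_mono) (simp add: truncate_def)
    then show ?thesis
      using mem by (simp add: ell_def le_less_trans)
  qed
  have dist: "weighted_norm p \<omega>' (\<lambda>k. truncate n x k - x k) \<le> ennreal (C * N * (1/2) ^ n * G)" for n
    unfolding G_def using half[of n] C0 N0 p by (intro geometric_norm_le) (auto simp: truncate_def)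
  have "(\<lambda>n. ennreal (C * N * (1/2) ^ n * G)) \<longlonglongrightarrow> ennreal (C * N * 0 * G)"
    by (intro tendsto_ennrealI tendsto_mult tendsto_const LIMSEQ_power_zero) auto
  then have lim: "(\<lambda>n. ennreal (C * N * (1/2) ^ n * G)) \<longlonglongrightarrow> 0"
    by simp
  show "limitin (ell_top p \<omega>') (\<lambda>n. truncate n x) x sequentially"
    unfolding limitin_def
  proof (intro conjI allI impI)
    fix U assume "openin (ell_top p \<omega>') U \<and> x \<in> U"
    then obtain e where e: "e > 0" "\<And>y. y \<in> ell p \<omega>' \<Longrightarrow> weighted_norm p \<omega>' (\<lambda>k. y k - x k) < e \<Longrightarrow> y \<in> U"
      unfolding openin_ell_top by blast
    have "eventually (\<lambda>n. ennreal (C * N * (1/2) ^ n * G) < e) sequentially"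
      using lim e(1) by (rule order_tendstoD)
    then show "\<forall>\<^sub>F n in sequentially. truncate n x \<in> U"
      by eventually_elim (use e(2) tmem dist in \<open>blast intro: le_less_trans\<close>)
  qed (use mem in simp)
qed

section \<open>Projective and inductive limits\<close>

lemma continuous_map_proj_lim:
  assumes "I \<noteq> {}" "\<And>i. i \<in> I \<Longrightarrow> continuous_map Z (X i) f"
  shows "continuous_map Z (proj_lim I X) f"
  unfolding proj_lim_def
proof (rule continuous_on_generated_topo)
  have top: "f x \<in> topspace (X j)" if "x \<in> topspace Z" "j \<in> I" for x j
    using assms(2)[OF that(2)] that(1) by (auto simp: continuous_map)
  fix U assume "U \<in> {U \<inter> (\<Inter>j\<in>I. topspace (X j)) |U i. i \<in> I \<and> openin (X i) U}"
  then obtain V i where U: "U = V \<inter> (\<Inter>j\<in>I. topspace (X j))" and i: "i \<in> I" "openin (X i) V"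
    by blast
  have "f -` U \<inter> topspace Z = {x \<in> topspace Z. f x \<in> V}"
    using top by (auto simp: U)
  then show "openin Z (f -` U \<inter> topspace Z)"
    using assms(2)[OF i(1)] i(2) by (simp add: continuous_map)
next
  have top: "f x \<in> topspace (X j)" if "x \<in> topspace Z" "j \<in> I" for x j
    using assms(2)[OF that(2)] that(1) by (auto simp: continuous_map)
  show "f ` topspace Z \<subseteq> \<Union> {U \<inter> (\<Inter>j\<in>I. topspace (X j)) |U i. i \<in> I \<and> openin (X i) U}"
    using assms(1) top topspace_proj_lim[OF assms(1), of X] unfolding proj_lim_def by auto
qed

lemma continuous_map_proj_lim_component:
  assumes "i \<in> I"
  shows "continuous_map (proj_lim I X) (X i) (\<lambda>x. x)"
  unfolding continuous_map
proof (intro conjI allI impI)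
  have ne: "I \<noteq> {}" using assms by auto
  show "(\<lambda>x. x) ` topspace (proj_lim I X) \<subseteq> topspace (X i)"
    using assms by (auto simp: topspace_proj_lim[OF ne])
  fix U assume "openin (X i) U"
  then have "openin (proj_lim I X) (U \<inter> (\<Inter>j\<in>I. topspace (X j)))"
    unfolding proj_lim_def using assms by (intro topology_generated_by_Basis) blast
  then show "openin (proj_lim I X) {x \<in> topspace (proj_lim I X). x \<in> U}"
    unfolding topspace_proj_lim[OF ne, symmetric] by (metis Collect_mem_eq Collect_conj_eq Int_commute)
qed

lemma limitin_proj_lim:
  assumes "I \<noteq> {}" "\<And>i. i \<in> I \<Longrightarrow> limitin (X i) f l F"
    and "\<And>i x. i \<in> I \<Longrightarrow> f x \<in> topspace (X i)"
  shows "limitin (proj_lim I X) f l F"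
  unfolding limitin_def
proof (intro conjI allI impI)
  show "l \<in> topspace (proj_lim I X)"
    using assms by (auto simp: topspace_proj_lim limitin_def)
  fix U assume U: "openin (proj_lim I X) U \<and> l \<in> U"
  then have "generate_topology_on {U \<inter> (\<Inter>j\<in>I. topspace (X j)) |U i. i \<in> I \<and> openin (X i) U} U"
    by (simp add: proj_lim_def openin_topology_generated_by_iff)
  moreover have "l \<in> U" using U by simp
  ultimately show "\<forall>\<^sub>F x in F. f x \<in> U"
  proof induction
    case (Basis S)
    then obtain V i where S: "S = V \<inter> (\<Inter>j\<in>I. topspace (X j))" "i \<in> I" "openin (X i) V"
      by blast
    then have "\<forall>\<^sub>F x in F. f x \<in> V"
      using assms(2)[OF S(2)] Basis(2) by (auto simp: limitin_def)
    then show ?case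
      by eventually_elim (use assms(3) in \<open>auto simp: S(1)\<close>)
  next
    case (UN K)
    then obtain k where "k \<in> K" "l \<in> k" by blast
    then have "\<forall>\<^sub>F x in F. f x \<in> k"
      using UN by blast
    then show ?case
      by eventually_elim (use \<open>k \<in> K\<close> in blast)
  qed (auto intro: eventually_conj)
qed

text \<open>Neighbourhoods in the limit are translates of neighbourhoods of 0, whereas a step
  carries its own topology. Continuity of the translations of the step is what moves the comparison
  from 0 to an arbitrary point.\<close>

lemma continuous_map_into_ind_lim:
  fixes X :: "'i \<Rightarrow> ('k \<Rightarrow> complex) topology"
  assumes i: "i \<in> I" and zero: "\<And>i. i \<in> I \<Longrightarrow> (\<lambda>_. 0) \<in> topspace (X i)"
    and transl: "\<And>x. x \<in> topspace (X i) \<Longrightarrow> continuous_map (X i) (X i) (\<lambda>y k. y k - x k)"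
  shows "continuous_map (X i) (ind_lim I X) (\<lambda>x. x)"
  unfolding continuous_map
proof (intro conjI allI impI)
  show "(\<lambda>x. x) ` topspace (X i) \<subseteq> topspace (ind_lim I X)"
    using i by (auto simp: topspace_ind_lim[OF zero])
  fix U assume U: "openin (ind_lim I X) U"
  show "openin (X i) {x \<in> topspace (X i). x \<in> U}"
  proof (subst openin_subopen, intro ballI)
    fix x assume "x \<in> {x \<in> topspace (X i). x \<in> U}"
    then have x: "x \<in> topspace (X i)" "x \<in> U" by auto
    obtain V where V: "lc_zero_nbhd I X V" "\<And>y. y \<in> (\<Union>i\<in>I. topspace (X i)) \<Longrightarrow> (\<lambda>k. y k - x k) \<in> V \<Longrightarrow> y \<in> U"
      using U x(2) unfolding openin_ind_lim by blast
    obtain W where W: "openin (X i) W" "(\<lambda>_. 0) \<in> W" "W \<subseteq> V"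
      using V(1) i by (auto simp: lc_zero_nbhd_def)
    have "openin (X i) {y \<in> topspace (X i). (\<lambda>k. y k - x k) \<in> W}"
      using transl[OF x(1)] W(1) by (simp add: continuous_map)
    moreover have "x \<in> {y \<in> topspace (X i). (\<lambda>k. y k - x k) \<in> W}"
      using x W by simp
    moreover have "{y \<in> topspace (X i). (\<lambda>k. y k - x k) \<in> W} \<subseteq> {x \<in> topspace (X i). x \<in> U}"
      using V(2) W(3) i by blast
    ultimately show "\<exists>T. openin (X i) T \<and> x \<in> T \<and> T \<subseteq> {x \<in> topspace (X i). x \<in> U}"
      by blast
  qed
qed

text \<open>The set of sequences with \<open>k\<close>-th entry below \<open>e\<close> in modulus is
  absolutely convex and meets every step in a neighbourhood of 0.\<close>

lemma ind_lim_coord_continuous: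
  fixes X :: "'i \<Rightarrow> ('k \<Rightarrow> complex) topology"
  assumes zero: "\<And>i. i \<in> I \<Longrightarrow> (\<lambda>_. 0) \<in> topspace (X i)"
    and coord: "\<And>i. i \<in> I \<Longrightarrow> continuous_map (X i) euclidean (\<lambda>y. y k)"
  shows "continuous_map (ind_lim I X) euclidean (\<lambda>y. y k)"
  unfolding continuous_map
proof (intro conjI allI impI)
  fix U :: "complex set" assume U: "openin euclidean U"
  show "openin (ind_lim I X) {x \<in> topspace (ind_lim I X). x k \<in> U}"
    unfolding openin_ind_lim
  proof (intro conjI ballI)
    fix x assume x: "x \<in> {x \<in> topspace (ind_lim I X). x k \<in> U}"
    then obtain e where e: "e > 0" "ball (x k) e \<subseteq> U"
      using U open_contains_ball[of U] by auto
    define V where "V = {v :: 'k \<Rightarrow> complex. cmod (v k) < e}"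
    have "lc_zero_nbhd I X V"
      unfolding lc_zero_nbhd_def
    proof (intro conjI ballI)
      show "abs_convex V"
        unfolding abs_convex_def
      proof (intro ballI allI impI)
        fix x y :: "'k \<Rightarrow> complex" and a b assume xy: "x \<in> V" "y \<in> V" and ab: "cmod a + cmod b \<le> 1"
        \<comment> \<open>The maximum keeps the inequality strict for coefficients with
          \<open>cmod a + cmod b \<le> 1\<close>, including \<open>a = b = 0\<close>.\<close>
        define m where "m = max (cmod (x k)) (cmod (y k))"
        have m: "m < e" "m \<ge> 0" "cmod (x k) \<le> m" "cmod (y k) \<le> m"
          using xy by (auto simp: m_def V_def le_max_iff_disj)
        have "cmod (a * x k + b * y k) \<le> cmod a * cmod (x k) + cmod b * cmod (y k)"
          using norm_triangle_ineq[of "a * x k" "b * y k"] by (simp add: norm_mult)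
        also have "\<dots> \<le> cmod a * m + cmod b * m"
          using m by (intro add_mono mult_left_mono) auto
        also have "\<dots> = (cmod a + cmod b) * m"
          by (simp add: algebra_simps)
        also have "\<dots> \<le> 1 * m"
          using ab m by (intro mult_right_mono) auto
        finally show "(\<lambda>k. a * x k + b * y k) \<in> V"
          using m by (simp add: V_def)
      qed
      fix i assume i: "i \<in> I"
      have "openin euclidean (ball (0 :: complex) e)" by simp
      then have "openin (X i) {y \<in> topspace (X i). y k \<in> ball 0 e}"
        using coord[OF i] by (simp only: continuous_map)
      then show "\<exists>O'. openin (X i) O' \<and> (\<lambda>_. 0) \<in> O' \<and> O' \<subseteq> V"
        using zero[OF i] e by (intro exI[of _ "{y \<in> topspace (X i). y k \<in> ball 0 e}"]) (auto simp: V_def)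
    qed
    moreover have "y \<in> {x \<in> topspace (ind_lim I X). x k \<in> U}"
      if "y \<in> (\<Union>i\<in>I. topspace (X i))" "(\<lambda>k. y k - x k) \<in> V" for y
      using that e by (auto simp: topspace_ind_lim[OF zero] V_def dist_norm norm_minus_commute)
    ultimately show "\<exists>V. lc_zero_nbhd I X V \<and> (\<forall>y\<in>(\<Union>i\<in>I. topspace (X i)).
        (\<lambda>k. y k - x k) \<in> V \<longrightarrow> y \<in> {x \<in> topspace (ind_lim I X). x k \<in> U})"
      by blast
  qed (auto simp: topspace_ind_lim[OF zero])
qed auto

lemma continuous_map_from_final_top:
  assumes "\<And>i. i \<in> I \<Longrightarrow> continuous_map (X i) Y f"
  shows "continuous_map (final_top I X) Y f"
  unfolding continuous_map
proof (intro conjI allI impI)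
  show "f ` topspace (final_top I X) \<subseteq> topspace Y"
    using assms by (fastforce simp: topspace_final_top continuous_map)
  fix U assume U: "openin Y U"
  show "openin (final_top I X) {x \<in> topspace (final_top I X). f x \<in> U}"
    unfolding openin_final_top
  proof (intro conjI ballI)
    fix i assume i: "i \<in> I"
    have "{x \<in> topspace (final_top I X). f x \<in> U} \<inter> topspace (X i) = {x \<in> topspace (X i). f x \<in> U}"
      using i by (auto simp: topspace_final_top)
    then show "openin (X i) ({x \<in> topspace (final_top I X). f x \<in> U} \<inter> topspace (X i))"
      using assms[OF i] U by (simp add: continuous_map)
  qed (auto simp: topspace_final_top)
qed

lemma continuous_map_into_final_top:
  assumes "i \<in> I"
  shows "continuous_map (X i) (final_top I X) (\<lambda>x. x)"
  unfolding continuous_map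
proof (intro conjI allI impI)
  show "(\<lambda>x. x) ` topspace (X i) \<subseteq> topspace (final_top I X)"
    using assms by (auto simp: topspace_final_top)
  fix U assume "openin (final_top I X) U"
  then have "openin (X i) (U \<inter> topspace (X i))"
    using assms by (simp add: openin_final_top)
  then show "openin (X i) {x \<in> topspace (X i). x \<in> U}"
    by (metis Collect_mem_eq Collect_conj_eq Int_commute)
qed

text \<open>Two continuous extensions agree along a sequence from \<open>D\<close> converging to the
  point. Comparing them coordinate by coordinate places the limits in the complex numbers, where
  they are unique; the coordinates take the role of a separation axiom for \<open>Y\<close>.\<close>

lemma uniquely_extendsI:
  fixes Y :: "('k \<Rightarrow> complex) topology"
  assumes D: "D \<subseteq> topspace P" and cont: "continuous_map P Y B" and eq: "\<And>x. x \<in> D \<Longrightarrow> B x = f x"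
    and dense: "\<And>x. x \<in> topspace P \<Longrightarrow> \<exists>u::nat \<Rightarrow> _. (\<forall>n. u n \<in> D) \<and> limitin P u x sequentially"
    and coord: "\<And>k. continuous_map Y euclidean (\<lambda>y. y k)"
  shows "uniquely_extends P Y D f"
  unfolding uniquely_extends_def
proof (intro conjI)
  let ?T = "restrict B (topspace P)"
  show "\<exists>!T. T \<in> extensional (topspace P) \<and> continuous_map P Y T \<and> (\<forall>x\<in>D. T x = f x)"
  proof (rule ex1I[of _ ?T])
    have "continuous_map P Y ?T"
      using cont by (rule continuous_map_eq) simp
    then show "?T \<in> extensional (topspace P) \<and> continuous_map P Y ?T \<and> (\<forall>x\<in>D. ?T x = f x)"
      using D eq by auto
    fix T assume T: "T \<in> extensional (topspace P) \<and> continuous_map P Y T \<and> (\<forall>x\<in>D. T x = f x)"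
    show "T = ?T"
    proof (rule extensionalityI)
      show "T \<in> extensional (topspace P)" "?T \<in> extensional (topspace P)"
        using T by auto
      fix x assume x: "x \<in> topspace P"
      obtain u :: "nat \<Rightarrow> _" where u: "\<And>n. u n \<in> D" "limitin P u x sequentially"
        using dense[OF x] by blast
      have "T x k = B x k" for k
      proof (rule LIMSEQ_unique)
        have lim: "limitin euclidean ((\<lambda>x. S x k) \<circ> u) (S x k) sequentially" if "continuous_map P Y S" for S
          using continuous_map_limit[OF continuous_map_compose[OF that coord[of k]] u(2)] by (simp add: o_def)
        show "(\<lambda>n. f (u n) k) \<longlonglongrightarrow> T x k"
          using lim[of T] T u(1) by (simp add: o_def)
        show "(\<lambda>n. f (u n) k) \<longlonglongrightarrow> B x k"
          using lim[OF cont] eq u(1) by (simp add: o_def)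
      qed
      then show "T x = ?T x"
        using x by auto
    qed
  qed
qed (rule D)

section \<open>Criteria for unique extension in terms of admissible weights\<close>

lemma prod_continuous_map_id:
  assumes "continuous_map X Y (\<lambda>x. x)"
  shows "continuous_map (prod_topology X X) (prod_topology Y Y) (\<lambda>x. x)"
  using continuous_map_prod_top[of X X Y Y "\<lambda>x. x" "\<lambda>x. x"] assms by (simp add: case_prod_unfold)

lemma limitin_truncate_pair:
  assumes "limitin X (\<lambda>n. truncate n x) x sequentially" "limitin X (\<lambda>n. truncate n y) y sequentially"
  shows "limitin (prod_topology X X) (\<lambda>n. (truncate n x, truncate n y)) (x, y) sequentially"
  using assms by (simp add: limitin_pairwise o_def)

lemma A_fin_in_ell:
  assumes p: "p > 0" and a: "a \<in> A_fin" and \<omega>: "\<And>k. a k \<noteq> 0 \<Longrightarrow> \<omega> k \<noteq> \<infinity>"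
  shows "a \<in> ell p \<omega>"
proof -
  have fin: "finite {k. a k \<noteq> 0}"
    using a by (simp add: A_fin_def)
  let ?f = "\<lambda>k. ennreal (cmod (a k)) * \<omega> k"
  have f: "?f k < \<infinity>" for k
    using \<omega>[of k] by (cases "a k = 0") (auto simp: ennreal_mult_less_top less_top)
  have "lp_norm p ?f < \<infinity>"
  proof (cases "p = \<infinity>")
    case True
    have "?f k \<le> (\<Sum>k | a k \<noteq> 0. ?f k)" for k
    proof (cases "a k = 0")
      case False
      then show ?thesis
        using fin by (intro member_le_sum) auto
    qed simp
    then have "lp_norm p ?f \<le> (\<Sum>k | a k \<noteq> 0. ?f k)"
      using True by (auto simp: lp_norm_def intro: SUP_least)
    also have "\<dots> < \<infinity>"
      using f fin by (simp add: ennreal_sum_less_top less_top)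
    finally show ?thesis .
  next
    case False
    have q: "enn2real p > 0"
      using p False by (rule enn2real_pos_exponent)
    have "infsum (\<lambda>k. ennreal_powr (?f k) (enn2real p)) UNIV = infsum (\<lambda>k. ennreal_powr (?f k) (enn2real p)) {k. a k \<noteq> 0}"
      by (rule infsum_cong_neutral) (auto simp: ennreal_powr_def)
    also have "\<dots> < \<infinity>"
      using f fin ennreal_powr_finite_iff by (simp add: ennreal_sum_less_top less_top)
    finally show ?thesis
      unfolding lp_norm_finite_iff[OF p False] .
  qed
  then show ?thesis
    by (simp add: ell_def weighted_norm_def)
qed

lemma twisted_pair_eq: "x \<in> A_fin \<times> A_fin \<Longrightarrow> (case x of (a, b) \<Rightarrow> aw_prod a b) = (case x of (a, b) \<Rightarrow> twisted_aw a b)"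
  by (auto simp: twisted_aw_eq)

text \<open>Continuity into a projective limit is tested on each target component \<open>r'\<close>,
  and the source component \<open>r\<close> may depend on it. The same choice makes the truncations
  converge in every component.\<close>

lemma proj_lim_extension:
  fixes p :: ennreal and W :: "real \<Rightarrow> ('d::finite) weight"
  defines "X \<equiv> proj_lim {0<..} (\<lambda>r. ell_top p (W r))"
  assumes p: "p > 0"
    and adm: "\<And>r'. r' > 0 \<Longrightarrow> \<exists>r>0. admissible (W r) (W r')"
    and one: "\<And>r. r > 0 \<Longrightarrow> W r 0 = 1"
    and fin: "\<And>r k. r > 0 \<Longrightarrow> W r k \<noteq> \<infinity>" and nz: "\<And>k. \<exists>r>0. W r k \<noteq> 0"
  shows "uniquely_extends (prod_topology X X) X (A_fin \<times> A_fin) (\<lambda>(a, b). twisted_aw a b)"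
proof -
  have ne: "{0 :: real<..} \<noteq> {}" by auto
  have comp: "continuous_map X (ell_top p (W r)) (\<lambda>x. x)" if "r > 0" for r
    unfolding X_def using that by (intro continuous_map_proj_lim_component) simp
  have top: "topspace X = (\<Inter>r\<in>{0<..}. ell p (W r))"
    by (simp add: X_def topspace_proj_lim[OF ne])
  have A: "A_fin \<subseteq> topspace X"
    unfolding top using fin p by (auto intro!: A_fin_in_ell)
  show ?thesis
  proof (rule uniquely_extendsI)
    show "A_fin \<times> A_fin \<subseteq> topspace (prod_topology X X)"
      using A by auto
    show "continuous_map (prod_topology X X) X (\<lambda>(a, b). aw_prod a b)"
      unfolding X_def
    proof (rule continuous_map_proj_lim[OF ne])
      fix r' :: real assume "r' \<in> {0<..}"
      then obtain r where r: "r > 0" "admissible (W r) (W r')"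
        using adm by auto
      from continuous_map_compose[OF prod_continuous_map_id[OF comp[OF r(1)]] admissible_continuous[OF r(2) p]]
      show "continuous_map (prod_topology (proj_lim {0<..} (\<lambda>r. ell_top p (W r))) (proj_lim {0<..} (\<lambda>r. ell_top p (W r))))
          (ell_top p (W r')) (\<lambda>(a, b). aw_prod a b)"
        by (simp add: X_def o_def)
    qed
    have lim: "limitin X (\<lambda>n. truncate n x) x sequentially" if x: "x \<in> topspace X" for x
      unfolding X_def
    proof (rule limitin_proj_lim[OF ne])
      fix r' :: real assume r': "r' \<in> {0<..}"
      then obtain r where r: "r > 0" "admissible (W r) (W r')"
        using adm by auto
      show "limitin (ell_top p (W r')) (\<lambda>n. truncate n x) x sequentially"
        using x r by (intro truncate_limit(2)[OF r(2) one p]) (auto simp: top)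
      show "truncate n x \<in> topspace (ell_top p (W r'))" for n
        using subsetD[OF A truncate_A_fin, of n x] r' by (auto simp: top)
    qed
    fix x assume "x \<in> topspace (prod_topology X X)"
    then obtain y z where x: "x = (y, z)" "y \<in> topspace X" "z \<in> topspace X"
      by auto
    then show "\<exists>u::nat \<Rightarrow> _. (\<forall>n. u n \<in> A_fin \<times> A_fin) \<and> limitin (prod_topology X X) u x sequentially"
      using limitin_truncate_pair[OF lim[OF x(2)] lim[OF x(3)]]
      by (intro exI[of _ "\<lambda>n. (truncate n y, truncate n z)"]) (simp add: x(1) truncate_A_fin)
  next
    fix k
    obtain r where r: "r > 0" "W r k \<noteq> 0"
      using nz by blast
    from continuous_map_compose[OF comp[OF r(1)] ell_coord_continuous[OF p, of "W r" k, OF r(2)]]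
    show "continuous_map X euclidean (\<lambda>y. y k)"
      by (simp add: o_def)
  qed (rule twisted_pair_eq)
qed

text \<open>The order of quantifiers in \<open>adm\<close> is that of outer source, outer target,
  inner target, inner source: one step \<open>r'\<close> receives the products from step
  \<open>r\<close>, and within it each component \<open>t'\<close> may be served by its own
  \<open>t\<close>.\<close>

lemma ind_square_extension:
  fixes p :: ennreal and W :: "real \<Rightarrow> real \<Rightarrow> ('d::finite) weight"
  defines "X \<equiv> \<lambda>r. proj_lim {0<..} (\<lambda>t. ell_top p (W r t))"
  assumes p: "p > 0"
    and adm: "\<And>r. r > 0 \<Longrightarrow> \<exists>r'>0. \<forall>t'>0. \<exists>t>0. admissible (W r t) (W r' t')"
    and one: "\<And>r t. r > 0 \<Longrightarrow> t > 0 \<Longrightarrow> W r t 0 = 1"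
    and fin: "\<And>K. finite K \<Longrightarrow> \<exists>r>0. \<forall>t>0. \<forall>k\<in>K. W r t k \<noteq> \<infinity>"
    and nz: "\<And>r k. r > 0 \<Longrightarrow> \<exists>t>0. W r t k \<noteq> 0"
  shows "uniquely_extends (ind_square X) (ind_lim {0<..} X) (A_fin \<times> A_fin) (\<lambda>(a, b). twisted_aw a b)"
proof -
  have ne: "{0 :: real<..} \<noteq> {}" by auto
  have X_eq: "X r = proj_lim {0<..} (\<lambda>t. ell_top p (W r t))" for r
    by (simp add: X_def)
  have comp: "continuous_map (X r) (ell_top p (W r t)) (\<lambda>x. x)" if "t > 0" for r t
    unfolding X_def using that by (intro continuous_map_proj_lim_component) simp
  have top: "topspace (X r) = (\<Inter>t\<in>{0<..}. ell p (W r t))" for r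
    by (simp add: X_def topspace_proj_lim[OF ne])
  have zero: "(\<lambda>_. 0) \<in> topspace (X r)" for r
    using p by (simp add: top)
  have transl: "continuous_map (X r) (X r) (\<lambda>y k. y k - x k)" if x: "x \<in> topspace (X r)" for r x
  proof -
    have "continuous_map (X r) (ell_top p (W r t)) (\<lambda>y k. y k - x k)" if t: "t > 0" for t
    proof -
      have "x \<in> ell p (W r t)" using x t by (auto simp: top)
      from continuous_map_compose[OF comp[OF t, of r] ell_translation_continuous[OF p this]]
      show ?thesis by (simp add: o_def)
    qed
    then show ?thesis
      unfolding X_eq[of r] by (intro continuous_map_proj_lim[OF ne]) (simp add: X_eq)
  qed
  have into: "continuous_map (X r) (ind_lim {0<..} X) (\<lambda>x. x)" if "r > 0" for r
    using that zero transl by (intro continuous_map_into_ind_lim) auto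
  have topP: "topspace (ind_square X) = (\<Union>r\<in>{0<..}. topspace (X r) \<times> topspace (X r))"
    by (simp add: ind_square_def topspace_final_top)
  show ?thesis
  proof (rule uniquely_extendsI)
    show "A_fin \<times> A_fin \<subseteq> topspace (ind_square X)"
    proof
      fix x :: "'d fseries \<times> 'd fseries" assume "x \<in> A_fin \<times> A_fin"
      then obtain a b where x: "x = (a, b)" "a \<in> A_fin" "b \<in> A_fin" by auto
      then have "finite ({k. a k \<noteq> 0} \<union> {k. b k \<noteq> 0})"
        by (simp add: A_fin_def)
      from fin[OF this] obtain r where r: "r > 0" "\<And>t k. t > 0 \<Longrightarrow> a k \<noteq> 0 \<or> b k \<noteq> 0 \<Longrightarrow> W r t k \<noteq> \<infinity>"
        by blast
      then have "a \<in> topspace (X r)" "b \<in> topspace (X r)"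
        unfolding top using x p by (auto intro!: A_fin_in_ell)
      then show "x \<in> topspace (ind_square X)"
        using r(1) by (auto simp: topP x(1))
    qed
    show "continuous_map (ind_square X) (ind_lim {0<..} X) (\<lambda>(a, b). aw_prod a b)"
      unfolding ind_square_def
    proof (rule continuous_map_from_final_top)
      fix r :: real assume "r \<in> {0<..}"
      then have "r > 0" by simp
      from adm[OF this] obtain r' where r': "r' > 0" "\<forall>t'>0. \<exists>t>0. admissible (W r t) (W r' t')"
        by blast
      have "continuous_map (prod_topology (X r) (X r)) (X r') (\<lambda>(a, b). aw_prod a b)"
        unfolding X_eq[of r']
      proof (rule continuous_map_proj_lim[OF ne])
        fix t' :: real assume "t' \<in> {0<..}"
        then obtain t where t: "t > 0" "admissible (W r t) (W r' t')"
          using r'(2) by auto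
        from continuous_map_compose[OF prod_continuous_map_id[OF comp[OF t(1)]] admissible_continuous[OF t(2) p]]
        show "continuous_map (prod_topology (X r) (X r)) (ell_top p (W r' t')) (\<lambda>(a, b). aw_prod a b)"
          by (simp add: o_def)
      qed
      from continuous_map_compose[OF this into[OF r'(1)]]
      show "continuous_map (prod_topology (X r) (X r)) (ind_lim {0<..} X) (\<lambda>(a, b). aw_prod a b)"
        by (simp add: o_def case_prod_unfold)
    qed
    fix x assume "x \<in> topspace (ind_square X)"
    then obtain r y z where x: "x = (y, z)" and r: "r > 0" and yz: "y \<in> topspace (X r)" "z \<in> topspace (X r)"
      by (auto simp: topP)
    \<comment> \<open>The truncations are shown to converge only in the target step
      \<open>r'\<close>, not in the step \<open>r\<close> that contains the pair; the product of
      step \<open>r'\<close> with itself is still one of those generating the topology.\<close>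
    from adm[OF r] obtain r' where r': "r' > 0" "\<forall>t'>0. \<exists>t>0. admissible (W r t) (W r' t')"
      by blast
    have lim: "limitin (X r') (\<lambda>n. truncate n y) y sequentially" if y: "y \<in> topspace (X r)" for y
      unfolding X_def
    proof (rule limitin_proj_lim[OF ne])
      fix t' :: real assume "t' \<in> {0<..}"
      then obtain t where t: "t > 0" "admissible (W r t) (W r' t')"
        using r'(2) by auto
      have y: "y \<in> ell p (W r t)"
        using y t(1) by (auto simp: top)
      show "limitin (ell_top p (W r' t')) (\<lambda>n. truncate n y) y sequentially"
        by (rule truncate_limit(2)[OF t(2) one[OF r t(1)] p y])
      have "y \<in> ell p (W r' t')"
        by (rule truncate_limit(1)[OF t(2) one[OF r t(1)] p y])
      moreover have "weighted_norm p (W r' t') (truncate n y) \<le> weighted_norm p (W r' t') y" for n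
        by (intro weighted_norm_mono) (simp add: truncate_def)
      ultimately show "truncate n y \<in> topspace (ell_top p (W r' t'))" for n
        by (simp add: ell_def) (rule le_less_trans)
    qed
    have "limitin (ind_square X) (\<lambda>n. (truncate n y, truncate n z)) x sequentially"
    proof -
      have "continuous_map (prod_topology (X r') (X r')) (ind_square X) (\<lambda>x. x)"
        unfolding ind_square_def using r'(1)
        by (intro continuous_map_into_final_top[where X = "\<lambda>r. prod_topology (X r) (X r)"]) simp
      from continuous_map_limit[OF this limitin_truncate_pair[OF lim[OF yz(1)] lim[OF yz(2)]]]
      show ?thesis by (simp add: o_def x)
    qed
    then show "\<exists>u::nat \<Rightarrow> _. (\<forall>n. u n \<in> A_fin \<times> A_fin) \<and> limitin (ind_square X) u x sequentially"
      by (intro exI[of _ "\<lambda>n. (truncate n y, truncate n z)"]) (simp add: truncate_A_fin)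
  next
    fix k
    show "continuous_map (ind_lim {0<..} X) euclidean (\<lambda>y. y k)"
    proof (rule ind_lim_coord_continuous[OF zero])
      fix r :: real assume "r \<in> {0<..}"
      then have "r > 0" by simp
      from nz[OF this, of k] obtain t where t: "t > 0" "W r t k \<noteq> 0"
        by blast
      from continuous_map_compose[OF comp[OF t(1)] ell_coord_continuous[OF p, of "W r t" k, OF t(2)]]
      show "continuous_map (X r) euclidean (\<lambda>y. y k)"
        by (simp add: o_def)
    qed
  qed (rule twisted_pair_eq)
qed


section \<open>Joint continuity on a countable inductive limit of weighted spaces\<close>

lemma abs_convex_scale:
  assumes "abs_convex V" "x \<in> V" "cmod a \<le> 1"
  shows "(\<lambda>k. a * x k) \<in> V"
  using assms(1)[unfolded abs_convex_def, rule_format, OF assms(2,2), of a 0] assms(3) by simp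

text \<open>The sum is the convex combination with weights \<open>1/3\<close> of the tripled
  summands, formed in two steps because absolute convexity speaks of two vectors.\<close>

lemma abs_convex_sum3:
  assumes V: "abs_convex V" and x: "(\<lambda>k. 3 * x k) \<in> V" and y: "(\<lambda>k. 3 * y k) \<in> V" and z: "(\<lambda>k. 3 * z k) \<in> V"
  shows "(\<lambda>k. x k + y k + z k) \<in> V"
proof -
  have "(\<lambda>k. (1/2) * (3 * x k) + (1/2) * (3 * y k)) \<in> V"
    using V[unfolded abs_convex_def, rule_format, OF x y, of "1/2" "1/2"] by simp
  from V[unfolded abs_convex_def, rule_format, OF this z, of "2/3" "1/3"]
  show ?thesis
    by (simp add: algebra_simps)
qed

lemma abs_convex_preimage_scale:
  assumes "abs_convex V"
  shows "abs_convex {x. (\<lambda>k. t * x k) \<in> V}"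
  unfolding abs_convex_def
proof (intro ballI allI impI)
  fix x y a b
  assume xy: "x \<in> {x. (\<lambda>k. t * x k) \<in> V}" "y \<in> {x. (\<lambda>k. t * x k) \<in> V}" and ab: "cmod a + cmod b \<le> 1"
  have "(\<lambda>k. a * (t * x k) + b * (t * y k)) \<in> V"
    using xy ab assms[unfolded abs_convex_def, rule_format, of "\<lambda>k. t * x k" "\<lambda>k. t * y k" a b] by simp
  then show "(\<lambda>k. a * x k + b * y k) \<in> {x. (\<lambda>k. t * x k) \<in> V}"
    by (simp add: algebra_simps)
qed

lemma lc_zero_nbhd_scale:
  assumes V: "lc_zero_nbhd I (\<lambda>i. ell_top p (W i)) V" and p: "p > 0"
  shows "lc_zero_nbhd I (\<lambda>i. ell_top p (W i)) {x. (\<lambda>k. t * x k) \<in> V}"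
  unfolding lc_zero_nbhd_def
proof (intro conjI ballI)
  show "abs_convex {x. (\<lambda>k. t * x k) \<in> V}"
    using V by (intro abs_convex_preimage_scale) (simp add: lc_zero_nbhd_def)
  fix i assume "i \<in> I"
  then obtain U where U: "openin (ell_top p (W i)) U" "(\<lambda>_. 0) \<in> U" "U \<subseteq> V"
    using V by (auto simp: lc_zero_nbhd_def)
  have "openin (ell_top p (W i)) {x \<in> topspace (ell_top p (W i)). (\<lambda>k. t * x k) \<in> U}"
    using ell_scaling_continuous[OF p, of "W i" t] U(1) by (simp only: continuous_map)
  then show "\<exists>O'. openin (ell_top p (W i)) O' \<and> (\<lambda>_. 0) \<in> O' \<and> O' \<subseteq> {x. (\<lambda>k. t * x k) \<in> V}"
    using U p by (intro exI[of _ "{x \<in> topspace (ell_top p (W i)). (\<lambda>k. t * x k) \<in> U}"]) auto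
qed

text \<open>A translate of a neighbourhood of 0 is not open by definition. Its interior is taken
  instead, consisting of the points around which some translated neighbourhood of 0 stays
  inside.\<close>

lemma ind_lim_nbhd:
  fixes W :: "'i \<Rightarrow> 'k \<Rightarrow> ennreal"
  assumes V: "lc_zero_nbhd I (\<lambda>i. ell_top p (W i)) V" and p: "p > 0"
    and x: "x \<in> (\<Union>i\<in>I. ell p (W i))"
  obtains U where "openin (ind_lim I (\<lambda>i. ell_top p (W i))) U" "x \<in> U" "\<And>y. y \<in> U \<Longrightarrow> (\<lambda>k. y k - x k) \<in> V"
proof -
  let ?X = "\<lambda>i. ell_top p (W i)" and ?E = "\<Union>i\<in>I. ell p (W i)"
  define U where "U = {z \<in> ?E. \<exists>V'. lc_zero_nbhd I ?X V' \<and> (\<forall>y\<in>?E. (\<lambda>k. y k - z k) \<in> V' \<longrightarrow> (\<lambda>k. y k - x k) \<in> V)}"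
  have zero: "(\<lambda>_. 0) \<in> V'" if "lc_zero_nbhd I ?X V'" for V'
    using that x unfolding lc_zero_nbhd_def by blast
  show ?thesis
  proof (rule that[of U])
    show "openin (ind_lim I ?X) U"
      unfolding openin_ind_lim topspace_ell_top
    proof (intro conjI ballI)
      show "U \<subseteq> ?E" by (auto simp: U_def)
      fix z assume "z \<in> U"
      then obtain V' where V': "lc_zero_nbhd I ?X V'" "\<And>y. y \<in> ?E \<Longrightarrow> (\<lambda>k. y k - z k) \<in> V' \<Longrightarrow> (\<lambda>k. y k - x k) \<in> V"
        unfolding U_def by blast
      \<comment> \<open>Half of \<open>V'\<close> leaves room for a second displacement of the same
        size, which shows that nearby points are interior too.\<close>
      let ?H = "{v. (\<lambda>k. 2 * v k) \<in> V'}"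
      have H: "lc_zero_nbhd I ?X ?H"
        by (rule lc_zero_nbhd_scale[OF V'(1) p])
      have conv: "abs_convex V'"
        using V'(1) by (simp add: lc_zero_nbhd_def)
      have "y \<in> U" if y: "y \<in> ?E" "(\<lambda>k. y k - z k) \<in> ?H" for y
      proof -
        have "(\<lambda>k. u k - x k) \<in> V" if u: "u \<in> ?E" "(\<lambda>k. u k - y k) \<in> ?H" for u
        proof (rule V'(2)[OF u(1)])
          have "(\<lambda>k. (1/2) * (2 * (u k - y k)) + (1/2) * (2 * (y k - z k))) \<in> V'"
            using conv[unfolded abs_convex_def, rule_format, of "\<lambda>k. 2 * (u k - y k)" "\<lambda>k. 2 * (y k - z k)" "1/2" "1/2"] u y by simp
          also have "(\<lambda>k. (1/2) * (2 * (u k - y k)) + (1/2) * (2 * (y k - z k))) = (\<lambda>k. u k - z k)"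
            by (simp add: fun_eq_iff field_simps)
          finally show "(\<lambda>k. u k - z k) \<in> V'" .
        qed
        then show ?thesis
          using y H unfolding U_def by blast
      qed
      then show "\<exists>V. lc_zero_nbhd I ?X V \<and> (\<forall>y\<in>?E. (\<lambda>k. y k - z k) \<in> V \<longrightarrow> y \<in> U)"
        using H by blast
    qed
    show "x \<in> U"
      using x V unfolding U_def by blast
    show "(\<lambda>k. y k - x k) \<in> V" if y: "y \<in> U" for y
    proof -
      obtain V' where V': "lc_zero_nbhd I ?X V'" "\<And>u. u \<in> ?E \<Longrightarrow> (\<lambda>k. u k - y k) \<in> V' \<Longrightarrow> (\<lambda>k. u k - x k) \<in> V"
        using y unfolding U_def by blast
      have "y \<in> ?E" using y by (simp add: U_def)
      then show ?thesis
        using V'(2)[of y] zero[OF V'(1)] by simp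
    qed
  qed
qed

lemma openin_ell_top_zero:
  assumes "openin (ell_top p \<omega>) U" "(\<lambda>_. 0) \<in> U"
  obtains e :: real where "e > 0" "\<And>y. weighted_norm p \<omega> y \<le> ennreal e \<Longrightarrow> y \<in> U"
proof -
  obtain e where e: "e > 0" "\<forall>y\<in>ell p \<omega>. weighted_norm p \<omega> y < e \<longrightarrow> y \<in> U"
    using bspec[OF conjunct2[OF assms(1)[unfolded openin_ell_top]] assms(2)] by auto
  obtain e0 where e0: "e0 > 0" "ennreal e0 < e"
  proof (cases e)
    case (real r)
    then show ?thesis
      using that[of "r / 2"] e(1) by (simp add: ennreal_less_iff)
  qed (use that[of 1] in simp)
  have "y \<in> U" if y: "weighted_norm p \<omega> y \<le> ennreal e0" for y
  proof -
    have "weighted_norm p \<omega> y < e"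
      using y e0(2) by (rule le_less_trans)
    moreover have "y \<in> ell p \<omega>"
      using le_less_trans[OF y ennreal_less_top] by (simp add: ell_def)
    ultimately show ?thesis
      using e(2) by blast
  qed
  then show ?thesis
    using e0(1) that by blast
qed

lemma ell_absorb:
  assumes p: "p > 0" and U: "openin (ell_top p \<omega>) U" "(\<lambda>_. 0) \<in> U" and x: "x \<in> ell p \<omega>"
  obtains t :: real where "0 < t" "t \<le> 1" "(\<lambda>k. of_real t * x k) \<in> U"
proof -
  obtain e0 where e0: "e0 > 0" "\<And>y. weighted_norm p \<omega> y \<le> ennreal e0 \<Longrightarrow> y \<in> U"
    using openin_ell_top_zero[OF U] by blast
  define N where "N = enn2real (weighted_norm p \<omega> x)"
  have N: "weighted_norm p \<omega> x = ennreal N" "N \<ge> 0"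
    using x by (auto simp: N_def ell_def less_top)
  define t where "t = min 1 (e0 / (N + 1))"
  have t: "0 < t" "t \<le> 1" "t * N \<le> e0"
  proof -
    show "0 < t" "t \<le> 1" using e0 N by (auto simp: t_def)
    have "t * N \<le> e0 / (N + 1) * N"
      using N by (intro mult_right_mono) (auto simp: t_def)
    also have "\<dots> \<le> e0"
      using N e0 by (simp add: field_simps)
    finally show "t * N \<le> e0" .
  qed
  have "weighted_norm p \<omega> (\<lambda>k. of_real t * x k) \<le> ennreal (t * N)"
    using ell_cmult[OF p, of \<omega> "of_real t" x] t N by (simp add: ennreal_mult)
  also have "\<dots> \<le> ennreal e0"
    using t by (intro ennreal_leI)
  finally have "(\<lambda>k. of_real t * x k) \<in> U"
    by (rule e0(2))
  then show ?thesis
    using that t by blast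
qed

text \<open>The neighbourhood is the absolutely convex hull of the balls of radius \<open>\<epsilon> n \<le> 1\<close> in the steps.
  For \<open>m \<le> n\<close> the product of the \<open>n\<close>-th and the \<open>m\<close>-th ball is controlled by \<open>\<epsilon> n\<close> alone.\<close>

lemma aw_prod_ind_lim_bounded:
  fixes p :: ennreal and W :: "real \<Rightarrow> ('d::finite) weight" and R :: "nat \<Rightarrow> real"
  defines "X \<equiv> \<lambda>r. ell_top p (W r)"
  assumes p: "p > 0" and adm: "\<And>r. r > 0 \<Longrightarrow> \<exists>r'>0. admissible (W r) (W r')"
    and R: "\<And>n. R n > 0" "\<And>n k. W (R (Suc n)) k \<le> W (R n) k" "\<And>r. r > 0 \<Longrightarrow> \<exists>n. \<forall>k. W (R n) k \<le> W r k"
    and nz: "\<And>r k. r > 0 \<Longrightarrow> W r k \<noteq> 0"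
    and V: "lc_zero_nbhd {0<..} X V"
  obtains U where "lc_zero_nbhd {0<..} X U" "\<And>x y. x \<in> U \<Longrightarrow> y \<in> U \<Longrightarrow> aw_prod x y \<in> V"
proof -
  have mono: "W (R n) k \<le> W (R m) k" if "m \<le> n" for m n k
    using that R(2) by (rule lift_Suc_antimono_le[of "\<lambda>n. W (R n) k", rotated])
  have conv: "abs_convex V"
    using V by (simp add: lc_zero_nbhd_def)
  \<comment> \<open>Within one step the product maps boundedly into a further step
    \<open>r'\<close>, so making one factor small brings it into \<open>V\<close>. Both orders are
    recorded because the product is not commutative.\<close>
  have "\<exists>\<epsilon>. 0 < \<epsilon> \<and> \<epsilon> \<le> 1 \<and> (\<forall>x y. wbound (W (R n)) x \<epsilon> \<longrightarrow> wbound (W (R n)) y 1 \<longrightarrow> aw_prod x y \<in> V \<and> aw_prod y x \<in> V)" for n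
  proof -
    obtain r' where r': "r' > 0" "admissible (W (R n)) (W r')"
      using adm[OF R(1)] by blast
    obtain K where K: "K \<ge> 0" "\<And>c d N M. wbound (W (R n)) c N \<Longrightarrow> wbound (W (R n)) d M \<Longrightarrow> weighted_norm p (W r') (aw_prod c d) \<le> ennreal (K * (N * M))"
      using admissible_norm_bound[OF r'(2) p] by blast
    obtain O' where O': "openin (ell_top p (W r')) O'" "(\<lambda>_. 0) \<in> O'" "O' \<subseteq> V"
      using V r'(1) by (auto simp: lc_zero_nbhd_def X_def)
    obtain e0 where e0: "e0 > 0" "\<And>y. weighted_norm p (W r') y \<le> ennreal e0 \<Longrightarrow> y \<in> O'"
      using openin_ell_top_zero[OF O'(1,2)] by blast
    define \<epsilon> where "\<epsilon> = min 1 (e0 / (K + 1))"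
    have \<epsilon>: "0 < \<epsilon>" "\<epsilon> \<le> 1" "K * \<epsilon> \<le> e0"
    proof -
      show "0 < \<epsilon>" "\<epsilon> \<le> 1" using e0 K by (auto simp: \<epsilon>_def)
      have "K * \<epsilon> \<le> K * (e0 / (K + 1))"
        using K by (intro mult_left_mono) (auto simp: \<epsilon>_def)
      also have "\<dots> \<le> e0"
        using K e0 by (simp add: field_simps)
      finally show "K * \<epsilon> \<le> e0" .
    qed
    have small: "z \<in> V" if "weighted_norm p (W r') z \<le> ennreal (K * \<epsilon>)" for z
      using e0(2)[OF order_trans[OF that ennreal_leI[OF \<epsilon>(3)]]] O'(3) by blast
    have "aw_prod x y \<in> V \<and> aw_prod y x \<in> V" if "wbound (W (R n)) x \<epsilon>" "wbound (W (R n)) y 1" for x y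
      using K(2)[OF that] K(2)[OF that(2,1)] by (auto intro: small)
    then show ?thesis
      using \<epsilon> by blast
  qed
  then obtain \<epsilon> where \<epsilon>: "\<And>n. 0 < \<epsilon> n" "\<And>n. \<epsilon> n \<le> 1"
    and small: "\<And>n x y. wbound (W (R n)) x (\<epsilon> n) \<Longrightarrow> wbound (W (R n)) y 1 \<Longrightarrow> aw_prod x y \<in> V \<and> aw_prod y x \<in> V"
    by metis
  define G where "G = (\<Union>n. {x. wbound (W (R n)) x (\<epsilon> n)})"
  \<comment> \<open>Bilinearity is available only where the series of the product converge.
    \<open>E\<close> is a linear space on which they do, and it contains the hull
    \<open>U\<close>.\<close>
  define E where "E = {x. \<exists>n N. wbound (W (R n)) x N}"
  define U where "U = \<Inter>{S. abs_convex S \<and> G \<subseteq> S}"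
  have GG: "aw_prod x y \<in> V" if "x \<in> G" "y \<in> G" for x y
  proof -
    obtain n m where n: "wbound (W (R n)) x (\<epsilon> n)" and m: "wbound (W (R m)) y (\<epsilon> m)"
      using \<open>x \<in> G\<close> \<open>y \<in> G\<close> by (auto simp: G_def)
    show ?thesis
    proof (cases "m \<le> n")
      case True
      have "wbound (W (R n)) y 1"
        using wbound_mono[OF wbound_weight_mono[OF m mono[OF True]] \<epsilon>(2)] .
      then show ?thesis using small[OF n] by blast
    next
      case False
      then have "n \<le> m" by simp
      have "wbound (W (R m)) x 1"
        using wbound_mono[OF wbound_weight_mono[OF n mono[OF \<open>n \<le> m\<close>]] \<epsilon>(2)] .
      then show ?thesis using small[OF m] by blast
    qed
  qed
  have summable: "aw_term x y summable_on aw_fibre k" if "x \<in> E" "y \<in> E" for x y k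
  proof -
    obtain n m N M where n: "wbound (W (R n)) x N" and m: "wbound (W (R m)) y M"
      using \<open>x \<in> E\<close> \<open>y \<in> E\<close> by (auto simp: E_def)
    obtain r' where r': "r' > 0" "admissible (W (R (max n m))) (W r')"
      using adm[OF R(1)] by blast
    show ?thesis
      by (rule admissible_summable[OF r'(2) wbound_weight_mono[OF n mono] wbound_weight_mono[OF m mono] nz[OF r'(1)]]) auto
  qed
  have E_lin: "(\<lambda>k. a * x k + b * y k) \<in> E" if "x \<in> E" "y \<in> E" for x y a b
  proof -
    obtain n m N M where n: "wbound (W (R n)) x N" and m: "wbound (W (R m)) y M"
      using \<open>x \<in> E\<close> \<open>y \<in> E\<close> by (auto simp: E_def)
    have "wbound (W (R (max n m))) (\<lambda>k. a * x k + b * y k) (cmod a * N + cmod b * M)"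
      by (intro wbound_add wbound_cmult wbound_weight_mono[OF n mono] wbound_weight_mono[OF m mono]) auto
    then show ?thesis by (auto simp: E_def)
  qed
  have "abs_convex E"
    unfolding abs_convex_def using E_lin by blast
  moreover have GE: "G \<subseteq> E"
    by (auto simp: G_def E_def)
  ultimately have UE: "U \<subseteq> E"
    by (auto simp: U_def)
  \<comment> \<open>For fixed \<open>x\<close> in \<open>G\<close> the elements \<open>y\<close> of
    \<open>E\<close> with product in \<open>V\<close> form an absolutely convex set that contains
    \<open>G\<close>, hence \<open>U\<close>. The same argument in the first variable then extends
    the bound to the hull on both sides.\<close>
  have GU: "aw_prod x y \<in> V" if x: "x \<in> G" and y: "y \<in> U" for x y
  proof -
    have "abs_convex {y \<in> E. aw_prod x y \<in> V}"
      unfolding abs_convex_def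
    proof (intro ballI allI impI)
      fix y z a b assume yz: "y \<in> {y \<in> E. aw_prod x y \<in> V}" "z \<in> {y \<in> E. aw_prod x y \<in> V}" and ab: "cmod a + cmod b \<le> 1"
      have "aw_prod x (\<lambda>k. a * y k + b * z k) = (\<lambda>k. a * aw_prod x y k + b * aw_prod x z k)"
        using x yz GE by (intro ext aw_prod_linear_right summable) auto
      then show "(\<lambda>k. a * y k + b * z k) \<in> {y \<in> E. aw_prod x y \<in> V}"
        using yz ab conv E_lin unfolding abs_convex_def by auto
    qed
    moreover have "G \<subseteq> {y \<in> E. aw_prod x y \<in> V}"
      using GG x GE by blast
    ultimately show ?thesis
      using y by (auto simp: U_def)
  qed
  have UU: "aw_prod x y \<in> V" if x: "x \<in> U" and y: "y \<in> U" for x y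
  proof -
    have "abs_convex {x \<in> E. aw_prod x y \<in> V}"
      unfolding abs_convex_def
    proof (intro ballI allI impI)
      fix x z a b assume xz: "x \<in> {x \<in> E. aw_prod x y \<in> V}" "z \<in> {x \<in> E. aw_prod x y \<in> V}" and ab: "cmod a + cmod b \<le> 1"
      have "aw_prod (\<lambda>k. a * x k + b * z k) y = (\<lambda>k. a * aw_prod x y k + b * aw_prod z y k)"
        using y xz UE by (intro ext aw_prod_linear_left summable) auto
      then show "(\<lambda>k. a * x k + b * z k) \<in> {x \<in> E. aw_prod x y \<in> V}"
        using xz ab conv E_lin unfolding abs_convex_def by auto
    qed
    moreover have "G \<subseteq> {x \<in> E. aw_prod x y \<in> V}"
      using GU y GE by blast
    ultimately show ?thesis
      using x by (auto simp: U_def)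
  qed
  have "lc_zero_nbhd {0<..} X U"
    unfolding lc_zero_nbhd_def
  proof (intro conjI ballI)
    show "abs_convex U"
      unfolding abs_convex_def
    proof (intro ballI allI impI)
      fix x y a b assume "x \<in> U" "y \<in> U" "cmod a + cmod b \<le> 1"
      then show "(\<lambda>k. a * x k + b * y k) \<in> U"
        unfolding U_def abs_convex_def by blast
    qed
    fix r :: real assume "r \<in> {0<..}"
    then have "r > 0" by simp
    from R(3)[OF this] obtain n where n: "\<forall>k. W (R n) k \<le> W r k"
      by blast
    let ?O = "{y \<in> ell p (W r). \<exists>e'<\<epsilon> n. wbound (W r) (\<lambda>k. y k - 0) e'}"
    have "openin (X r) ?O"
      unfolding X_def by (rule sup_ball_open[OF p])
    moreover have "(\<lambda>_. 0) \<in> ?O"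
      using p \<epsilon>(1)[of n] by (auto simp: wbound_def intro!: exI[of _ 0])
    moreover have "?O \<subseteq> U"
    proof -
      have "?O \<subseteq> G"
      proof
        fix y assume "y \<in> ?O"
        then obtain e' where "e' < \<epsilon> n" "wbound (W r) y e'" by auto
        then have "wbound (W (R n)) y (\<epsilon> n)"
          using n wbound_mono wbound_weight_mono by (metis less_imp_le)
        then show "y \<in> G" by (auto simp: G_def)
      qed
      then show ?thesis by (auto simp: U_def)
    qed
    ultimately show "\<exists>O'. openin (X r) O' \<and> (\<lambda>_. 0) \<in> O' \<and> O' \<subseteq> U"
      by blast
  qed
  then show ?thesis
    using UU that by blast
qed

text \<open>Any two elements lie in a common step along the sequence \<open>R\<close>, where their
  product is defined. Continuity at an arbitrary pair is reduced by bilinearity to boundedness near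
  0, since neighbourhoods of 0 absorb single elements.\<close>

lemma ind_lim_extension:
  fixes p :: ennreal and W :: "real \<Rightarrow> ('d::finite) weight" and R :: "nat \<Rightarrow> real"
  defines "X \<equiv> \<lambda>r. ell_top p (W r)"
  defines "Y \<equiv> ind_lim {0<..} X"
  assumes p: "p > 0" and adm: "\<And>r. r > 0 \<Longrightarrow> \<exists>r'>0. admissible (W r) (W r')"
    and R: "\<And>n. R n > 0" "\<And>n k. W (R (Suc n)) k \<le> W (R n) k" "\<And>r. r > 0 \<Longrightarrow> \<exists>n. \<forall>k. W (R n) k \<le> W r k"
    and one: "\<And>r. r > 0 \<Longrightarrow> W r 0 = 1"
    and nz: "\<And>r k. r > 0 \<Longrightarrow> W r k \<noteq> 0"
    and fin: "\<And>K. finite K \<Longrightarrow> \<exists>r>0. \<forall>k\<in>K. W r k \<noteq> \<infinity>"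
  shows "uniquely_extends (prod_topology Y Y) Y (A_fin \<times> A_fin) (\<lambda>(a, b). twisted_aw a b)"
proof -
  have zero: "(\<lambda>_. 0) \<in> topspace (X r)" for r
    using p by (simp add: X_def)
  have topY: "topspace Y = (\<Union>r\<in>{0<..}. ell p (W r))"
    unfolding Y_def topspace_ind_lim[OF zero] by (simp add: X_def)
  have into: "continuous_map (X r) Y (\<lambda>x. x)" if "r > 0" for r
    unfolding Y_def using that zero ell_translation_continuous[OF p]
    by (intro continuous_map_into_ind_lim) (auto simp: X_def)
  have mono: "W (R n) k \<le> W (R m) k" if "m \<le> n" for m n k
    using that R(2) by (rule lift_Suc_antimono_le[of "\<lambda>n. W (R n) k", rotated])
  have ell_mono: "x \<in> ell p (W (R n))" if "x \<in> ell p (W r)" "\<And>k. W (R n) k \<le> W r k" for x r n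
  proof -
    have "weighted_norm p (W (R n)) x \<le> weighted_norm p (W r) x"
      using that(2) by (intro weighted_norm_mono mult_left_mono) auto
    then show ?thesis
      using that(1) unfolding ell_def mem_Collect_eq by (rule le_less_trans)
  qed
  have step: "\<exists>n. x \<in> ell p (W (R n))" if x: "x \<in> topspace Y" for x
  proof -
    obtain r where r: "r > 0" "x \<in> ell p (W r)"
      using x by (auto simp: topY)
    from R(3)[OF r(1)] obtain n where "\<forall>k. W (R n) k \<le> W r k"
      by blast
    then show ?thesis
      using ell_mono[OF r(2), of n] by blast
  qed
  have common: "\<exists>n. x \<in> ell p (W (R n)) \<and> y \<in> ell p (W (R n))" if xy: "x \<in> topspace Y" "y \<in> topspace Y" for x y
  proof -
    obtain n m where n: "x \<in> ell p (W (R n))" and m: "y \<in> ell p (W (R m))"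
      using step[OF xy(1)] step[OF xy(2)] by blast
    have "x \<in> ell p (W (R (max n m)))" "y \<in> ell p (W (R (max n m)))"
      by (auto intro: ell_mono[OF n mono] ell_mono[OF m mono])
    then show ?thesis by blast
  qed
  have step_in: "x \<in> topspace Y" if "r > 0" "x \<in> ell p (W r)" for x r
    using that by (auto simp: topY)
  have lin: "(\<lambda>k. a * x k + b * y k) \<in> topspace Y" if xy: "x \<in> topspace Y" "y \<in> topspace Y" for x y a b
  proof -
    from common[OF xy] obtain n where n: "x \<in> ell p (W (R n))" "y \<in> ell p (W (R n))"
      by blast
    show ?thesis
      by (rule step_in[OF R(1) ell_add_mem[OF p ell_cmult_mem[OF p n(1)] ell_cmult_mem[OF p n(2)]]])
  qed
  have diff: "(\<lambda>k. x k - y k) \<in> topspace Y" if xy: "x \<in> topspace Y" "y \<in> topspace Y" for x y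
    using lin[OF xy, of 1 "-1"] by simp
  have prod: "aw_prod x y \<in> topspace Y \<and> (\<forall>k. aw_term x y summable_on aw_fibre k)"
    if xy: "x \<in> topspace Y" "y \<in> topspace Y" for x y
  proof -
    from common[OF xy] obtain n where n: "x \<in> ell p (W (R n))" "y \<in> ell p (W (R n))"
      by blast
    obtain N M where b: "wbound (W (R n)) x N" "wbound (W (R n)) y M"
      using wbound_ell[OF p n(1)] wbound_ell[OF p n(2)] by metis
    from adm[OF R(1)] obtain r' where r': "r' > 0" "admissible (W (R n)) (W r')"
      by blast
    obtain K where K: "K \<ge> 0" "\<And>c d N M. wbound (W (R n)) c N \<Longrightarrow> wbound (W (R n)) d M \<Longrightarrow> weighted_norm p (W r') (aw_prod c d) \<le> ennreal (K * (N * M))"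
      using admissible_norm_bound[OF r'(2) p] by blast
    have "aw_prod x y \<in> ell p (W r')"
      using le_less_trans[OF K(2)[OF b] ennreal_less_top] by (simp add: ell_def)
    then show ?thesis
      using step_in[OF r'(1)] admissible_summable[OF r'(2) b nz[OF r'(1)]] by blast
  qed
  have absorb: "\<exists>t>0. t \<le> 1 \<and> (\<lambda>k. of_real t * x k) \<in> U" if U: "lc_zero_nbhd {0<..} X U" and x: "x \<in> topspace Y" for x U
  proof -
    obtain r where r: "r > 0" "x \<in> ell p (W r)"
      using x by (auto simp: topY)
    then obtain O' where O': "openin (ell_top p (W r)) O'" "(\<lambda>_. 0) \<in> O'" "O' \<subseteq> U"
      using U by (auto simp: lc_zero_nbhd_def X_def)
    obtain t :: real where "0 < t" "t \<le> 1" "(\<lambda>k. of_real t * x k) \<in> O'"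
      using ell_absorb[OF p O'(1,2) r(2)] .
    then show ?thesis
      using O'(3) by blast
  qed
  have cont: "continuous_map (prod_topology Y Y) Y (\<lambda>(x, y). aw_prod x y)"
    unfolding continuous_map
  proof (intro conjI allI impI)
    show "(\<lambda>(x, y). aw_prod x y) ` topspace (prod_topology Y Y) \<subseteq> topspace Y"
      using prod by auto
    fix S assume S: "openin Y S"
    show "openin (prod_topology Y Y) {x \<in> topspace (prod_topology Y Y). (case x of (x, y) \<Rightarrow> aw_prod x y) \<in> S}"
      unfolding openin_prod_topology_alt
    proof (intro allI impI)
      fix x0 y0 assume "(x0, y0) \<in> {x \<in> topspace (prod_topology Y Y). (case x of (x, y) \<Rightarrow> aw_prod x y) \<in> S}"
      then have 0: "x0 \<in> topspace Y" "y0 \<in> topspace Y" "aw_prod x0 y0 \<in> S"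
        by auto
      obtain V where V: "lc_zero_nbhd {0<..} X V" "\<And>y. y \<in> topspace Y \<Longrightarrow> (\<lambda>k. y k - aw_prod x0 y0 k) \<in> V \<Longrightarrow> y \<in> S"
        using S 0(3) unfolding Y_def openin_ind_lim topspace_ind_lim[OF zero] by blast
      \<comment> \<open>The increment of the product is the sum of \<open>aw_prod x0 g\<close>,
        \<open>aw_prod h y0\<close> and \<open>aw_prod h g\<close>, each of which has to lie in a
        third of \<open>V\<close>.\<close>
      define V3 where "V3 = {v. (\<lambda>k. 3 * v k) \<in> V}"
      have V3: "lc_zero_nbhd {0<..} X V3"
        unfolding V3_def X_def by (rule lc_zero_nbhd_scale[OF V(1)[unfolded X_def] p])
      obtain U where U: "lc_zero_nbhd {0<..} X U" "\<And>x y. x \<in> U \<Longrightarrow> y \<in> U \<Longrightarrow> aw_prod x y \<in> V3"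
        using aw_prod_ind_lim_bounded[OF p adm R nz V3[unfolded X_def]] unfolding X_def by blast
      have conv: "abs_convex U" "abs_convex V3" "abs_convex V"
        using U(1) V3 V(1) by (auto simp: lc_zero_nbhd_def)
      obtain t1 t2 where t12: "0 < t1" "t1 \<le> 1" "(\<lambda>k. of_real t1 * x0 k) \<in> U" "0 < t2" "t2 \<le> 1" "(\<lambda>k. of_real t2 * y0 k) \<in> U"
        using absorb[OF U(1) 0(1)] absorb[OF U(1) 0(2)] by blast
      define t where "t = min t1 t2"
      have t0: "0 < t"
        using t12 by (simp add: t_def)
      have shrink: "(\<lambda>k. of_real t * z k) \<in> U" if "(\<lambda>k. of_real u * z k) \<in> U" "0 < u" "t \<le> u" for u :: real and z
      proof -
        have "\<bar>t / u\<bar> \<le> 1"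
          using t0 that by (subst abs_of_nonneg) auto
        then have "cmod (of_real (t / u)) \<le> 1"
          by (simp only: norm_of_real)
        from abs_convex_scale[OF conv(1) that(1) this] show ?thesis
          using that(2) by simp
      qed
      have t: "0 < t" "t \<le> 1" "(\<lambda>k. of_real t * x0 k) \<in> U" "(\<lambda>k. of_real t * y0 k) \<in> U"
        using t12 shrink[OF t12(3)] shrink[OF t12(6)] by (auto simp: t_def)
      \<comment> \<open>The increments are confined to \<open>t\<close> times \<open>U\<close>. In
        the mixed terms the fixed factor is scaled by \<open>t\<close> and the increment by
        \<open>c\<close>, which leaves the product unchanged and puts both factors into
        \<open>U\<close>.\<close>
      define c where "c = complex_of_real (1 / t)"
      have ct: "of_real t * (c * w) = w" "c * (of_real t * w) = w" for w
        using t0 by (simp_all add: c_def)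
      define Ut where "Ut = {v. (\<lambda>k. c * v k) \<in> U}"
      have Ut: "lc_zero_nbhd {0<..} X Ut"
        unfolding Ut_def X_def by (rule lc_zero_nbhd_scale[OF U(1)[unfolded X_def] p])
      have nbhd: "\<exists>N. openin Y N \<and> x \<in> N \<and> (\<forall>y\<in>N. (\<lambda>k. y k - x k) \<in> Ut)" if "x \<in> topspace Y" for x
      proof -
        have x: "x \<in> (\<Union>r\<in>{0<..}. ell p (W r))"
          using that by (simp only: topY)
        show ?thesis
          unfolding Y_def X_def by (rule ind_lim_nbhd[OF Ut[unfolded X_def] p x]) blast
      qed
      obtain N1 N2 where N1: "openin Y N1" "x0 \<in> N1" "\<forall>x\<in>N1. (\<lambda>k. x k - x0 k) \<in> Ut"
        and N2: "openin Y N2" "y0 \<in> N2" "\<forall>y\<in>N2. (\<lambda>k. y k - y0 k) \<in> Ut"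
        using nbhd[OF 0(1)] nbhd[OF 0(2)] by blast
      have "aw_prod x y \<in> S" if xy: "x \<in> N1" "y \<in> N2" for x y
      proof -
        have tops: "x \<in> topspace Y" "y \<in> topspace Y"
          using xy N1(1) N2(1) openin_subset by blast+
        define h where "h = (\<lambda>k. x k - x0 k)"
        define g where "g = (\<lambda>k. y k - y0 k)"
        have hg: "h \<in> topspace Y" "g \<in> topspace Y"
          using diff tops 0 by (auto simp: h_def g_def)
        have x_eq: "x = (\<lambda>k. 1 * x0 k + 1 * h k)" and y_eq: "y = (\<lambda>k. 1 * y0 k + 1 * g k)"
          by (auto simp: h_def g_def)
        have "aw_prod x y k = aw_prod x0 y k + aw_prod h y k" for k
          using aw_prod_linear_left[of x0 y k h 1 1] prod[OF 0(1) tops(2)] prod[OF hg(1) tops(2)] x_eq by simp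
        moreover have "aw_prod x0 y k = aw_prod x0 y0 k + aw_prod x0 g k" for k
          using aw_prod_linear_right[of x0 y0 k g 1 1] prod[OF 0(1,2)] prod[OF 0(1) hg(2)] y_eq by simp
        moreover have "aw_prod h y k = aw_prod h y0 k + aw_prod h g k" for k
          using aw_prod_linear_right[of h y0 k g 1 1] prod[OF hg(1) 0(2)] prod[OF hg] y_eq by simp
        ultimately have split: "(\<lambda>k. aw_prod x y k - aw_prod x0 y0 k) = (\<lambda>k. aw_prod x0 g k + aw_prod h y0 k + aw_prod h g k)"
          by (simp add: fun_eq_iff)
        define h' where "h' = (\<lambda>k. c * h k)"
        define g' where "g' = (\<lambda>k. c * g k)"
        have hg': "h' \<in> U" "g' \<in> U"
          using bspec[OF N1(3) xy(1)] bspec[OF N2(3) xy(2)] by (auto simp: Ut_def h_def g_def h'_def g'_def)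
        have left: "aw_prod (\<lambda>k. a * u k) v = (\<lambda>k. a * aw_prod u v k)" if "u \<in> topspace Y" "v \<in> topspace Y" for a u v
          using aw_prod_linear_left[of u v _ u a 0] prod[OF that] by (simp add: fun_eq_iff)
        have right: "aw_prod u (\<lambda>k. a * v k) = (\<lambda>k. a * aw_prod u v k)" if "u \<in> topspace Y" "v \<in> topspace Y" for a u v
          using aw_prod_linear_right[of u v _ v a 0] prod[OF that] by (simp add: fun_eq_iff)
        have scaled: "(\<lambda>k. a * z k) \<in> topspace Y" if "z \<in> topspace Y" for a z
          using lin[OF that that, of a 0] by simp
        have "aw_prod (\<lambda>k. of_real t * x0 k) g' = aw_prod x0 g"
          using 0 hg by (simp add: g'_def left right scaled ct)
        then have 1: "aw_prod x0 g \<in> V3"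
          using U(2)[OF t(3) hg'(2)] by simp
        have "aw_prod h' (\<lambda>k. of_real t * y0 k) = aw_prod h y0"
          using 0 hg by (simp add: h'_def left right scaled ct)
        then have 2: "aw_prod h y0 \<in> V3"
          using U(2)[OF hg'(1) t(4)] by simp
        \<comment> \<open>The quadratic term keeps the factor \<open>t * t \<le> 1\<close>, under
          which absolutely convex sets are stable.\<close>
        have "aw_prod h g = (\<lambda>k. of_real (t * t) * aw_prod h' g' k)"
          using hg by (simp add: h'_def g'_def left right scaled ct mult.assoc)
        moreover have "cmod (of_real (t * t)) \<le> 1"
          using t(1,2) by (simp only: norm_of_real) (simp add: abs_mult mult_le_one)
        ultimately have 3: "aw_prod h g \<in> V3"
          using abs_convex_scale[OF conv(2) U(2)[OF hg']] by metis
        have "(\<lambda>k. aw_prod x y k - aw_prod x0 y0 k) \<in> V"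
          unfolding split using 1 2 3 by (intro abs_convex_sum3[OF conv(3)]) (auto simp: V3_def)
        then show ?thesis
          using V(2) prod[OF tops] by blast
      qed
      then have "N1 \<times> N2 \<subseteq> {x \<in> topspace (prod_topology Y Y). (case x of (x, y) \<Rightarrow> aw_prod x y) \<in> S}"
        using openin_subset[OF N1(1)] openin_subset[OF N2(1)] by auto
      then show "\<exists>A B. openin Y A \<and> openin Y B \<and> x0 \<in> A \<and> y0 \<in> B \<and> A \<times> B \<subseteq> {x \<in> topspace (prod_topology Y Y). (case x of (x, y) \<Rightarrow> aw_prod x y) \<in> S}"
        using N1(1,2) N2(1,2) by blast
    qed
  qed
  have lim: "limitin Y (\<lambda>n. truncate n x) x sequentially" if x: "x \<in> topspace Y" for x
  proof -
    obtain r where r: "r > 0" "x \<in> ell p (W r)"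
      using x by (auto simp: topY)
    from adm[OF r(1)] obtain r' where r': "r' > 0" "admissible (W r) (W r')"
      by blast
    have "limitin (X r') (\<lambda>n. truncate n x) x sequentially"
      unfolding X_def by (rule truncate_limit(2)[OF r'(2) one[OF r(1)] p r(2)])
    from continuous_map_limit[OF into[OF r'(1)] this]
    show ?thesis by (simp add: o_def)
  qed
  show ?thesis
  proof (rule uniquely_extendsI)
    show "A_fin \<times> A_fin \<subseteq> topspace (prod_topology Y Y)"
    proof -
      have "a \<in> topspace Y" if a: "a \<in> A_fin" for a
      proof -
        have "finite {k. a k \<noteq> 0}" using a by (simp add: A_fin_def)
        from fin[OF this] obtain r where r: "r > 0" "\<And>k. a k \<noteq> 0 \<Longrightarrow> W r k \<noteq> \<infinity>"
          by blast
        show ?thesis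
          by (rule step_in[OF r(1) A_fin_in_ell[OF p a r(2)]])
      qed
      then show ?thesis by auto
    qed
    fix x assume "x \<in> topspace (prod_topology Y Y)"
    then obtain y z where x: "x = (y, z)" "y \<in> topspace Y" "z \<in> topspace Y"
      by auto
    then show "\<exists>u::nat \<Rightarrow> _. (\<forall>n. u n \<in> A_fin \<times> A_fin) \<and> limitin (prod_topology Y Y) u x sequentially"
      using limitin_truncate_pair[OF lim[OF x(2)] lim[OF x(3)]]
      by (intro exI[of _ "\<lambda>n. (truncate n y, truncate n z)"]) (simp add: x(1) truncate_A_fin)
  next
    fix k
    show "continuous_map Y euclidean (\<lambda>y. y k)"
      unfolding Y_def
    proof (rule ind_lim_coord_continuous[OF zero])
      fix r :: real assume "r \<in> {0<..}"
      then show "continuous_map (X r) euclidean (\<lambda>y. y k)"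
        unfolding X_def using nz by (intro ell_coord_continuous[OF p]) auto
    qed
  qed (rule cont, rule twisted_pair_eq)
qed

section \<open>The weights\<close>

lemma mi_abs_add: "mi_abs (\<alpha> + \<beta>) = mi_abs \<alpha> + mi_abs \<beta>"
  by (simp add: mi_abs_def sum.distrib)

lemma mi_abs_zero [simp]: "mi_abs 0 = 0"
  by (simp add: mi_abs_def)

lemma theta_zero [simp]: "r > 0 \<Longrightarrow> theta r s 0 = 1"
  by (cases s) (auto simp: mi_fact_def)

lemma theta_nonzero [simp]: "r > 0 \<Longrightarrow> theta r s \<alpha> \<noteq> 0"
  by (cases s) (auto simp: mult_le_0_iff not_le)

lemma theta_finite: "s \<noteq> Num 0 \<Longrightarrow> theta r s \<alpha> \<noteq> \<infinity>"
  by (cases s) auto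

lemma theta_mono:
  assumes "s \<noteq> Num 0" "0 < r" "r \<le> r'"
  shows "theta r s \<alpha> \<le> theta r' s \<alpha>"
proof (cases s)
  case (Num x)
  then show ?thesis
    using assms by (auto intro!: ennreal_leI mult_right_mono)
next
  case (Flat \<sigma>)
  then show ?thesis
    using assms by (auto intro!: ennreal_leI mult_right_mono power_mono)
qed

lemma theta_antimono: "r \<le> r' \<Longrightarrow> theta r' (Num 0) \<alpha> \<le> theta r (Num 0) \<alpha>"
  by auto

text \<open>The weight increases with the parameter except at \<open>s = 0\<close>, where it
  decreases; accordingly the minimum or the maximum of the two is taken.\<close>

lemma theta_common_weaker:
  assumes "r > 0" "r' > 0"
  shows "\<exists>t>0. \<forall>\<alpha>. theta t s \<alpha> \<le> theta r s \<alpha> \<and> theta t s \<alpha> \<le> theta r' s \<alpha>"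
proof (cases "s = Num 0")
  case True
  show ?thesis
    unfolding True using assms
    by (intro exI[of _ "max r r'"] conjI allI theta_antimono) (auto simp: less_max_iff_disj)
next
  case False
  then show ?thesis
    using assms by (intro exI[of _ "min r r'"] conjI allI theta_mono) auto
qed

text \<open>This places finitely supported symbols in a step. At \<open>s = 0\<close> the weight is
  infinite above the order \<open>r\<close>, so the parameter has to exceed all orders in
  \<open>K\<close>.\<close>

lemma theta_finite_on:
  assumes "finite K"
  shows "\<exists>r>0. \<forall>\<alpha>\<in>K. theta r s \<alpha> \<noteq> \<infinity>"
proof (cases "s = Num 0")
  case True
  define r where "r = 1 + real (\<Sum>\<alpha>\<in>K. mi_abs \<alpha>)"
  have "real (mi_abs \<alpha>) \<le> r" if "\<alpha> \<in> K" for \<alpha>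
  proof -
    have "mi_abs \<alpha> \<le> (\<Sum>\<alpha>\<in>K. mi_abs \<alpha>)"
      using that assms by (intro member_le_sum) auto
    then have "real (mi_abs \<alpha>) \<le> real (\<Sum>\<alpha>\<in>K. mi_abs \<alpha>)"
      by (rule of_nat_mono)
    then show ?thesis by (simp add: r_def del: of_nat_sum)
  qed
  moreover have "r > 0"
    unfolding r_def by (intro add_pos_nonneg of_nat_0_le_iff) simp
  ultimately show ?thesis
    using True by (intro exI[of _ r]) auto
next
  case False
  then show ?thesis
    using theta_finite by (intro exI[of _ 1]) auto
qed

text \<open>\<open>theta r\<close> dominates \<open>theta r'\<close> with room for exponential factors, up to splitting
  and merging of multi-indices.\<close>

definition absorbs :: "('d::finite) itself \<Rightarrow> flat_index \<Rightarrow> real \<Rightarrow> real \<Rightarrow> bool" where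
  "absorbs _ s r r' \<longleftrightarrow> (\<exists>C\<ge>1::real. \<forall>\<alpha> \<beta> :: 'd mindex.
     theta r' s (\<alpha> + \<beta>) * 8 ^ (mi_abs \<alpha> + mi_abs \<beta>) \<le> ennreal C * (theta r s \<alpha> * theta r s \<beta>) \<and>
     theta r' s \<alpha> * theta r' s \<beta> * 8 ^ (mi_abs \<alpha> + mi_abs \<beta>) \<le> ennreal C * theta r s (\<alpha> + \<beta>) \<and>
     8 ^ mi_abs \<alpha> \<le> ennreal C * theta r s \<alpha>)"

lemma eight_power_ennreal: "(8 :: ennreal) ^ n = ennreal (8 ^ n)"
  by (simp add: ennreal_power[symmetric])

lemma le_mult_eight_power: "x \<le> x * 8 ^ n" for x :: ennreal
  using mult_left_mono[of 1 "8 ^ n :: ennreal" x] by (simp add: eight_power_ennreal)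

text \<open>Where the right sides are finite, all orders are at most \<open>r\<close> and a sum of
  two indices has order at most \<open>2 * r\<close>. There the weight of parameter
  \<open>2 * r\<close> is 1 and the exponential factor is bounded by
  \<open>8 powr (2 * r)\<close>.\<close>

lemma absorbs_zero:
  assumes "r > 0"
  shows "absorbs TYPE('d::finite) (Num 0) r (2 * r)"
  unfolding absorbs_def
proof (intro exI conjI allI)
  define C :: real where "C = 8 powr (2 * r)"
  show C: "C \<ge> 1"
    using assms by (simp add: C_def ge_one_powr_ge_zero)
  have pow: "(8 :: ennreal) ^ n \<le> ennreal C" if "real n \<le> 2 * r" for n
  proof -
    have "(8 :: real) ^ n = 8 powr real n"
      by (simp add: powr_realpow)
    also have "\<dots> \<le> C"
      using that by (simp add: C_def)
    finally show ?thesis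
      by (simp add: eight_power_ennreal ennreal_leI)
  qed
  fix \<alpha> \<beta> :: "'d mindex"
  show "theta (2 * r) (Num 0) (\<alpha> + \<beta>) * 8 ^ (mi_abs \<alpha> + mi_abs \<beta>) \<le> ennreal C * (theta r (Num 0) \<alpha> * theta r (Num 0) \<beta>)"
    using C pow[of "mi_abs \<alpha> + mi_abs \<beta>"] by (auto simp: mi_abs_add ennreal_mult_top)
  show "theta (2 * r) (Num 0) \<alpha> * theta (2 * r) (Num 0) \<beta> * 8 ^ (mi_abs \<alpha> + mi_abs \<beta>) \<le> ennreal C * theta r (Num 0) (\<alpha> + \<beta>)"
    using C pow[of "mi_abs \<alpha> + mi_abs \<beta>"] assms by (auto simp: mi_abs_add ennreal_mult_top)
  show "8 ^ mi_abs \<alpha> \<le> ennreal C * theta r (Num 0) \<alpha>"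
    using C pow[of "mi_abs \<alpha>"] assms by (auto simp: ennreal_mult_top)
qed

text \<open>The inequality \<open>(a + b) powr q \<le> 2 powr q * (a powr q + b powr q)\<close>
  costs one factor \<open>2 powr q\<close>; the further factor 2 reserves half of \<open>r\<close>
  for the linear exponent \<open>n * ln 8\<close>. How that half suffices is left to the assumption
  on \<open>c\<close>, the only place where \<open>s < 1/2\<close> and \<open>s = 1/2\<close>
  differ.\<close>

lemma absorbs_Num:
  assumes x: "0 < x" "x \<le> 1/2" and q: "q = 1 / (2 * x)" and r': "0 < r'" "2 powr (q + 1) * r' \<le> r"
    and c: "c \<ge> 0" "\<And>n::nat. real n * ln 8 \<le> c + r / 2 * real n powr q"
  shows "absorbs TYPE('d::finite) (Num x) r r'"
  unfolding absorbs_def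
proof (intro exI conjI allI)
  have q1: "q \<ge> 1"
    using x by (simp add: q field_simps)
  have p4: "2 powr (q + 1) \<ge> 4"
    using powr_mono[of 2 "q + 1" 2] q1 by simp
  have r4: "4 * r' \<le> r"
    using mult_right_mono[OF p4, of r'] r' by linarith
  have r2: "2 powr q * r' \<le> r / 2"
    using r' by (simp add: powr_add)
  have eight: "(8 :: ennreal) ^ n = ennreal (exp (real n * ln 8))" for n
    by (simp add: eight_power_ennreal exp_of_nat_mult)
  have th: "theta t (Num x) \<alpha> = ennreal (exp (t * real (mi_abs \<alpha>) powr q))" for t and \<alpha> :: "'d mindex"
    using x by (simp add: q)
  \<comment> \<open>Twice \<open>c\<close>, because the linear exponent is bounded separately for
    \<alpha> and for \<beta>.\<close>
  show "exp (2 * c) \<ge> 1"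
    using c by simp
  fix \<alpha> \<beta> :: "'d mindex"
  define a b where "a = mi_abs \<alpha>" and "b = mi_abs \<beta>"
  have up: "real (a + b) powr q \<le> 2 powr q * (real a powr q + real b powr q)"
  proof -
    define m where "m = max a b"
    have "real (a + b) powr q \<le> (2 * real m) powr q"
      using q1 by (intro powr_mono2) (auto simp: m_def)
    also have "\<dots> = 2 powr q * real m powr q"
      by (simp add: powr_mult)
    also have "\<dots> \<le> 2 powr q * (real a powr q + real b powr q)"
      by (intro mult_left_mono) (auto simp: m_def max_def)
    finally show ?thesis .
  qed
  have down: "real a powr q \<le> real (a + b) powr q" "real b powr q \<le> real (a + b) powr q"
    using q1 by (auto intro!: powr_mono2)
  have "r' * real (a + b) powr q \<le> r' * (2 powr q * (real a powr q + real b powr q))"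
    using up r' by (intro mult_left_mono) auto
  also have "\<dots> = (2 powr q * r') * (real a powr q + real b powr q)"
    by (simp add: mult_ac)
  also have "\<dots> \<le> r / 2 * (real a powr q + real b powr q)"
    using r2 by (intro mult_right_mono) auto
  finally have "r' * real (a + b) powr q + real (a + b) * ln 8 \<le> 2 * c + (r * real a powr q + r * real b powr q)"
    using c(2)[of a] c(2)[of b] by (simp add: algebra_simps)
  then show "theta r' (Num x) (\<alpha> + \<beta>) * 8 ^ (mi_abs \<alpha> + mi_abs \<beta>) \<le> ennreal (exp (2 * c)) * (theta r (Num x) \<alpha> * theta r (Num x) \<beta>)"
    unfolding th eight by (simp add: ennreal_mult[symmetric] exp_add[symmetric] mi_abs_add a_def b_def)
  have "r' * real a powr q \<le> r / 4 * real (a + b) powr q" "r' * real b powr q \<le> r / 4 * real (a + b) powr q"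
    by (intro mult_mono down; use r4 r' in simp)+
  then have "r' * real a powr q + r' * real b powr q + real (a + b) * ln 8 \<le> 2 * c + r * real (a + b) powr q"
    using c(2)[of "a + b"] c(1) by (simp add: algebra_simps)
  then show "theta r' (Num x) \<alpha> * theta r' (Num x) \<beta> * 8 ^ (mi_abs \<alpha> + mi_abs \<beta>) \<le> ennreal (exp (2 * c)) * theta r (Num x) (\<alpha> + \<beta>)"
    unfolding th eight by (simp add: ennreal_mult[symmetric] exp_add[symmetric] mi_abs_add a_def b_def)
  have "r / 2 * real a powr q \<le> r * real a powr q"
    using r4 r' by (intro mult_right_mono) auto
  then have "real a * ln 8 \<le> 2 * c + r * real a powr q"
    using c(2)[of a] c(1) by linarith
  then show "8 ^ mi_abs \<alpha> \<le> ennreal (exp (2 * c)) * theta r (Num x) \<alpha>"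
    unfolding th eight by (simp add: ennreal_mult[symmetric] exp_add[symmetric] a_def)
qed

text \<open>The factorial of a sum is at most \<open>2 ^ (a + b)\<close> times the product of the
  factorials, and raising this to the power \<open>1 / (2 * \<sigma>)\<close> gives the second
  factor of the constant; the first is the exponential to be absorbed.\<close>

lemma absorbs_Flat:
  assumes \<sigma>: "\<sigma> > 0" and r': "0 < r'" "8 * 2 powr (1 / (2 * \<sigma>)) * r' \<le> r"
  shows "absorbs TYPE('d::finite) (Flat \<sigma>) r r'"
  unfolding absorbs_def
proof (intro exI conjI allI)
  define \<kappa> where "\<kappa> = 1 / (2 * \<sigma>)"
  have \<kappa>: "\<kappa> > 0" using \<sigma> by (simp add: \<kappa>_def)
  have two: "2 powr \<kappa> \<ge> 1"
    using \<kappa> by (simp add: ge_one_powr_ge_zero)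
  have "8 * 2 powr \<kappa> * r' \<le> r"
    using r' by (simp add: \<kappa>_def)
  then have r8: "8 * r' \<le> r"
    using r'(1) order_trans[OF mult_left_mono[OF two, of "8 * r'"], of r] by (simp add: mult_ac del: mult_le_cancel_left1 mult_le_cancel_left_pos)
  have r: "r > 0" using r8 r' by linarith
  have th: "theta t (Flat \<sigma>) \<alpha> = ennreal (t ^ mi_abs \<alpha> * mi_fact \<alpha> powr \<kappa>)" for t and \<alpha> :: "'d mindex"
    by (simp add: \<kappa>_def)
  \<comment> \<open>Chosen so that \<open>y powr \<kappa> = 8 / r\<close>; then
    \<open>y ^ n \<le> exp y * fact n\<close>, raised to the power \<kappa>, bounds
    \<open>8 ^ n\<close> by the weight.\<close>
  define y where "y = (8 / r) powr (1 / \<kappa>)"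
  define c where "c = max 1 (exp y powr \<kappa>)"
  have y: "y > 0" using r by (simp add: y_def)
  have fac: "8 ^ n \<le> c * (r ^ n * fact n powr \<kappa>)" for n
  proof -
    have "y ^ n \<le> exp y * fact n"
      using sum_le_suminf[OF summable_exp_generic[of y], of "{n}"] y
      by (simp add: exp_def field_simps)
    then have "(y ^ n) powr \<kappa> \<le> (exp y * fact n) powr \<kappa>"
      using y \<kappa> by (intro powr_mono2) auto
    also have "\<dots> = exp y powr \<kappa> * fact n powr \<kappa>"
      by (simp add: powr_mult)
    also have "\<dots> \<le> c * fact n powr \<kappa>"
      by (intro mult_right_mono) (auto simp: c_def)
    also have "(y ^ n) powr \<kappa> = (8 / r) ^ n"
      using y r \<kappa> by (simp add: y_def powr_realpow[symmetric] powr_powr del: powr_realpow)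
    finally show ?thesis
      using r by (simp add: power_divide field_simps)
  qed
  \<comment> \<open>The one-dimensional bound is used once per coordinate.\<close>
  define C where "C = c ^ CARD('d)"
  show C: "C \<ge> 1"
    by (simp add: C_def c_def)
  fix \<alpha> \<beta> :: "'d mindex"
  define a b where "a = mi_abs \<alpha>" and "b = mi_abs \<beta>"
  have pos: "mi_fact \<alpha> powr \<kappa> \<ge> 0" "mi_fact \<beta> powr \<kappa> \<ge> 0" "mi_fact (\<alpha> + \<beta>) powr \<kappa> \<ge> 0"
    by auto
  have "mi_fact (\<alpha> + \<beta>) \<le> 2 ^ (a + b) * (mi_fact \<alpha> * mi_fact \<beta>)"
    using mi_binom_le[of \<alpha> \<beta>] by (simp add: mi_binom_def field_simps a_def b_def)
  then have "mi_fact (\<alpha> + \<beta>) powr \<kappa> \<le> (2 ^ (a + b) * (mi_fact \<alpha> * mi_fact \<beta>)) powr \<kappa>"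
    using \<kappa> by (intro powr_mono2) (auto simp: less_imp_le)
  also have "\<dots> = (2 powr \<kappa>) ^ (a + b) * (mi_fact \<alpha> powr \<kappa> * mi_fact \<beta> powr \<kappa>)"
    by (simp add: powr_mult less_imp_le powr_power powr_realpow[symmetric] powr_powr mult.commute)
  finally have "r' ^ (a + b) * 8 ^ (a + b) * mi_fact (\<alpha> + \<beta>) powr \<kappa> \<le>
      r' ^ (a + b) * 8 ^ (a + b) * ((2 powr \<kappa>) ^ (a + b) * (mi_fact \<alpha> powr \<kappa> * mi_fact \<beta> powr \<kappa>))"
    using r' by (intro mult_left_mono) auto
  also have "\<dots> = (8 * 2 powr \<kappa> * r') ^ (a + b) * (mi_fact \<alpha> powr \<kappa> * mi_fact \<beta> powr \<kappa>)"
    by (simp add: power_mult_distrib mult_ac)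
  also have "\<dots> \<le> r ^ (a + b) * (mi_fact \<alpha> powr \<kappa> * mi_fact \<beta> powr \<kappa>)"
    using r' by (intro mult_right_mono power_mono) (auto simp: \<kappa>_def)
  also have "\<dots> \<le> C * (r ^ (a + b) * (mi_fact \<alpha> powr \<kappa> * mi_fact \<beta> powr \<kappa>))"
    using C r mult_right_mono[OF C, of "r ^ (a + b) * (mi_fact \<alpha> powr \<kappa> * mi_fact \<beta> powr \<kappa>)"] by simp
  finally show "theta r' (Flat \<sigma>) (\<alpha> + \<beta>) * 8 ^ (mi_abs \<alpha> + mi_abs \<beta>) \<le> ennreal C * (theta r (Flat \<sigma>) \<alpha> * theta r (Flat \<sigma>) \<beta>)"
    unfolding th eight_power_ennreal using r r' C
    by (simp add: ennreal_mult[symmetric] mi_abs_add a_def b_def power_add mult_ac)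
  have "mi_fact \<alpha> * mi_fact \<beta> \<le> mi_fact (\<alpha> + \<beta>)"
  proof -
    have "mi_fact \<alpha> * mi_fact \<beta> = (\<Prod>i\<in>UNIV. fact (\<alpha> $ i) * fact (\<beta> $ i))"
      by (simp add: mi_fact_def prod.distrib)
    also have "\<dots> \<le> mi_fact (\<alpha> + \<beta>)"
      unfolding mi_fact_def
    proof (intro prod_mono conjI)
      fix i
      have "fact (\<alpha> $ i) * fact (\<beta> $ i) \<le> (fact (\<alpha> $ i + \<beta> $ i) :: nat)"
        by (intro dvd_imp_le fact_fact_dvd_fact) simp
      then have "real (fact (\<alpha> $ i) * fact (\<beta> $ i)) \<le> real (fact (\<alpha> $ i + \<beta> $ i))"
        by (rule of_nat_mono)
      then show "fact (\<alpha> $ i) * fact (\<beta> $ i) \<le> (fact ((\<alpha> + \<beta>) $ i) :: real)"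
        by simp
    qed simp
    finally show ?thesis .
  qed
  then have "(mi_fact \<alpha> * mi_fact \<beta>) powr \<kappa> \<le> mi_fact (\<alpha> + \<beta>) powr \<kappa>"
    using \<kappa> by (intro powr_mono2) (auto simp: less_imp_le)
  then have "(8 * r') ^ (a + b) * (mi_fact \<alpha> powr \<kappa> * mi_fact \<beta> powr \<kappa>) \<le> r ^ (a + b) * mi_fact (\<alpha> + \<beta>) powr \<kappa>"
    using r8 r' by (intro mult_mono power_mono) (auto simp: powr_mult less_imp_le)
  also have "\<dots> \<le> C * (r ^ (a + b) * mi_fact (\<alpha> + \<beta>) powr \<kappa>)"
    using C r mult_right_mono[OF C, of "r ^ (a + b) * mi_fact (\<alpha> + \<beta>) powr \<kappa>"] by simp
  finally show "theta r' (Flat \<sigma>) \<alpha> * theta r' (Flat \<sigma>) \<beta> * 8 ^ (mi_abs \<alpha> + mi_abs \<beta>) \<le> ennreal C * theta r (Flat \<sigma>) (\<alpha> + \<beta>)"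
    unfolding th eight_power_ennreal using r r' C
    by (simp add: ennreal_mult[symmetric] mi_abs_add a_def b_def power_add power_mult_distrib mult_ac)
  have "8 ^ a = (\<Prod>i\<in>(UNIV::'d set). (8::real) ^ (\<alpha> $ i))"
    by (simp add: a_def mi_abs_def power_sum)
  also have "\<dots> \<le> (\<Prod>i\<in>UNIV. c * (r ^ (\<alpha> $ i) * fact (\<alpha> $ i) powr \<kappa>))"
    by (intro prod_mono conjI fac) simp
  also have "\<dots> = C * (r ^ a * mi_fact \<alpha> powr \<kappa>)"
    by (simp add: prod.distrib C_def a_def mi_abs_def power_sum mi_fact_def prod_powr_distrib)
  finally show "8 ^ mi_abs \<alpha> \<le> ennreal C * theta r (Flat \<sigma>) \<alpha>"
    unfolding th eight_power_ennreal using r C by (simp add: ennreal_mult[symmetric] a_def)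
qed

text \<open>Weaker refers to the weight, not to the number: at \<open>s = 0\<close> the new
  parameter is larger.\<close>

lemma absorbs_weaker:
  assumes s: "s \<in> R_flat" "s < Num (1/2)" and r: "r > 0"
  shows "\<exists>r'>0. absorbs TYPE('d::finite) s r r'"
proof (cases s)
  case (Flat \<sigma>)
  then have \<sigma>: "\<sigma> > 0" using s(1) by (auto simp: R_flat_def)
  let ?k = "8 * 2 powr (1 / (2 * \<sigma>)) :: real"
  have "absorbs TYPE('d) s r (r / ?k)"
    unfolding Flat using r \<sigma> by (intro absorbs_Flat) auto
  then show ?thesis
    using r by (intro exI[of _ "r / ?k"]) auto
next
  case (Num x)
  then have x: "0 \<le> x" "x < 1/2"
    using s by (auto simp: R_flat_def)
  show ?thesis
  proof (cases "x = 0")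
    case True
    then show ?thesis
      using absorbs_zero[OF r] r Num by (intro exI[of _ "2 * r"]) auto
  next
    case False
    define q where "q = 1 / (2 * x)"
    have q: "q > 1" using x False by (simp add: q_def field_simps)
    \<comment> \<open>From \<open>M\<close> on, \<open>r / 2 * n powr (q - 1)\<close> exceeds
      \<open>ln 8\<close>, which uses \<open>q > 1\<close>; below \<open>M\<close> the linear
      exponent is bounded by the constant \<open>M * ln 8\<close>.\<close>
    define M where "M = (2 * ln 8 / r) powr (1 / (q - 1))"
    have M: "M \<ge> 0" by (simp add: M_def)
    have l8: "ln 8 > (0::real)" by simp
    have bound: "real n * ln 8 \<le> M * ln 8 + r / 2 * real n powr q" for n
    proof (cases "real n \<le> M")
      case True
      then have "real n * ln 8 \<le> M * ln 8"
        using l8 by (intro mult_right_mono) auto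
      then show ?thesis
        using r by (simp add: add_increasing2)
    next
      case False
      then have n: "real n > 0" using M by linarith
      have "2 * ln 8 / r = M powr (q - 1)"
        using q r l8 by (simp add: M_def powr_powr)
      also have "\<dots> \<le> real n powr (q - 1)"
        using False M q by (intro powr_mono2) auto
      finally have "real n * (2 * ln 8 / r) \<le> real n * real n powr (q - 1)"
        using n by (intro mult_left_mono) auto
      also have "\<dots> = real n powr q"
        using n powr_add[of "real n" 1 "q - 1"] by simp
      finally have "real n * ln 8 \<le> r / 2 * real n powr q"
        using r by (simp add: field_simps)
      then show ?thesis
        using M l8 by (simp add: add_increasing)
    qed
    have "absorbs TYPE('d) s r (r / 2 powr (q + 1))"
      unfolding Num
    proof (rule absorbs_Num[OF _ _ q_def])
      show "0 < x" "x \<le> 1/2" using x False by auto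
      show "0 < r / 2 powr (q + 1)" "2 powr (q + 1) * (r / 2 powr (q + 1)) \<le> r"
        using r by auto
      show "0 \<le> M * ln 8" using M l8 by simp
    qed (rule bound)
    then show ?thesis
      using r by (intro exI[of _ "r / 2 powr (q + 1)"]) auto
  qed
qed

lemma absorbs_stronger:
  assumes s: "s \<in> R_flat" "Num 0 < s" "s \<le> Num (1/2)" and r': "r' > 0"
  shows "\<exists>r>0. absorbs TYPE('d::finite) s r r'"
proof (cases s)
  case (Flat \<sigma>)
  then have \<sigma>: "\<sigma> > 0" using s(1) by (auto simp: R_flat_def)
  let ?k = "8 * 2 powr (1 / (2 * \<sigma>)) :: real"
  have "absorbs TYPE('d) s (?k * r') r'"
    unfolding Flat using r' \<sigma> by (intro absorbs_Flat) auto
  then show ?thesis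
    using r' by (intro exI[of _ "?k * r'"]) auto
next
  case (Num x)
  then have x: "0 < x" "x \<le> 1/2"
    using s by (auto simp: less_eq_flat_index_def)
  define q where "q = 1 / (2 * x)"
  have q: "q \<ge> 1" using x by (simp add: q_def field_simps)
  \<comment> \<open>With \<open>r \<ge> 2 * ln 8\<close> the linear exponent is dominated for every
    \<open>q \<ge> 1\<close>, in particular in the limiting case \<open>q = 1\<close>, and no
    additive constant remains.\<close>
  define r where "r = max (2 powr (q + 1) * r') (2 * ln 8)"
  have r: "r > 0" using r' by (simp add: r_def less_max_iff_disj)
  have "absorbs TYPE('d) s r r'"
    unfolding Num
  proof (rule absorbs_Num[OF x q_def r'])
    show "2 powr (q + 1) * r' \<le> r" by (simp add: r_def)
    fix n :: nat
    have "real n \<le> real n powr q"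
    proof (cases "n = 0")
      case False
      then have "real n powr 1 \<le> real n powr q"
        using q by (intro powr_mono) auto
      then show ?thesis using False by simp
    qed simp
    then have "ln 8 * real n \<le> r / 2 * real n powr q"
      using r by (intro mult_mono) (auto simp: r_def)
    then show "real n * ln 8 \<le> 0 + r / 2 * real n powr q"
      by (simp add: mult.commute)
  qed simp
  then show ?thesis
    using r by blast
qed

lemma absorbs_mono:
  assumes "absorbs TYPE('d::finite) s r u" "\<And>\<alpha> :: 'd mindex. theta r' s \<alpha> \<le> theta u s \<alpha>"
  shows "absorbs TYPE('d) s r r'"
proof -
  obtain C :: real where C: "C \<ge> 1" "\<And>\<alpha> \<beta> :: 'd mindex.
     theta u s (\<alpha> + \<beta>) * 8 ^ (mi_abs \<alpha> + mi_abs \<beta>) \<le> ennreal C * (theta r s \<alpha> * theta r s \<beta>) \<and>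
     theta u s \<alpha> * theta u s \<beta> * 8 ^ (mi_abs \<alpha> + mi_abs \<beta>) \<le> ennreal C * theta r s (\<alpha> + \<beta>) \<and>
     8 ^ mi_abs \<alpha> \<le> ennreal C * theta r s \<alpha>"
    using assms(1) unfolding absorbs_def by blast
  show ?thesis
    unfolding absorbs_def
  proof (intro exI[of _ C] conjI allI)
    fix \<alpha> \<beta> :: "'d mindex"
    show "theta r' s (\<alpha> + \<beta>) * 8 ^ (mi_abs \<alpha> + mi_abs \<beta>) \<le> ennreal C * (theta r s \<alpha> * theta r s \<beta>)"
      by (rule order_trans[OF mult_right_mono[OF assms(2)] C(2)[of \<alpha> \<beta>, THEN conjunct1]]) simp
    show "theta r' s \<alpha> * theta r' s \<beta> * 8 ^ (mi_abs \<alpha> + mi_abs \<beta>) \<le> ennreal C * theta r s (\<alpha> + \<beta>)"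
      by (rule order_trans[OF mult_right_mono[OF mult_mono[OF assms(2) assms(2)]] C(2)[of \<alpha> \<beta>, THEN conjunct2, THEN conjunct1]]) simp_all
    show "8 ^ mi_abs \<alpha> \<le> ennreal C * theta r s \<alpha>"
      using C(2) by blast
  qed (rule C)
qed

section \<open>Distributing weights over sums of multi-indices\<close>

lemma absorbs_le:
  assumes "absorbs TYPE('d::finite) s r r'" "r' > 0"
  shows "\<exists>C\<ge>1::real. \<forall>\<alpha>::'d mindex. theta r' s \<alpha> \<le> ennreal C * theta r s \<alpha>"
proof -
  obtain C :: real where "C \<ge> 1" and C: "\<And>\<alpha> \<beta> :: 'd mindex. theta r' s \<alpha> * theta r' s \<beta> * 8 ^ (mi_abs \<alpha> + mi_abs \<beta>) \<le> ennreal C * theta r s (\<alpha> + \<beta>)"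
    using assms(1) unfolding absorbs_def by blast
  have "theta r' s \<alpha> \<le> ennreal C * theta r s \<alpha>" for \<alpha> :: "'d mindex"
    using order_trans[OF le_mult_eight_power C[of \<alpha> 0]] assms(2) by simp
  then show ?thesis
    using \<open>C \<ge> 1\<close> by blast
qed

text \<open>Passing from \<open>r\<close> to \<open>m\<close> separates \<alpha>1 from \<gamma>, and
  passing from \<open>m\<close> to \<open>r'\<close> joins \<alpha>1 with \<alpha>2. The weight of
  \<gamma> is kept on the left as a gain with which other occurrences of \<gamma> can be paid
  for.\<close>

lemma theta_split:
  assumes "absorbs TYPE('d::finite) s r m" "absorbs TYPE('d) s m r'" and pos: "m > 0" "r' > 0"
  shows "\<exists>C\<ge>1::real. \<forall>\<alpha>1 \<alpha>2 \<gamma> :: 'd mindex.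
    theta r' s (\<alpha>1 + \<alpha>2) * 8 ^ (mi_abs \<alpha>1 + mi_abs \<alpha>2 + mi_abs \<gamma>) * theta m s \<gamma> \<le> ennreal C * (theta r s (\<alpha>1 + \<gamma>) * theta r s \<alpha>2)"
proof -
  obtain C :: real where C: "C \<ge> 1" "\<And>\<alpha> \<beta> :: 'd mindex. theta r' s (\<alpha> + \<beta>) * 8 ^ (mi_abs \<alpha> + mi_abs \<beta>) \<le> ennreal C * (theta m s \<alpha> * theta m s \<beta>)"
    using assms(2) unfolding absorbs_def by blast
  obtain D :: real where D: "D \<ge> 1" "\<And>\<alpha> \<beta> :: 'd mindex. theta m s \<alpha> * theta m s \<beta> * 8 ^ (mi_abs \<alpha> + mi_abs \<beta>) \<le> ennreal D * theta r s (\<alpha> + \<beta>)"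
    using assms(1) unfolding absorbs_def by blast
  show ?thesis
  proof (intro exI[of _ "C * (D * D)"] conjI allI)
    show "C * (D * D) \<ge> 1"
      using C(1) D(1) by (intro mult_ge1_I)
    fix \<alpha>1 \<alpha>2 \<gamma> :: "'d mindex"
    have "theta r' s (\<alpha>1 + \<alpha>2) * 8 ^ (mi_abs \<alpha>1 + mi_abs \<alpha>2 + mi_abs \<gamma>) * theta m s \<gamma> =
        (theta r' s (\<alpha>1 + \<alpha>2) * 8 ^ (mi_abs \<alpha>1 + mi_abs \<alpha>2)) * (8 ^ mi_abs \<gamma> * theta m s \<gamma>)"
      by (simp only: power_add mult_ac)
    also have "\<dots> \<le> (ennreal C * (theta m s \<alpha>1 * theta m s \<alpha>2)) * (8 ^ mi_abs \<gamma> * theta m s \<gamma>)"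
      by (intro mult_right_mono C) simp
    also have "\<dots> = ennreal C * ((theta m s \<alpha>1 * theta m s \<gamma> * 8 ^ mi_abs \<gamma>) * theta m s \<alpha>2)"
      by (simp only: mult_ac)
    also have "\<dots> \<le> ennreal C * ((theta m s \<alpha>1 * theta m s \<gamma> * (8 ^ mi_abs \<gamma> * 8 ^ mi_abs \<alpha>1)) * (theta m s \<alpha>2 * 8 ^ mi_abs \<alpha>2))"
      by (intro mult_mono order_refl le_mult_eight_power) auto
    \<comment> \<open>Here \<open>\<alpha>2\<close> is read as \<open>\<alpha>2 + 0\<close>, so that
      the splitting bound also carries it from \<open>m\<close> back to \<open>r\<close>.\<close>
    also have "\<dots> = ennreal C * ((theta m s \<alpha>1 * theta m s \<gamma> * 8 ^ (mi_abs \<alpha>1 + mi_abs \<gamma>)) * (theta m s \<alpha>2 * theta m s (0 :: 'd mindex) * 8 ^ (mi_abs \<alpha>2 + mi_abs (0 :: 'd mindex))))"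
      using pos by (simp add: power_add mult_ac)
    also have "\<dots> \<le> ennreal C * ((ennreal D * theta r s (\<alpha>1 + \<gamma>)) * (ennreal D * theta r s (\<alpha>2 + 0)))"
      by (intro mult_left_mono mult_mono D) auto
    also have "\<dots> = ennreal (C * (D * D)) * (theta r s (\<alpha>1 + \<gamma>) * theta r s \<alpha>2)"
      using C(1) D(1) by (simp add: ennreal_mult mult_ac)
    finally show "theta r' s (\<alpha>1 + \<alpha>2) * 8 ^ (mi_abs \<alpha>1 + mi_abs \<alpha>2 + mi_abs \<gamma>) * theta m s \<gamma> \<le> ennreal (C * (D * D)) * (theta r s (\<alpha>1 + \<gamma>) * theta r s \<alpha>2)" .
  qed
qed

text \<open>The counterpart for denominators: \<beta>2 and \<gamma> are separated at the cost of the
  weight of \<gamma>, and then \<beta>1 and \<beta>2 are joined under the parameter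
  \<open>t\<close>.\<close>

lemma theta_merge:
  assumes "absorbs TYPE('d::finite) s t m" "absorbs TYPE('d) s m r" and pos: "m > 0" "r > 0"
  shows "\<exists>C\<ge>1::real. \<forall>\<beta>1 \<beta>2 \<gamma> :: 'd mindex.
    theta r s \<beta>1 * theta r s (\<beta>2 + \<gamma>) * 8 ^ (mi_abs \<beta>1 + mi_abs \<beta>2) \<le> ennreal C * (theta t s (\<beta>1 + \<beta>2) * theta m s \<gamma>)"
proof -
  obtain C :: real where C: "C \<ge> 1" "\<And>\<alpha> \<beta> :: 'd mindex. theta r s (\<alpha> + \<beta>) * 8 ^ (mi_abs \<alpha> + mi_abs \<beta>) \<le> ennreal C * (theta m s \<alpha> * theta m s \<beta>)"
    using assms(2) unfolding absorbs_def by blast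
  obtain D :: real where D: "D \<ge> 1" "\<And>\<alpha> \<beta> :: 'd mindex. theta m s \<alpha> * theta m s \<beta> * 8 ^ (mi_abs \<alpha> + mi_abs \<beta>) \<le> ennreal D * theta t s (\<alpha> + \<beta>)"
    using assms(1) unfolding absorbs_def by blast
  have C': "theta r s (\<alpha> + \<beta>) \<le> ennreal C * (theta m s \<alpha> * theta m s \<beta>)" for \<alpha> \<beta> :: "'d mindex"
    using le_mult_eight_power C(2) by (rule order_trans)
  show ?thesis
  proof (intro exI[of _ "C * C * D"] conjI allI)
    show "C * C * D \<ge> 1"
      using C(1) D(1) by (intro mult_ge1_I)
    fix \<beta>1 \<beta>2 \<gamma> :: "'d mindex"
    have "theta r s \<beta>1 * theta r s (\<beta>2 + \<gamma>) * 8 ^ (mi_abs \<beta>1 + mi_abs \<beta>2) = theta r s (\<beta>1 + 0) * theta r s (\<beta>2 + \<gamma>) * 8 ^ (mi_abs \<beta>1 + mi_abs \<beta>2)"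
      by simp
    also have "\<dots> \<le> (ennreal C * (theta m s \<beta>1 * theta m s (0 :: 'd mindex))) * (ennreal C * (theta m s \<beta>2 * theta m s \<gamma>)) * 8 ^ (mi_abs \<beta>1 + mi_abs \<beta>2)"
      by (intro mult_right_mono mult_mono C') auto
    also have "\<dots> = ennreal (C * C) * ((theta m s \<beta>1 * theta m s \<beta>2 * 8 ^ (mi_abs \<beta>1 + mi_abs \<beta>2)) * theta m s \<gamma>)"
      using C(1) pos by (simp add: ennreal_mult mult_ac)
    also have "\<dots> \<le> ennreal (C * C) * ((ennreal D * theta t s (\<beta>1 + \<beta>2)) * theta m s \<gamma>)"
      by (intro mult_left_mono mult_right_mono D) auto
    also have "\<dots> = ennreal (C * C * D) * (theta t s (\<beta>1 + \<beta>2) * theta m s \<gamma>)"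
      using C(1) D(1) by (simp add: ennreal_mult mult_ac)
    finally show "theta r s \<beta>1 * theta r s (\<beta>2 + \<gamma>) * 8 ^ (mi_abs \<beta>1 + mi_abs \<beta>2) \<le> ennreal (C * C * D) * (theta t s (\<beta>1 + \<beta>2) * theta m s \<gamma>)" .
  qed
qed

text \<open>The splitting bound is used for the first components and, with the factors interchanged,
  for the second ones, because \<gamma> is attached to \<alpha>1 on one side and to \<beta>2 on the
  other. The leftover weights of \<gamma> are bounded below by a positive constant and are
  dropped.\<close>

lemma admissible_weight_A:
  assumes "absorbs TYPE('d::finite) s r m" "absorbs TYPE('d) s m r'" and pos: "m > 0" "r' > 0"
  shows "admissible (weight_A s r :: 'd weight) (weight_A s r')"
proof -
  obtain C :: real where C: "C \<ge> 1" "\<And>\<alpha>1 \<alpha>2 \<gamma> :: 'd mindex.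
    theta r' s (\<alpha>1 + \<alpha>2) * 8 ^ (mi_abs \<alpha>1 + mi_abs \<alpha>2 + mi_abs \<gamma>) * theta m s \<gamma> \<le> ennreal C * (theta r s (\<alpha>1 + \<gamma>) * theta r s \<alpha>2)"
    using theta_split[OF assms] by blast
  obtain D :: real where D: "D \<ge> 1" "\<And>\<alpha> :: 'd mindex. 8 ^ mi_abs \<alpha> \<le> ennreal D * theta m s \<alpha>"
    using assms(2) unfolding absorbs_def by blast
  have E: "theta r' s (\<alpha>1 + \<alpha>2) * 8 ^ (mi_abs \<alpha>1 + mi_abs \<alpha>2 + mi_abs \<gamma>) \<le> ennreal (C * D) * (theta r s (\<alpha>1 + \<gamma>) * theta r s \<alpha>2)"
    for \<alpha>1 \<alpha>2 \<gamma> :: "'d mindex"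
  proof -
    have "1 \<le> (8 :: ennreal) ^ mi_abs \<gamma>"
      by (simp add: eight_power_ennreal)
    then have "1 \<le> ennreal D * theta m s \<gamma>"
      using D(2) by (rule order_trans)
    then have "theta r' s (\<alpha>1 + \<alpha>2) * 8 ^ (mi_abs \<alpha>1 + mi_abs \<alpha>2 + mi_abs \<gamma>) * 1 \<le>
        theta r' s (\<alpha>1 + \<alpha>2) * 8 ^ (mi_abs \<alpha>1 + mi_abs \<alpha>2 + mi_abs \<gamma>) * (ennreal D * theta m s \<gamma>)"
      by (rule mult_left_mono) simp
    also have "\<dots> = ennreal D * (theta r' s (\<alpha>1 + \<alpha>2) * 8 ^ (mi_abs \<alpha>1 + mi_abs \<alpha>2 + mi_abs \<gamma>) * theta m s \<gamma>)"
      by (simp only: mult_ac)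
    also have "\<dots> \<le> ennreal D * (ennreal C * (theta r s (\<alpha>1 + \<gamma>) * theta r s \<alpha>2))"
      by (intro mult_left_mono C) simp
    also have "\<dots> = ennreal (C * D) * (theta r s (\<alpha>1 + \<gamma>) * theta r s \<alpha>2)"
      using C(1) D(1) by (simp add: ennreal_mult mult_ac)
    finally show ?thesis by simp
  qed
  have "admissible_with ((C * D) * (C * D)) (weight_A s r :: 'd weight) (weight_A s r')"
    unfolding admissible_with_def
  proof (intro conjI allI disjI1)
    show "0 \<le> (C * D) * (C * D)"
      using C(1) D(1) by simp
    fix \<alpha>1 \<alpha>2 \<beta>1 \<beta>2 \<gamma> :: "'d mindex"
    let ?x = "theta r' s (\<alpha>1 + \<alpha>2)" and ?y = "theta r' s (\<beta>2 + \<beta>1)"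
    have "weight_A s r' (\<alpha>1 + \<alpha>2, \<beta>1 + \<beta>2) * 8 ^ quint_abs (\<alpha>1, \<alpha>2, \<beta>1, \<beta>2, \<gamma>) \<le>
      weight_A s r' (\<alpha>1 + \<alpha>2, \<beta>1 + \<beta>2) * 8 ^ (mi_abs \<alpha>1 + mi_abs \<alpha>2 + mi_abs \<gamma> + (mi_abs \<beta>2 + mi_abs \<beta>1 + mi_abs \<gamma>))"
      unfolding eight_power_ennreal
      by (intro mult_left_mono ennreal_leI power_increasing) (auto simp: quint_abs_def)
    also have "\<dots> = (?x * 8 ^ (mi_abs \<alpha>1 + mi_abs \<alpha>2 + mi_abs \<gamma>)) * (?y * 8 ^ (mi_abs \<beta>2 + mi_abs \<beta>1 + mi_abs \<gamma>))"
      by (simp add: weight_A_def power_add mult_ac add_ac)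
    also have "\<dots> \<le> (ennreal (C * D) * (theta r s (\<alpha>1 + \<gamma>) * theta r s \<alpha>2)) * (ennreal (C * D) * (theta r s (\<beta>2 + \<gamma>) * theta r s \<beta>1))"
      by (intro mult_mono E) auto
    also have "\<dots> = ennreal ((C * D) * (C * D)) * (weight_A s r (\<alpha>1 + \<gamma>, \<beta>1) * weight_A s r (\<alpha>2, \<beta>2 + \<gamma>))"
      using C(1) D(1) by (simp add: weight_A_def ennreal_mult mult_ac)
    finally show "weight_A s r' (\<alpha>1 + \<alpha>2, \<beta>1 + \<beta>2) * 8 ^ quint_abs (\<alpha>1, \<alpha>2, \<beta>1, \<beta>2, \<gamma>) \<le>
        ennreal ((C * D) * (C * D)) * (weight_A s r (\<alpha>1 + \<gamma>, \<beta>1) * weight_A s r (\<alpha>2, \<beta>2 + \<gamma>))" .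
  qed
  then show ?thesis
    by (auto simp: admissible_def)
qed

text \<open>\<open>F1 / T1\<close> and \<open>F2 / T2\<close> are the weights of the factors,
  \<open>A / B\<close> that of the result and \<open>G\<close> the weight of \<gamma>. If
  \<open>B\<close> is infinite the left side is 0; otherwise an infinite \<open>F1\<close> or
  \<open>F2\<close> makes its quotient infinite, which is one of the alternatives.\<close>

lemma ennreal_quotient_bound:
  fixes A B G T1 T2 F1 F2 :: ennreal and x y C1 C2 :: real
  assumes pos: "B \<noteq> 0" "G \<noteq> 0" "T1 \<noteq> 0" "T2 \<noteq> 0" "F1 \<noteq> 0" "F2 \<noteq> 0"
    and xy: "x \<ge> 1" "y \<ge> 1" and C: "C1 \<ge> 1" "C2 \<ge> 1"
    and merge: "T1 * T2 * ennreal x \<le> ennreal C1 * (B * G)"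
    and split: "A * ennreal y * G \<le> ennreal C2 * (F1 * F2)"
    and T1: "B \<noteq> \<infinity> \<Longrightarrow> T1 \<noteq> \<infinity>" and G: "F1 \<noteq> \<infinity> \<Longrightarrow> G \<noteq> \<infinity>"
  shows "A / B * ennreal (x * y) \<le> ennreal (C1 * C2) * (F1 / T1 * (F2 / T2)) \<or> F1 / T1 = \<infinity> \<or> F2 / T2 = \<infinity>"
proof (cases "B = \<infinity> \<or> F1 = \<infinity> \<or> F2 = \<infinity>")
  case True
  show ?thesis
  proof (cases "B = \<infinity>")
    case False
    then have T1': "T1 \<noteq> \<infinity>" by (rule T1)
    show ?thesis
    proof (cases "F1 = \<infinity>")
      case True
      then show ?thesis using T1' by (simp add: ennreal_top_divide)
    next
      case F1: False
      then have G': "G \<noteq> \<infinity>" by (rule G)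
      have "T1 * T2 * ennreal x < \<infinity>"
        by (rule le_less_trans[OF merge]) (use False G' in \<open>simp add: ennreal_mult_less_top less_top\<close>)
      then have "T2 \<noteq> \<infinity>"
        using pos xy by (auto simp: ennreal_mult_less_top)
      moreover have "F2 = \<infinity>"
        using True False F1 by simp
      ultimately show ?thesis by (simp add: ennreal_top_divide)
    qed
  qed simp
next
  case False
  then have fin: "B \<noteq> \<infinity>" "F1 \<noteq> \<infinity>" "F2 \<noteq> \<infinity>" "T1 \<noteq> \<infinity>" "G \<noteq> \<infinity>"
    using T1 G by auto
  have "T1 * T2 * ennreal x < \<infinity>"
    by (rule le_less_trans[OF merge]) (use fin in \<open>simp add: ennreal_mult_less_top less_top\<close>)
  then have T2: "T2 \<noteq> \<infinity>"
    using pos xy by (auto simp: ennreal_mult_less_top)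
  have "A * ennreal y * G < \<infinity>"
    by (rule le_less_trans[OF split]) (use fin in \<open>simp add: ennreal_mult_less_top less_top\<close>)
  then have A: "A \<noteq> \<infinity>"
    using pos xy by (auto simp: ennreal_mult_less_top)
  have real: "\<exists>v>0. V = ennreal v" if "V \<noteq> 0" "V \<noteq> \<infinity>" for V
    using that by (cases V) (auto simp: less_le)
  obtain b where b: "B = ennreal b" "b > 0" using real[OF pos(1) fin(1)] by blast
  obtain g where g: "G = ennreal g" "g > 0" using real[OF pos(2) fin(5)] by blast
  obtain t1 where t1: "T1 = ennreal t1" "t1 > 0" using real[OF pos(3) fin(4)] by blast
  obtain t2 where t2: "T2 = ennreal t2" "t2 > 0" using real[OF pos(4) T2] by blast
  obtain f1 where f1: "F1 = ennreal f1" "f1 > 0" using real[OF pos(5) fin(2)] by blast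
  obtain f2 where f2: "F2 = ennreal f2" "f2 > 0" using real[OF pos(6) fin(3)] by blast
  obtain a where a: "A = ennreal a" "a \<ge> 0" using A by (cases A) auto
  note r = a b g t1 t2 f1 f2
  have m: "t1 * t2 * x \<le> C1 * (b * g)"
    using merge r xy C by (simp add: ennreal_mult[symmetric])
  have s: "a * y * g \<le> C2 * (f1 * f2)"
    using split r xy C by (simp add: ennreal_mult[symmetric])
  \<comment> \<open>In the product of the two bounds the weight of \<gamma> stands on both sides and
    cancels.\<close>
  have "(a * y * g) * (t1 * t2 * x) \<le> (C2 * (f1 * f2)) * (C1 * (b * g))"
    by (rule mult_mono[OF s m]) (use r xy C in auto)
  then have "(a * (x * y) * (t1 * t2)) * g \<le> (C1 * C2 * (f1 * f2) * b) * g"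
    by (simp add: mult_ac)
  then have "a * (x * y) * (t1 * t2) \<le> C1 * C2 * (f1 * f2) * b"
    using r by simp
  then have "a / b * (x * y) \<le> (C1 * C2) * (f1 / t1 * (f2 / t2))"
    using r by (simp add: field_simps)
  then show ?thesis
    using r xy C by (simp add: divide_ennreal ennreal_mult[symmetric])
qed

text \<open>\<gamma> raises the numerator of the first factor and the denominator of the second.
  Splitting the numerators gains the weight of \<gamma> at \<open>q\<close>, merging the
  denominators costs its weight at \<open>m\<close>, and \<open>mq\<close> says that the gain covers
  the cost.\<close>

lemma admissible_weight_C:
  assumes "absorbs TYPE('d::finite) s r2 q" "absorbs TYPE('d) s q r2'"
    and "absorbs TYPE('d) s t m" "absorbs TYPE('d) s m r1"
    and le: "\<And>\<beta> :: 'd mindex. theta t s \<beta> \<le> theta r1' s \<beta>"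
    and mq: "K \<ge> 1" "\<And>\<gamma> :: 'd mindex. theta m s \<gamma> \<le> ennreal K * theta q s \<gamma>"
    and pos: "r2 > 0" "q > 0" "r2' > 0" "m > 0" "r1 > 0" "r1' > 0"
  shows "admissible (weight_C s r2 r1 :: 'd weight) (weight_C s r2' r1')"
proof -
  obtain C2 :: real where C2: "C2 \<ge> 1" "\<And>\<alpha>1 \<alpha>2 \<gamma> :: 'd mindex.
    theta r2' s (\<alpha>1 + \<alpha>2) * 8 ^ (mi_abs \<alpha>1 + mi_abs \<alpha>2 + mi_abs \<gamma>) * theta q s \<gamma> \<le> ennreal C2 * (theta r2 s (\<alpha>1 + \<gamma>) * theta r2 s \<alpha>2)"
    using theta_split[OF assms(1,2) pos(2,3)] by blast
  obtain C1 :: real where C1: "C1 \<ge> 1" "\<And>\<beta>1 \<beta>2 \<gamma> :: 'd mindex.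
    theta r1 s \<beta>1 * theta r1 s (\<beta>2 + \<gamma>) * 8 ^ (mi_abs \<beta>1 + mi_abs \<beta>2) \<le> ennreal C1 * (theta t s (\<beta>1 + \<beta>2) * theta m s \<gamma>)"
    using theta_merge[OF assms(3,4) pos(4,5)] by blast
  have merge: "theta r1 s \<beta>1 * theta r1 s (\<beta>2 + \<gamma>) * 8 ^ (mi_abs \<beta>1 + mi_abs \<beta>2) \<le> ennreal (C1 * K) * (theta r1' s (\<beta>1 + \<beta>2) * theta q s \<gamma>)"
    for \<beta>1 \<beta>2 \<gamma> :: "'d mindex"
  proof -
    have "ennreal C1 * (theta t s (\<beta>1 + \<beta>2) * theta m s \<gamma>) \<le> ennreal C1 * (theta r1' s (\<beta>1 + \<beta>2) * (ennreal K * theta q s \<gamma>))"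
      by (intro mult_mono mq le order_refl) auto
    also have "\<dots> = ennreal (C1 * K) * (theta r1' s (\<beta>1 + \<beta>2) * theta q s \<gamma>)"
      using C1(1) mq(1) by (simp add: ennreal_mult mult_ac)
    finally show ?thesis
      using C1(2) order_trans by blast
  qed
  have CK: "C1 * K \<ge> 1"
    using mult_mono[of 1 C1 1 K] C1(1) mq(1) by simp
  have "admissible_with (C1 * K * C2) (weight_C s r2 r1 :: 'd weight) (weight_C s r2' r1')"
    unfolding admissible_with_def
  proof (intro conjI allI)
    show "0 \<le> C1 * K * C2"
      using CK C2(1) by simp
    fix \<alpha>1 \<alpha>2 \<beta>1 \<beta>2 \<gamma> :: "'d mindex"
    have T1: "theta r1 s \<beta>1 \<noteq> \<infinity>" if "theta r1' s (\<beta>1 + \<beta>2) \<noteq> \<infinity>"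
    proof -
      have "theta r1 s \<beta>1 * theta r1 s (\<beta>2 + 0) * 8 ^ (mi_abs \<beta>1 + mi_abs \<beta>2) < \<infinity>"
        by (rule le_less_trans[OF merge]) (use that pos in \<open>simp add: ennreal_mult_less_top less_top\<close>)
      then show ?thesis
        using pos by (auto simp: ennreal_mult_less_top eight_power_ennreal)
    qed
    have G: "theta q s \<gamma> \<noteq> \<infinity>" if "theta r2 s (\<alpha>1 + \<gamma>) \<noteq> \<infinity>"
    proof -
      have "theta r2' s (\<alpha>1 + 0) * 8 ^ (mi_abs \<alpha>1 + mi_abs (0 :: 'd mindex) + mi_abs \<gamma>) * theta q s \<gamma> < \<infinity>"
        by (rule le_less_trans[OF C2(2)]) (use that pos in \<open>simp add: ennreal_mult_less_top less_top\<close>)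
      then show ?thesis
        using pos by (auto simp: ennreal_mult_less_top eight_power_ennreal)
    qed
    have e: "(8 :: ennreal) ^ quint_abs (\<alpha>1, \<alpha>2, \<beta>1, \<beta>2, \<gamma>) = ennreal (8 ^ (mi_abs \<beta>1 + mi_abs \<beta>2) * 8 ^ (mi_abs \<alpha>1 + mi_abs \<alpha>2 + mi_abs \<gamma>))"
      unfolding eight_power_ennreal by (simp add: quint_abs_def power_add[symmetric] add_ac)
    show "weight_C s r2' r1' (\<alpha>1 + \<alpha>2, \<beta>1 + \<beta>2) * 8 ^ quint_abs (\<alpha>1, \<alpha>2, \<beta>1, \<beta>2, \<gamma>)
          \<le> ennreal (C1 * K * C2) * (weight_C s r2 r1 (\<alpha>1 + \<gamma>, \<beta>1) * weight_C s r2 r1 (\<alpha>2, \<beta>2 + \<gamma>)) \<or>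
        weight_C s r2 r1 (\<alpha>1 + \<gamma>, \<beta>1) = \<infinity> \<or> weight_C s r2 r1 (\<alpha>2, \<beta>2 + \<gamma>) = \<infinity>"
      unfolding e weight_C_def prod.case
      by (rule ennreal_quotient_bound[where G = "theta q s \<gamma>"])
         (use pos CK C2(1) merge[of \<beta>1 \<beta>2 \<gamma>] C2(2)[of \<alpha>1 \<alpha>2 \<gamma>] T1 G in \<open>auto simp: eight_power_ennreal simp del: theta.simps\<close>)
  qed
  then show ?thesis
    by (auto simp: admissible_def)
qed

text \<open>Interchanging the two components together with the two factors maps the quintuple
  condition to itself, so the starred spaces need no estimates of their own.\<close>

lemma admissible_transpose:
  assumes "admissible \<omega> \<omega>'"
  shows "admissible (\<lambda>k. \<omega> (prod.swap k)) (\<lambda>k. \<omega>' (prod.swap k))"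
proof -
  obtain C where C: "admissible_with C \<omega> \<omega>'"
    using assms by (auto simp: admissible_def)
  have "admissible_with C (\<lambda>k. \<omega> (prod.swap k)) (\<lambda>k. \<omega>' (prod.swap k))"
    unfolding admissible_with_def
  proof (intro conjI allI)
    show "0 \<le> C" using C by (simp add: admissible_with_def)
    fix \<alpha>1 \<alpha>2 \<beta>1 \<beta>2 \<gamma>
    show "\<omega>' (prod.swap (\<alpha>1 + \<alpha>2, \<beta>1 + \<beta>2)) * 8 ^ quint_abs (\<alpha>1, \<alpha>2, \<beta>1, \<beta>2, \<gamma>)
          \<le> ennreal C * (\<omega> (prod.swap (\<alpha>1 + \<gamma>, \<beta>1)) * \<omega> (prod.swap (\<alpha>2, \<beta>2 + \<gamma>))) \<or>
        \<omega> (prod.swap (\<alpha>1 + \<gamma>, \<beta>1)) = \<infinity> \<or> \<omega> (prod.swap (\<alpha>2, \<beta>2 + \<gamma>)) = \<infinity>"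
      using C[unfolded admissible_with_def, THEN conjunct2, rule_format, of \<beta>2 \<beta>1 \<alpha>2 \<alpha>1 \<gamma>]
      by (auto simp: quint_abs_def add_ac mult_ac)
  qed
  then show ?thesis
    by (auto simp: admissible_def)
qed

lemma weight_C_star_eq: "weight_C_star s r2 r1 = (\<lambda>k. weight_C s r1 r2 (prod.swap k))"
  by (auto simp: weight_C_star_def weight_C_def fun_eq_iff)

lemma admissible_weight_C_star:
  assumes "admissible (weight_C s a b :: ('d::finite) weight) (weight_C s a' b')"
  shows "admissible (weight_C_star s b a :: 'd weight) (weight_C_star s b' a')"
  unfolding weight_C_star_eq by (rule admissible_transpose[OF assms])

lemma weight_C_one: "r2 > 0 \<Longrightarrow> r1 > 0 \<Longrightarrow> weight_C s r2 r1 0 = 1"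
  by (simp add: weight_C_def zero_prod_def)

lemma weight_C_finite: "r1 > 0 \<Longrightarrow> theta r2 s (fst k) \<noteq> \<infinity> \<Longrightarrow> weight_C s r2 r1 k \<noteq> \<infinity>"
  by (auto simp: weight_C_def ennreal_divide_eq_top_iff split: prod.splits)

lemma weight_C_nonzero: "r2 > 0 \<Longrightarrow> theta r1 s (snd k) \<noteq> \<infinity> \<Longrightarrow> weight_C s r2 r1 k \<noteq> 0"
  by (auto simp: weight_C_def ennreal_divide_eq_0_iff split: prod.splits)

text \<open>The numerator parameters depend only on \<open>r2\<close> and are fixed before
  \<open>r1'\<close> is known; the denominator parameters may depend on all of them.\<close>

lemma weight_C_weaker:
  assumes s: "s \<in> R_flat" "s < Num (1/2)" and r2: "r2 > 0"
  shows "\<exists>r2'>0. \<forall>r1'>0. \<exists>r1>0. admissible (weight_C s r2 r1 :: ('d::finite) weight) (weight_C s r2' r1')"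
proof -
  note weaker = absorbs_weaker[where 'd='d, OF s]
  obtain q where q: "q > 0" "absorbs TYPE('d) s r2 q"
    using weaker[OF r2] by blast
  obtain r2' where r2': "r2' > 0" "absorbs TYPE('d) s q r2'"
    using weaker[OF q(1)] by blast
  have "\<exists>r1>0. admissible (weight_C s r2 r1 :: 'd weight) (weight_C s r2' r1')" if r1': "r1' > 0" for r1'
  proof -
    \<comment> \<open>Being below \<open>r1'\<close> serves the denominator of the result; being
      below \<open>q\<close> lets the gain at \<open>q\<close> cover the cost at
      \<open>m\<close>.\<close>
    obtain t where t: "t > 0" "\<And>\<alpha> :: 'd mindex. theta t s \<alpha> \<le> theta r1' s \<alpha>" "\<And>\<alpha> :: 'd mindex. theta t s \<alpha> \<le> theta q s \<alpha>"
      using theta_common_weaker[OF r1' q(1), of s] by blast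
    obtain m where m: "m > 0" "absorbs TYPE('d) s t m"
      using weaker[OF t(1)] by blast
    obtain r1 where r1: "r1 > 0" "absorbs TYPE('d) s m r1"
      using weaker[OF m(1)] by blast
    obtain K :: real where K: "K \<ge> 1" "\<And>\<alpha>::'d mindex. theta m s \<alpha> \<le> ennreal K * theta t s \<alpha>"
      using absorbs_le[OF m(2,1)] by blast
    have "theta m s \<gamma> \<le> ennreal K * theta q s \<gamma>" for \<gamma> :: "'d mindex"
      by (rule order_trans[OF K(2) mult_left_mono[OF t(3)]]) simp
    then show ?thesis
      using admissible_weight_C[OF q(2) r2'(2) m(2) r1(2) t(2) K(1)] r2 q(1) r2'(1) m(1) r1(1) r1' by blast
  qed
  then show ?thesis
    using r2'(1) by blast
qed

text \<open>Now the denominator parameters come before \<open>r2'\<close>, and the numerators are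
  strengthened until their gain covers the cost already fixed at \<open>m\<close>.\<close>

lemma weight_C_stronger:
  assumes s: "s \<in> R_flat" "Num 0 < s" "s \<le> Num (1/2)" and r1: "r1 > 0"
  shows "\<exists>r1'>0. \<forall>r2'>0. \<exists>r2>0. admissible (weight_C s r2 r1 :: ('d::finite) weight) (weight_C s r2' r1')"
proof -
  note stronger = absorbs_stronger[where 'd='d, OF s]
  have s0: "s \<noteq> Num 0" using s(2) by auto
  obtain m where m: "m > 0" "absorbs TYPE('d) s m r1"
    using stronger[OF r1] by blast
  obtain r1' where r1': "r1' > 0" "absorbs TYPE('d) s r1' m"
    using stronger[OF m(1)] by blast
  have "\<exists>r2>0. admissible (weight_C s r2 r1 :: 'd weight) (weight_C s r2' r1')" if r2': "r2' > 0" for r2'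
  proof -
    \<comment> \<open>\<open>u\<close> has to dominate \<open>r2'\<close>, for the numerator of the
      result, and \<open>m\<close>, for the cost of \<gamma>.\<close>
    define u where "u = max r2' m"
    have u: "u > 0" "\<And>\<alpha> :: 'd mindex. theta r2' s \<alpha> \<le> theta u s \<alpha>" "\<And>\<alpha> :: 'd mindex. theta m s \<alpha> \<le> theta u s \<alpha>"
      using r2' m(1) by (auto simp: u_def less_max_iff_disj intro!: theta_mono[OF s0] simp del: theta.simps)
    obtain q where q: "q > 0" "absorbs TYPE('d) s q u"
      using stronger[OF u(1)] by blast
    obtain r2 where r2: "r2 > 0" "absorbs TYPE('d) s r2 q"
      using stronger[OF q(1)] by blast
    obtain K :: real where K: "K \<ge> 1" "\<And>\<alpha>::'d mindex. theta u s \<alpha> \<le> ennreal K * theta q s \<alpha>"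
      using absorbs_le[OF q(2) u(1)] by blast
    have mq: "theta m s \<gamma> \<le> ennreal K * theta q s \<gamma>" for \<gamma> :: "'d mindex"
      using u(3) K(2) by (rule order_trans)
    have "absorbs TYPE('d) s q r2'"
      using absorbs_mono[OF q(2) u(2)] .
    then show ?thesis
      using admissible_weight_C[OF r2(2) _ r1'(2) m(2) order_refl K(1) mq] r2(1) q(1) r2' m(1) r1 r1'(1) by blast
  qed
  then show ?thesis
    using r1'(1) by blast
qed


section \<open>The extension criteria applied to the symbol spaces\<close>

lemma A_hat_extension:
  fixes p :: ennreal
  assumes s: "s \<in> R_flat" "s < Num (1/2)" and p: "p > 0"
  shows "uniquely_extends (prod_topology (A_hat p s) (A_hat p s)) (A_hat p s :: ('d::finite) fseries topology)
     (A_fin \<times> A_fin) (\<lambda>(a, b). twisted_aw a b)"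
proof -
  have adm: "\<exists>r'>0. admissible (weight_A s r :: 'd weight) (weight_A s r')" if "r > 0" for r
  proof -
    obtain m where m: "m > 0" "absorbs TYPE('d) s r m"
      using absorbs_weaker[OF s \<open>r > 0\<close>] by blast
    obtain r' where r': "r' > 0" "absorbs TYPE('d) s m r'"
      using absorbs_weaker[OF s m(1)] by blast
    show ?thesis
      using admissible_weight_A[OF m(2) r'(2) m(1) r'(1)] r'(1) by blast
  qed
  have mono: "weight_A s r k \<le> weight_A s r' k" if "\<And>\<alpha> :: 'd mindex. theta r s \<alpha> \<le> theta r' s \<alpha>"
    for r r' and k :: "'d mindex \<times> 'd mindex"
    using that by (auto simp: weight_A_def split: prod.splits intro!: mult_mono)
  have one: "weight_A s r (0 :: 'd mindex \<times> 'd mindex) = 1" if "r > 0" for r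
    using that by (simp add: weight_A_def zero_prod_def)
  have nz: "weight_A s r k \<noteq> 0" if "r > 0" for r and k :: "'d mindex \<times> 'd mindex"
    using that by (auto simp: weight_A_def split: prod.splits)
  have fin: "\<exists>r>0. \<forall>k\<in>K. weight_A s r k \<noteq> \<infinity>" if K: "finite K" for K :: "('d mindex \<times> 'd mindex) set"
  proof -
    have "finite (fst ` K \<union> snd ` K)" using K by simp
    from theta_finite_on[OF this, of s] obtain r where "r > 0" "\<forall>\<alpha>\<in>fst ` K \<union> snd ` K. theta r s \<alpha> \<noteq> \<infinity>"
      by blast
    then show ?thesis
      by (intro exI[of _ r]) (force simp: weight_A_def ennreal_mult_eq_top_iff split: prod.splits)
  qed
  \<comment> \<open>A countable cofinal sequence of steps with decreasing weights. As the weight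
    falls with a growing parameter at \<open>s = 0\<close> and with a shrinking one otherwise, it is
    \<open>n + 1\<close> there and \<open>1 / (n + 1)\<close> elsewhere.\<close>
  obtain R :: "nat \<Rightarrow> real" where R: "\<And>n. R n > 0"
    "\<And>n (\<alpha> :: 'd mindex). theta (R (Suc n)) s \<alpha> \<le> theta (R n) s \<alpha>"
    "\<And>r. r > 0 \<Longrightarrow> \<exists>n. \<forall>\<alpha> :: 'd mindex. theta (R n) s \<alpha> \<le> theta r s \<alpha>"
  proof (cases "s = Num 0")
    case True
    show ?thesis
    proof (rule that[of "\<lambda>n. real n + 1"])
      show "\<exists>n. \<forall>\<alpha> :: 'd mindex. theta (real n + 1) s \<alpha> \<le> theta r s \<alpha>" for r
      proof -
        obtain n where "r \<le> real n" using real_arch_simple by blast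
        then show ?thesis
          unfolding True by (intro exI[of _ n] allI theta_antimono) simp
      qed
    qed (auto simp: True)
  next
    case False
    show ?thesis
    proof (rule that[of "\<lambda>n. 1 / (real n + 1)"])
      show "theta (1 / (real (Suc n) + 1)) s \<alpha> \<le> theta (1 / (real n + 1)) s \<alpha>" for n and \<alpha> :: "'d mindex"
        by (intro theta_mono[OF False]) (auto simp: field_simps)
      show "\<exists>n. \<forall>\<alpha> :: 'd mindex. theta (1 / (real n + 1)) s \<alpha> \<le> theta r s \<alpha>" if r: "r > 0" for r
      proof -
        obtain n where "inverse (real (Suc n)) < r"
          using reals_Archimedean[OF r] by blast
        then show ?thesis
          by (intro exI[of _ n] allI theta_mono[OF False]) (auto simp: inverse_eq_divide add.commute)
      qed
    qed (simp add: add_nonneg_pos)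
  qed
  show ?thesis
    unfolding A_hat_def
  proof (rule ind_lim_extension[where W = "weight_A s" and R = R, OF p])
    show "weight_A s (R (Suc n)) k \<le> weight_A s (R n) k" for n and k :: "'d mindex \<times> 'd mindex"
      by (rule mono[OF R(2)])
    show "\<exists>n. \<forall>k. weight_A s (R n) k \<le> weight_A s r (k :: 'd mindex \<times> 'd mindex)" if "r > 0" for r
      using R(3)[OF that] mono by blast
  qed (fact adm R(1) one nz fin)+
qed

lemma A0_hat_extension:
  fixes p :: ennreal
  assumes s: "s \<in> R_flat" "Num 0 < s" "s \<le> Num (1/2)" and p: "p > 0"
  shows "uniquely_extends (prod_topology (A0_hat p s) (A0_hat p s)) (A0_hat p s :: ('d::finite) fseries topology)
     (A_fin \<times> A_fin) (\<lambda>(a, b). twisted_aw a b)"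
  unfolding A0_hat_def
proof (rule proj_lim_extension[OF p])
  have s0: "s \<noteq> Num 0" using s(2) by auto
  show "\<exists>r>0. admissible (weight_A s r :: 'd weight) (weight_A s r')" if "r' > 0" for r'
  proof -
    obtain m where m: "m > 0" "absorbs TYPE('d) s m r'"
      using absorbs_stronger[OF s \<open>r' > 0\<close>] by blast
    obtain r where r: "r > 0" "absorbs TYPE('d) s r m"
      using absorbs_stronger[OF s m(1)] by blast
    show ?thesis
      using admissible_weight_A[OF r(2) m(2) m(1) \<open>r' > 0\<close>] r(1) by blast
  qed
  show "weight_A s r (0 :: 'd mindex \<times> 'd mindex) = 1" if "r > 0" for r
    using that by (simp add: weight_A_def zero_prod_def)
  show "weight_A s r k \<noteq> \<infinity>" for r and k :: "'d mindex \<times> 'd mindex"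
    using theta_finite[OF s0] by (auto simp: weight_A_def ennreal_mult_eq_top_iff split: prod.splits)
  show "\<exists>r>0. weight_A s r k \<noteq> 0" for k :: "'d mindex \<times> 'd mindex"
    by (rule exI[of _ 1]) (auto simp: weight_A_def split: prod.splits)
qed

lemma C_extension:
  fixes p :: ennreal
  assumes s: "s \<in> R_flat" "s < Num (1/2)" and p: "p > 0"
  shows "uniquely_extends (ind_square (C_step p s)) (C_hat p s :: ('d::finite) fseries topology) (A_fin \<times> A_fin) (\<lambda>(a, b). twisted_aw a b)"
    and "uniquely_extends (ind_square (C_star_step p s)) (C_star_hat p s :: 'd fseries topology) (A_fin \<times> A_fin) (\<lambda>(a, b). twisted_aw a b)"
proof -
  have fin: "\<exists>r>0. \<forall>t>0. \<forall>k\<in>K. weight_C s r t k \<noteq> \<infinity>" if K: "finite K" for K :: "('d mindex \<times> 'd mindex) set"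
  proof -
    have "finite (fst ` K)" using K by simp
    from theta_finite_on[OF this, of s] obtain r where "r > 0" "\<forall>\<alpha>\<in>fst ` K. theta r s \<alpha> \<noteq> \<infinity>"
      by blast
    then show ?thesis
      using weight_C_finite by (intro exI[of _ r]) blast
  qed
  have nz: "\<exists>t>0. weight_C s r t k \<noteq> 0" if r: "r > 0" for r and k :: "'d mindex \<times> 'd mindex"
  proof -
    obtain t where "t > 0" "theta t s (snd k) \<noteq> \<infinity>"
      using theta_finite_on[of "{snd k}" s] by auto
    then show ?thesis
      using weight_C_nonzero[OF r] by blast
  qed
  show "uniquely_extends (ind_square (C_step p s)) (C_hat p s :: 'd fseries topology) (A_fin \<times> A_fin) (\<lambda>(a, b). twisted_aw a b)"
    unfolding C_hat_def C_step_def[abs_def]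
    by (rule ind_square_extension[OF p weight_C_weaker[OF s] weight_C_one fin nz])
  show "uniquely_extends (ind_square (C_star_step p s)) (C_star_hat p s :: 'd fseries topology) (A_fin \<times> A_fin) (\<lambda>(a, b). twisted_aw a b)"
    unfolding C_star_hat_def C_star_step_def[abs_def]
  proof (rule ind_square_extension[OF p])
    \<comment> \<open>The outer parameter is the last argument of \<open>weight_C_star\<close>,
      which after transposition is the numerator parameter of \<open>weight_C\<close>; hence the
      same choices serve.\<close>
    show "\<exists>r'>0. \<forall>t'>0. \<exists>t>0. admissible (weight_C_star s t r :: 'd weight) (weight_C_star s t' r')"
      if r: "r > 0" for r
    proof -
      obtain r' where r': "r' > 0" "\<forall>t'>0. \<exists>t>0. admissible (weight_C s r t :: 'd weight) (weight_C s r' t')"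
        using weight_C_weaker[OF s r] by blast
      have "\<exists>t>0. admissible (weight_C_star s t r :: 'd weight) (weight_C_star s t' r')" if "t' > 0" for t'
        using r'(2)[rule_format, OF that] by (auto dest: admissible_weight_C_star)
      then show ?thesis
        using r'(1) by blast
    qed
    show "weight_C_star s t r (0 :: 'd mindex \<times> 'd mindex) = 1" if "r > 0" "t > 0" for r t
      using weight_C_one[OF that] by (simp add: weight_C_star_eq zero_prod_def)
    show "\<exists>r>0. \<forall>t>0. \<forall>k\<in>K. weight_C_star s t r k \<noteq> \<infinity>" if "finite K" for K :: "('d mindex \<times> 'd mindex) set"
      using fin[of "prod.swap ` K"] that by (simp add: weight_C_star_eq)
    show "\<exists>t>0. weight_C_star s t r k \<noteq> 0" if "r > 0" for r and k :: "'d mindex \<times> 'd mindex"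
      using nz[OF that] by (simp add: weight_C_star_eq)
  qed
qed

lemma C0_extension:
  fixes p :: ennreal
  assumes s: "s \<in> R_flat" "Num 0 < s" "s \<le> Num (1/2)" and p: "p > 0"
  shows "uniquely_extends (ind_square (C0_step p s)) (C0_hat p s :: ('d::finite) fseries topology) (A_fin \<times> A_fin) (\<lambda>(a, b). twisted_aw a b)"
    and "uniquely_extends (ind_square (C0_star_step p s)) (C0_star_hat p s :: 'd fseries topology) (A_fin \<times> A_fin) (\<lambda>(a, b). twisted_aw a b)"
proof -
  have s0: "s \<noteq> Num 0" using s(2) by auto
  have fin: "weight_C s t r k \<noteq> \<infinity>" if "r > 0" for r t and k :: "'d mindex \<times> 'd mindex"
    using that theta_finite[OF s0] by (intro weight_C_finite)
  have nz: "weight_C s t r k \<noteq> 0" if "t > 0" for r t and k :: "'d mindex \<times> 'd mindex"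
    using that theta_finite[OF s0] by (intro weight_C_nonzero)
  show "uniquely_extends (ind_square (C0_step p s)) (C0_hat p s :: 'd fseries topology) (A_fin \<times> A_fin) (\<lambda>(a, b). twisted_aw a b)"
    unfolding C0_hat_def C0_step_def[abs_def]
  proof (rule ind_square_extension[OF p weight_C_stronger[OF s]])
    show "weight_C s t r (0 :: 'd mindex \<times> 'd mindex) = 1" if "r > 0" "t > 0" for r t
      using weight_C_one[OF that(2,1)] .
    show "\<exists>r>0. \<forall>t>0. \<forall>k\<in>K. weight_C s t r k \<noteq> \<infinity>" for K :: "('d mindex \<times> 'd mindex) set"
      using fin by (intro exI[of _ 1]) simp
    show "\<exists>t>0. weight_C s t r k \<noteq> 0" for r and k :: "'d mindex \<times> 'd mindex"
      using nz by (intro exI[of _ 1]) simp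
  qed
  show "uniquely_extends (ind_square (C0_star_step p s)) (C0_star_hat p s :: 'd fseries topology) (A_fin \<times> A_fin) (\<lambda>(a, b). twisted_aw a b)"
    unfolding C0_star_hat_def C0_star_step_def[abs_def]
  proof (rule ind_square_extension[OF p])
    show "\<exists>r'>0. \<forall>t'>0. \<exists>t>0. admissible (weight_C_star s r t :: 'd weight) (weight_C_star s r' t')"
      if r: "r > 0" for r
    proof -
      obtain r' where r': "r' > 0" "\<forall>t'>0. \<exists>t>0. admissible (weight_C s t r :: 'd weight) (weight_C s t' r')"
        using weight_C_stronger[OF s r] by blast
      have "\<exists>t>0. admissible (weight_C_star s r t :: 'd weight) (weight_C_star s r' t')" if "t' > 0" for t'
        using r'(2)[rule_format, OF that] by (auto dest: admissible_weight_C_star)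
      then show ?thesis
        using r'(1) by blast
    qed
    show "weight_C_star s r t (0 :: 'd mindex \<times> 'd mindex) = 1" if "r > 0" "t > 0" for r t
      using weight_C_one[OF that(2,1)] by (simp add: weight_C_star_eq zero_prod_def)
    show "\<exists>r>0. \<forall>t>0. \<forall>k\<in>K. weight_C_star s r t k \<noteq> \<infinity>" for K :: "('d mindex \<times> 'd mindex) set"
      using fin by (intro exI[of _ 1]) (simp add: weight_C_star_eq)
    show "\<exists>t>0. weight_C_star s r t k \<noteq> 0" for r and k :: "'d mindex \<times> 'd mindex"
      using nz by (intro exI[of _ 1]) (simp add: weight_C_star_eq)
  qed
qed

theorem theorem4p18:
  fixes s :: flat_index and p :: ennreal
    and T_aw :: "('d::finite) fseries \<times> 'd fseries \<Rightarrow> 'd fseries"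
  assumes "s \<in> R_flat" and "p > 0"
  defines "T_aw \<equiv> \<lambda>(a1, a2). twisted_aw a1 a2"
  shows "(s < Num (1/2) \<longrightarrow>
            uniquely_extends (prod_topology (A_hat p s) (A_hat p s)) (A_hat p s) (A_fin \<times> A_fin) T_aw \<and>
            uniquely_extends (ind_square (C_step p s)) (C_hat p s) (A_fin \<times> A_fin) T_aw \<and>
            uniquely_extends (ind_square (C_star_step p s)) (C_star_hat p s) (A_fin \<times> A_fin) T_aw) \<and>
         (Num 0 < s \<and> s \<le> Num (1/2) \<longrightarrow>
            uniquely_extends (prod_topology (A0_hat p s) (A0_hat p s)) (A0_hat p s) (A_fin \<times> A_fin) T_aw \<and>
            uniquely_extends (ind_square (C0_step p s)) (C0_hat p s) (A_fin \<times> A_fin) T_aw \<and>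
            uniquely_extends (ind_square (C0_star_step p s)) (C0_star_hat p s) (A_fin \<times> A_fin) T_aw)"
  unfolding T_aw_def
  by (intro conjI impI; (elim conjE)?; intro A_hat_extension C_extension A0_hat_extension C0_extension assms)

end
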